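(* Let $S$ be a smooth $\mathbb{R}^{n''}$-valued map defined on a neighborhood of the origin in $\mathbb{R}^{n'}\times\mathbb{R}^{n''}\times\mathbb{R}^{n'}$, let $\psi$ be a cutoff function, and let $$Tf(x',x'') = \int f(y',x''+S(x',x'',y'))\,\psi(x',x'',y')\,dy'.$$ Suppose that $T$ satisfies the homogeneity conditions with multiindices $\alpha',\alpha'',\beta',\beta''$ and the rank condition with positive integer $r$ (both defined in the context), that $\frac{r}{n''}>\frac{|\alpha'|+|\beta'|}{|\beta''|}$, and that the support of $\psi$ is sufficiently near the origin. If $s\ge 0$, $1<p<\infty$ and $T$ maps $L^p(\mathbb{R}^n)$ to the Sobolev space $L^p_s(\mathbb{R}^n)$, $n=n'+n''$, then necessarily $$s\max\{\beta''_1,\dots,\beta''_{n''}\}\le\frac{|\alpha'|}{p}+|\beta'|\left(1-\frac1p\right).$$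
   Context: Fix positive integers $n',n''$. Points are $x',y'\in\mathbb{R}^{n'}$, $x''\in\mathbb{R}^{n''}$. A cutoff function here is a smooth function $\psi(x',x'',y')$ with compact support near the origin, inside the domain of $S$. A multiindex is a tuple of integers. For a multiindex $\gamma=(\gamma_1,\dots,\gamma_m)$, $z\in\mathbb{R}^m$ and an integer $j$, write $2^{j\gamma}z:=(2^{j\gamma_1}z_1,\dots,2^{j\gamma_m}z_m)$ and $|\gamma|:=\gamma_1+\cdots+\gamma_m$. Homogeneity conditions: there are multiindices $\alpha',\beta'$ of length $n'$ and $\alpha'',\beta''$ of length $n''$ such that $\beta''_i>\alpha''_i$ for all $i=1,\dots,n''$, and such that the limit $$S^P(x',x'',y'):=\lim_{j\to\infty}2^{j\beta''}S(2^{-j\alpha'}x',2^{-j\alpha''}x'',2^{-j\beta'}y')$$ exists and is a smooth function of $x',x'',y'$ which does not vanish identically. Rank condition: let $H^P(x',x'',y',\eta'')$ be the $n'\times n'$ mixed Hessian matrix with $(i,j)$-entry $\frac{\partial^2}{\partial x'_i\,\partial y'_j}\big(\eta''\cdot S^P(x',x'',y')\big)$. The rank condition with positive integer $r$ says that $H^P(x',x'',y',\eta'')$ has rank at least $r$ at each point $(x',x'',y')\neq(0,0,0)$ and for each $\eta''\in\mathbb{R}^{n''}\setminus\{0\}$. $L^p_s(\mathbb{R}^n)$ is the usual Sobolev space of functions with $s$ derivatives in $L^p$.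
   Formalization: The cutoff is assumed nonzero at the origin (for ψ = 0, T = 0 and the claim fails), and the entries of α', α'', β' are assumed positive (otherwise the limit defining S^P need not make sense, and the claim can fail for globally defined S). *)

theory Defs
  imports "HOL-Analysis.Analysis"
begin

subsection \<open>Smooth maps\<close>

primrec higher_differentiable_on ::
  "nat \<Rightarrow> 'a::real_normed_vector set \<Rightarrow> ('a \<Rightarrow> 'b::real_normed_vector) \<Rightarrow> bool"
where
  "higher_differentiable_on 0 U f \<longleftrightarrow> continuous_on U f"
| "higher_differentiable_on (Suc k) U f \<longleftrightarrow>
     (\<forall>x\<in>U. f differentiable at x) \<and>
     (\<forall>v. higher_differentiable_on k U (\<lambda>x. frechet_derivative f (at x) v))"

text \<open>Meant for open sets \<open>U\<close> only, since \<open>at x\<close> looks at a full neighbourhood of \<open>x\<close>.\<close>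

definition smooth_on ::
  "'a::real_normed_vector set \<Rightarrow> ('a \<Rightarrow> 'b::real_normed_vector) \<Rightarrow> bool"
where
  "smooth_on U f \<longleftrightarrow> (\<forall>k. higher_differentiable_on k U f)"

subsection \<open>Lebesgue and Sobolev spaces\<close>

text \<open>Elements are representatives; functions that agree almost everywhere are not identified.\<close>

definition Lp_space :: "real \<Rightarrow> ('a::euclidean_space \<Rightarrow> complex) set" where
  "Lp_space p = {f \<in> borel_measurable lborel. integrable lborel (\<lambda>x. norm (f x) powr p)}"

text \<open>
  For \<open>s > 0\<close> the Bessel kernel is the integrable convolution kernel of the Fourier multiplier
  operator \<open>(I - \<Delta>) powr (- s / 2)\<close>, obtained by integrating the heat kernel
  \<open>(4 \<pi> t) powr (- n / 2) * exp (- \<bar>x\<bar>^2 / (4 t))\<close> of \<open>\<real>^n\<close>. The Sobolev space of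
  functions with \<open>s\<close> derivatives in \<open>L^p\<close> (\<open>s\<close> real) is the image of \<open>L^p\<close> under that operator;
  for integer \<open>s\<close> and \<open>1 < p < \<infinity>\<close> this is the classical space defined by weak derivatives.
\<close>

definition bessel_kernel :: "real \<Rightarrow> 'a::euclidean_space \<Rightarrow> real" where
  "bessel_kernel s x =
     (LBINT t:{0<..}. t powr (s / 2 - 1) * exp (- t) *
        ((4 * pi * t) powr (- real DIM('a) / 2) * exp (- (norm x)\<^sup>2 / (4 * t)))) / Gamma (s / 2)"

definition bessel_potential ::
  "real \<Rightarrow> ('a::euclidean_space \<Rightarrow> complex) \<Rightarrow> 'a \<Rightarrow> complex"
where
  "bessel_potential s g x =
     (if s = 0 then g x else (LINT y|lborel. bessel_kernel s (x - y) *\<^sub>R g y))"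

definition Sobolev_space :: "real \<Rightarrow> real \<Rightarrow> ('a::euclidean_space \<Rightarrow> complex) set" where
  "Sobolev_space s p =
     {h \<in> borel_measurable lborel. \<exists>g\<in>Lp_space p. AE x in lborel. h x = bessel_potential s g x}"

subsection \<open>The averaging operator\<close>

text \<open>
  A point \<open>(x', x'', y')\<close> is an element of \<open>(real^'m) \<times> (real^'k) \<times> (real^'m)\<close>, with
  \<open>n' = CARD('m)\<close> and \<open>n'' = CARD('k)\<close>.
  A cutoff may vanish at the origin, even identically; lower bounds for the averaging operator need
  \<open>\<psi> 0 \<noteq> 0\<close> in addition.
\<close>

definition cutoff ::
  "((real^'m) \<times> (real^'k) \<times> (real^'m)) set \<Rightarrow> ((real^'m) \<times> (real^'k) \<times> (real^'m) \<Rightarrow> complex) \<Rightarrow> bool"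
where
  "cutoff U \<psi> \<longleftrightarrow>
     smooth_on UNIV \<psi> \<and> compact (closure {z. \<psi> z \<noteq> 0}) \<and> closure {z. \<psi> z \<noteq> 0} \<subseteq> U"

definition averaging_op ::
  "((real^'m) \<times> (real^'k) \<times> (real^'m) \<Rightarrow> (real^'k)) \<Rightarrow> ((real^'m) \<times> (real^'k) \<times> (real^'m) \<Rightarrow> complex) \<Rightarrow>
   ((real^'m) \<times> (real^'k) \<Rightarrow> complex) \<Rightarrow> (real^'m) \<times> (real^'k) \<Rightarrow> complex"
where
  "averaging_op S \<psi> f =
     (\<lambda>(x', x''). LINT y'|lborel. f (y', x'' + S (x', x'', y')) * \<psi> (x', x'', y'))"

subsection \<open>Homogeneity and rank conditions\<close>

definition dilate :: "int \<Rightarrow> int^'n \<Rightarrow> real^'n \<Rightarrow> real^'n" where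
  "dilate j \<gamma> z = (\<chi> i. 2 powi (j * \<gamma> $ i) * z $ i)"

definition msize :: "int^'n \<Rightarrow> int" where
  "msize \<gamma> = (\<Sum>i\<in>UNIV. \<gamma> $ i)"

text \<open>
  \<open>S\<close> is only given near the origin, so the limit makes sense at every point only if the dilations
  contract all of space to the origin, that is, if \<open>\<alpha>'\<close>, \<open>\<alpha>''\<close> and \<open>\<beta>'\<close> have positive
  entries (and then so has \<open>\<beta>''\<close>). Values of \<open>S\<close> away from the origin are then irrelevant.
\<close>

definition homogeneity_conditions ::
  "((real^'m) \<times> (real^'k) \<times> (real^'m) \<Rightarrow> (real^'k)) \<Rightarrow> (int^'m) \<Rightarrow> (int^'k) \<Rightarrow> (int^'m) \<Rightarrow> (int^'k) \<Rightarrow>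
   ((real^'m) \<times> (real^'k) \<times> (real^'m) \<Rightarrow> (real^'k)) \<Rightarrow> bool"
where
  "homogeneity_conditions S \<alpha>' \<alpha>'' \<beta>' \<beta>'' SP \<longleftrightarrow>
     (\<forall>i. 0 < \<alpha>' $ i) \<and> (\<forall>i. 0 < \<alpha>'' $ i) \<and> (\<forall>i. 0 < \<beta>' $ i) \<and>
     (\<forall>i. \<alpha>'' $ i < \<beta>'' $ i) \<and>
     (\<forall>x' x'' y'.
        (\<lambda>j::nat. dilate (int j) \<beta>''
           (S (dilate (- int j) \<alpha>' x', dilate (- int j) \<alpha>'' x'', dilate (- int j) \<beta>' y')))
        \<longlonglongrightarrow> SP (x', x'', y')) \<and>
     smooth_on UNIV SP \<and>
     (\<exists>z. SP z \<noteq> 0)"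

definition mixed_hessian ::
  "((real^'m) \<times> (real^'k) \<times> (real^'m) \<Rightarrow> (real^'k)) \<Rightarrow> (real^'m) \<times> (real^'k) \<times> (real^'m) \<Rightarrow> (real^'k) \<Rightarrow> real^'m^'m"
where
  "mixed_hessian SP z \<eta> =
     (\<chi> i j. frechet_derivative
               (\<lambda>w. frechet_derivative (\<lambda>v. \<eta> \<bullet> SP v) (at w) (0, 0, axis j 1))
               (at z) (axis i 1, 0, 0))"

definition rank_condition ::
  "((real^'m) \<times> (real^'k) \<times> (real^'m) \<Rightarrow> (real^'k)) \<Rightarrow> nat \<Rightarrow> bool"
where
  "rank_condition SP r \<longleftrightarrow> (\<forall>z \<eta>. z \<noteq> 0 \<longrightarrow> \<eta> \<noteq> 0 \<longrightarrow> r \<le> rank (mixed_hessian SP z \<eta>))"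

end

theory Submission
  imports Defs "HOL-Probability.Distributions"
begin

text \<open>
  Fix \<open>k\<close>, put \<open>N = 2^(j \<beta>''\<^sub>k)\<close>, and let \<open>f\<^sub>j(y', y'')\<close> be \<open>exp(i N y''\<^sub>k)\<close> cut off to \<open>y'\<close> in the box of
  scale \<open>2^(-j \<beta>')\<close> and \<open>y''\<close> in a box of scale \<open>2^(-j \<alpha>'')\<close>. On the box of scale \<open>2^(-j \<alpha>'), 2^(-j \<alpha>'')\<close> in \<open>x\<close>,
  homogeneity and dominated convergence show that \<open>T f\<^sub>j\<close> is \<open>2^(-j \<bar>\<beta>'\<bar>) exp(i N x''\<^sub>k)\<close> times a function with
  a nonzero limit. Since \<open>\<beta>''\<^sub>k > \<alpha>''\<^sub>k\<close>, the oscillation is fast at this scale, and an \<open>L\<close>-fold difference of \<open>T f\<^sub>j\<close> in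
  \<open>x''\<^sub>k\<close> with step \<open>h = \<pi>/N\<close> is about \<open>2^L\<close> times as large as \<open>T f\<^sub>j\<close>. For functions in the Sobolev space of
  order \<open>s < L\<close> such differences are \<open>O(h^s)\<close>, because the \<open>L\<close>-fold difference of the Bessel kernel has
  \<open>L\<^sup>1\<close> norm \<open>O(h^s)\<close>. Comparing the powers of \<open>2^j\<close> gives the
  bound. As the operator is not assumed bounded, the comparison is made for one lacunary sum of
  multiples of the \<open>f\<^sub>j\<close> (a gliding hump).
\<close>

subsection \<open>Finite differences of Gaussians\<close>

text \<open>Membership of T f in the Sobolev space gives a constant for each f separately, and T is
  built from a map that is only known near the origin, so no continuity in f is at hand to make
  these constants uniform. The lacunary sum is therefore treated exactly: earlier pieces are
  absorbed through their own constants, and later pieces must vanish identically where the j-th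
  piece is tested. For this the boxes of the f_j keep y''_k above a positive multiple of 2^(-j
  \<alpha>''_k), while f_i tends to the hyperplane y''_k = 0 as i grows; on the testing region x''_k
  + S_k then has to stay away from 0. That takes a bound on S uniform over the region, whereas
  homogeneity is a pointwise limit; Baire's theorem closes this gap on a smaller ball. The exponent
  p enters only through volumes of boxes: the norm of f_j is of size 2^(-j(|\<beta>'| +
  |\<alpha>''|)/p), the dual function costs 2^(-j(|\<alpha>'| + |\<alpha>''|)(1 - 1/p)), and the
  pairing of T f_j carries 2^(-j(|\<alpha>'| + |\<alpha>''| + |\<beta>'|)). In the comparison
  |\<alpha>''| cancels.\<close>

lemma poly_le_exp_square:
  fixes P :: "real poly" and c :: real
  assumes "c > 0"
  shows "\<exists>C\<ge>0. \<forall>u. \<bar>poly P u\<bar> \<le> C * exp (c * u\<^sup>2)"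
  using assms
proof (induction P arbitrary: c)
  case 0
  then show ?case by (intro exI[of _ 0]) auto
next
  case (pCons a P)
  \<comment> \<open>Half of the exponent is reserved for the linear factor u and half for the
    remaining polynomial; this is why c has to be arbitrary in the induction.\<close>
  from pCons.IH[of "c/2"] pCons.prems obtain C where C: "C \<ge> 0" "\<And>u. \<bar>poly P u\<bar> \<le> C * exp (c/2 * u\<^sup>2)"
    by auto
  have "\<bar>poly (pCons a P) u\<bar> \<le> (\<bar>a\<bar> + (1 + 2/c) * C) * exp (c * u\<^sup>2)" for u
  proof -
    have "\<bar>u\<bar> \<le> 1 + u\<^sup>2"
      using sum_squares_ge_zero[of "\<bar>u\<bar> - 1" "\<bar>u\<bar>"] zero_le_power2[of "\<bar>u\<bar> - 1"]
      by (simp add: power2_eq_square algebra_simps)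
    also have "\<dots> \<le> (1 + 2/c) * exp (c/2 * u\<^sup>2)"
    proof -
      have e: "exp (c/2 * u\<^sup>2) \<ge> 1 + c/2*u\<^sup>2" by (rule exp_ge_add_one_self)
      have "1 + u\<^sup>2 \<le> (1 + 2/c) * (1 + c/2*u\<^sup>2)"
        using pCons.prems by (simp add: field_simps)
      also have "\<dots> \<le> (1 + 2/c) * exp (c/2 * u\<^sup>2)"
        using e pCons.prems by (intro mult_left_mono) auto
      finally show ?thesis .
    qed
    finally have u: "\<bar>u\<bar> \<le> (1 + 2/c) * exp (c/2 * u\<^sup>2)" .
    have "\<bar>poly (pCons a P) u\<bar> \<le> \<bar>a\<bar> * 1 + \<bar>u\<bar> * \<bar>poly P u\<bar>"
      by (simp add: abs_mult[symmetric])
    also have "\<dots> \<le> \<bar>a\<bar> * exp (c * u\<^sup>2) + ((1 + 2/c) * exp (c/2 * u\<^sup>2)) * (C * exp (c/2 * u\<^sup>2))"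
      using u C pCons.prems by (intro add_mono mult_mono) auto
    also have "\<dots> = (\<bar>a\<bar> + (1 + 2/c) * C) * exp (c * u\<^sup>2)"
      by (simp add: algebra_simps flip: exp_add)
    finally show ?thesis .
  qed
  moreover have "\<bar>a\<bar> + (1 + 2/c) * C \<ge> 0" using C pCons.prems by simp
  ultimately show ?case by blast
qed

lemma integrable_exp_neg_norm_square:
  fixes c :: real
  assumes "c > 0"
  shows "integrable lborel (\<lambda>x::'a::euclidean_space. exp (- c * (norm x)\<^sup>2))"
proof (rule integrableI_nonneg)
  \<comment> \<open>For this deviation the normal density is a constant multiple of
    \<open>exp (- c * u\<^sup>2)\<close>; the case of several variables is then a product over
    \<open>Basis\<close>.\<close>
  define \<sigma> where "\<sigma> = 1 / sqrt (2*c)"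
  have s: "\<sigma> > 0" "2 * \<sigma>\<^sup>2 = 1/c" using assms by (auto simp: \<sigma>_def power_divide)
  have "integrable lborel (\<lambda>u::real. sqrt (2 * pi * \<sigma>\<^sup>2) * normal_density 0 \<sigma> u)"
    using s by (intro integrable_mult_right) simp
  moreover have "sqrt (2 * pi * \<sigma>\<^sup>2) * normal_density 0 \<sigma> u = exp (- c * u\<^sup>2)" for u
    using s by (simp add: normal_density_def mult.commute)
  ultimately have "integrable lborel (\<lambda>u::real. exp (- c * u\<^sup>2))" by simp
  then have fin: "(\<integral>\<^sup>+u. ennreal (exp (- c * u\<^sup>2)) \<partial>lborel) < \<infinity>"
    by (subst (asm) integrable_iff_bounded) simp
  have "(\<integral>\<^sup>+x. ennreal (exp (- c * (norm x)\<^sup>2)) \<partial>(lborel::'a measure))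
      = (\<integral>\<^sup>+x. (\<Prod>b\<in>Basis. ennreal (exp (- c * (x \<bullet> b)\<^sup>2))) \<partial>(lborel::'a measure))"
  proof (intro nn_integral_cong)
    fix x :: 'a
    have "- c * (norm x)\<^sup>2 = (\<Sum>b\<in>Basis. - c * (x \<bullet> b)\<^sup>2)"
      unfolding power2_norm_eq_inner
      by (subst euclidean_inner) (simp add: sum_distrib_left power2_eq_square)
    then show "ennreal (exp (- c * (norm x)\<^sup>2)) = (\<Prod>b\<in>Basis. ennreal (exp (- c * (x \<bullet> b)\<^sup>2)))"
      by (simp add: prod_ennreal exp_sum)
  qed
  also have "\<dots> = (\<Prod>b\<in>(Basis::'a set). \<integral>\<^sup>+u. ennreal (exp (- c * u\<^sup>2)) \<partial>lborel)"
    by (rule nn_integral_lborel_prod) auto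
  also have "\<dots> < \<infinity>"
    using fin unfolding prod_constant infinity_ennreal_def power_less_top_ennreal by simp
  finally show "(\<integral>\<^sup>+x. ennreal (exp (- c * (norm x)\<^sup>2)) \<partial>(lborel::'a measure)) < \<infinity>" .
qed auto

lemma nn_integral_lborel_shift:
  fixes f :: "'a::euclidean_space \<Rightarrow> ennreal"
  assumes [measurable]: "f \<in> borel_measurable borel"
  shows "(\<integral>\<^sup>+x. f (x + a) \<partial>lborel) = (\<integral>\<^sup>+x. f x \<partial>lborel)"
proof -
  have "(\<integral>\<^sup>+x. f x \<partial>lborel) = (\<integral>\<^sup>+x. f x \<partial>(distr lborel borel ((+) a)))"
    by (simp add: lborel_distr_plus)
  also have "\<dots> = (\<integral>\<^sup>+x. f (x + a) \<partial>lborel)"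
    by (subst nn_integral_distr) (auto simp: add.commute)
  finally show ?thesis by simp
qed

lemma integrable_gaussian_poly:
  fixes e :: "'a::euclidean_space"
  shows "integrable lborel (\<lambda>x::'a. poly P (x \<bullet> e) * exp (- (norm x)\<^sup>2 / 4))"
proof -
  \<comment> \<open>Chosen so that \<open>c * (x \<bullet> e)\<^sup>2\<close> is at most |x|^2 / 8
    by Cauchy-Schwarz: the polynomial uses up half of the exponent 1/4 and an integrable Gaussian
    remains.\<close>
  define c where "c = 1 / (8 * (1 + (norm e)\<^sup>2))"
  have c: "c > 0" by (simp add: c_def add_pos_nonneg)
  obtain C where C: "C \<ge> 0" "\<And>u. \<bar>poly P u\<bar> \<le> C * exp (c * u\<^sup>2)"
    using poly_le_exp_square[OF c] by blast
  have "integrable lborel (\<lambda>x::'a. C * exp (- (1/8) * (norm x)\<^sup>2))"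
    by (intro integrable_mult_right integrable_exp_neg_norm_square) auto
  then show ?thesis
  proof (rule Bochner_Integration.integrable_bound)
    show "AE x in lborel. norm (poly P (x \<bullet> e) * exp (- (norm x)\<^sup>2 / 4)) \<le> norm (C * exp (- (1/8) * (norm x)\<^sup>2))"
    proof (intro AE_I2)
      fix x :: 'a
      have "(x \<bullet> e)\<^sup>2 \<le> (norm x)\<^sup>2 * (norm e)\<^sup>2"
        using Cauchy_Schwarz_ineq[of x e] by (simp add: power2_norm_eq_inner)
      also have "\<dots> \<le> (norm x)\<^sup>2 * (1 + (norm e)\<^sup>2)" by (intro mult_left_mono) auto
      finally have "c * (x \<bullet> e)\<^sup>2 \<le> c * ((norm x)\<^sup>2 * (1 + (norm e)\<^sup>2))"
        using c by (intro mult_left_mono) auto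
      also have "\<dots> = (norm x)\<^sup>2 / 8"
      proof -
        have "1 + (norm e)\<^sup>2 \<noteq> 0" using zero_le_power2[of "norm e"] by linarith
        then show ?thesis unfolding c_def by (simp add: divide_simps)
      qed
      finally have *: "c * (x \<bullet> e)\<^sup>2 \<le> (norm x)\<^sup>2 / 8" .
      have "\<bar>poly P (x \<bullet> e)\<bar> \<le> C * exp ((norm x)\<^sup>2 / 8)"
        by (rule order_trans[OF C(2)]) (use * C(1) in \<open>auto intro!: mult_left_mono\<close>)
      then have "\<bar>poly P (x \<bullet> e)\<bar> * exp (- (norm x)\<^sup>2 / 4) \<le> C * exp ((norm x)\<^sup>2 / 8) * exp (- (norm x)\<^sup>2 / 4)"
        by (intro mult_right_mono) auto
      also have "\<dots> = C * exp (- (1/8) * (norm x)\<^sup>2)"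
        by (simp flip: exp_add)
      finally show "norm (poly P (x \<bullet> e) * exp (- (norm x)\<^sup>2 / 4)) \<le> norm (C * exp (- (1/8) * (norm x)\<^sup>2))"
        using C(1) by (simp add: abs_mult)
    qed
  qed (auto intro!: borel_measurable_continuous_onI continuous_intros)
qed

text \<open>The increment is the integral of the derivative over a segment of length \<tau>. After
  an exchange of integrals, translation invariance makes every point of the segment contribute the
  same integral of |g'|.\<close>

lemma nn_integral_difference_le:
  fixes g g' :: "'a::euclidean_space \<Rightarrow> real" and e :: 'a
  assumes deriv: "\<And>x v. ((\<lambda>v. g (x + v *\<^sub>R e)) has_real_derivative g' (x + v *\<^sub>R e)) (at v)"
    and cont: "continuous_on UNIV g" "continuous_on UNIV g'" and "\<tau> \<ge> 0"
  shows "(\<integral>\<^sup>+x. ennreal \<bar>g (x + \<tau> *\<^sub>R e) - g x\<bar> \<partial>lborel) \<le> ennreal \<tau> * (\<integral>\<^sup>+x. ennreal \<bar>g' x\<bar> \<partial>lborel)"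
proof -
  have [measurable]: "g \<in> borel_measurable borel" "g' \<in> borel_measurable borel"
    using cont by (auto intro: borel_measurable_continuous_onI)
  have *: "ennreal \<bar>g (x + \<tau> *\<^sub>R e) - g x\<bar> \<le> (\<integral>\<^sup>+v. ennreal \<bar>g' (x + v *\<^sub>R e)\<bar> * indicator {0..\<tau>} v \<partial>lborel)" for x
  proof -
    have c: "continuous_on {0..\<tau>} (\<lambda>v. g' (x + v *\<^sub>R e))"
      by (intro continuous_on_compose2[OF cont(2)] continuous_intros) auto
    have "((\<lambda>v. g' (x + v *\<^sub>R e)) has_integral (g (x + \<tau> *\<^sub>R e) - g (x + 0 *\<^sub>R e))) {0..\<tau>}"
      using \<open>\<tau> \<ge> 0\<close> deriv
      by (intro fundamental_theorem_of_calculus)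
         (auto simp: has_real_derivative_iff_has_vector_derivative[symmetric] intro: DERIV_subset)
    then have "\<bar>g (x + \<tau> *\<^sub>R e) - g x\<bar> = \<bar>integral {0..\<tau>} (\<lambda>v. g' (x + v *\<^sub>R e))\<bar>"
      by (simp add: integral_unique)
    also have "\<dots> \<le> integral {0..\<tau>} (\<lambda>v. \<bar>g' (x + v *\<^sub>R e)\<bar>)"
    proof -
      have "(\<lambda>v. g' (x + v *\<^sub>R e)) integrable_on {0..\<tau>}" "(\<lambda>v. \<bar>g' (x + v *\<^sub>R e)\<bar>) integrable_on {0..\<tau>}"
        using c by (auto intro!: integrable_continuous_interval continuous_intros)
      from integral_norm_bound_integral[OF this] show ?thesis by auto
    qed
    also have "ennreal \<dots> = (\<integral>\<^sup>+v. ennreal \<bar>g' (x + v *\<^sub>R e)\<bar> * indicator {0..\<tau>} v \<partial>lborel)"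
    proof -
      have "((\<lambda>v. \<bar>g' (x + v *\<^sub>R e)\<bar>) has_integral integral {0..\<tau>} (\<lambda>v. \<bar>g' (x + v *\<^sub>R e)\<bar>)) {0..\<tau>}"
        using c by (intro integrable_integral integrable_continuous_interval continuous_intros) auto
      from nn_integral_has_integral_lebesgue[OF _ this]
      have "(\<integral>\<^sup>+v. ennreal (indicator {0..\<tau>} v * \<bar>g' (x + v *\<^sub>R e)\<bar>) \<partial>lborel)
          = ennreal (integral {0..\<tau>} (\<lambda>v. \<bar>g' (x + v *\<^sub>R e)\<bar>))"
        by simp
      then show ?thesis
        by (simp add: ennreal_mult ennreal_indicator mult.commute)
    qed
    finally show ?thesis by (simp add: ennreal_leI)
  qed
  have "(\<integral>\<^sup>+x. ennreal \<bar>g (x + \<tau> *\<^sub>R e) - g x\<bar> \<partial>lborel)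
     \<le> (\<integral>\<^sup>+x. \<integral>\<^sup>+v. ennreal \<bar>g' (x + v *\<^sub>R e)\<bar> * indicator {0..\<tau>} v \<partial>lborel \<partial>lborel)"
    by (intro nn_integral_mono *)
  also have "\<dots> = (\<integral>\<^sup>+v. \<integral>\<^sup>+x. ennreal \<bar>g' (x + v *\<^sub>R e)\<bar> * indicator {0..\<tau>} v \<partial>lborel \<partial>lborel)"
    by (rule lborel_pair.Fubini') measurable
  also have "\<dots> = (\<integral>\<^sup>+v. (\<integral>\<^sup>+x. ennreal \<bar>g' x\<bar> \<partial>lborel) * indicator {0..\<tau>} v \<partial>lborel)"
    by (simp add: nn_integral_multc nn_integral_lborel_shift[of "\<lambda>x. ennreal \<bar>g' x\<bar>"])
  also have "\<dots> = (\<integral>\<^sup>+x. ennreal \<bar>g' x\<bar> \<partial>lborel) * ennreal \<tau>"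
    using \<open>\<tau> \<ge> 0\<close> by (simp add: nn_integral_cmult)
  finally show ?thesis by (simp add: mult.commute)
qed

text \<open>Pascal's rule, stated for an arbitrary sequence so that it becomes the recursion (I -
  A)^(L+1) = (I - A)^L - (I - A)^L A for the translation A.\<close>

lemma sum_binomial_Suc_shift:
  fixes a :: "nat \<Rightarrow> 'b::comm_ring_1"
  shows "(\<Sum>l\<le>Suc L. (-1)^l * of_nat (Suc L choose l) * a l)
       = (\<Sum>l\<le>L. (-1)^l * of_nat (L choose l) * a l) - (\<Sum>l\<le>L. (-1)^l * of_nat (L choose l) * a (Suc l))"
proof -
  have "(\<Sum>l\<le>Suc L. (-1)^l * of_nat (Suc L choose l) * a l)
      = a 0 + (\<Sum>l\<le>L. (-1)^Suc l * of_nat (Suc L choose Suc l) * a (Suc l))"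
    by (subst sum.atMost_Suc_shift) simp
  also have "\<dots> = a 0 + (\<Sum>l\<le>L. (-1)^Suc l * of_nat (L choose Suc l) * a (Suc l))
                 - (\<Sum>l\<le>L. (-1)^l * of_nat (L choose l) * a (Suc l))"
    by (simp add: algebra_simps sum.distrib sum_negf sum_subtractf)
  also have "a 0 + (\<Sum>l\<le>L. (-1)^Suc l * of_nat (L choose Suc l) * a (Suc l))
      = (\<Sum>l\<le>Suc L. (-1)^l * of_nat (L choose l) * a l)"
    by (subst sum.atMost_Suc_shift) simp
  also have "\<dots> = (\<Sum>l\<le>L. (-1)^l * of_nat (L choose l) * a l)" by (simp add: binomial_eq_0)
  finally show ?thesis .
qed

text \<open>This is (I - A)^L with A the translation by h, so g x itself has coefficient 1. The
  usual forward difference differs from it by the sign (-1)^L.\<close>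

definition finite_difference :: "nat \<Rightarrow> 'a::real_vector \<Rightarrow> ('a \<Rightarrow> 'b::real_vector) \<Rightarrow> 'a \<Rightarrow> 'b" where
  "finite_difference L h g x = (\<Sum>l\<le>L. ((-1)^l * real (L choose l)) *\<^sub>R g (x + real l *\<^sub>R h))"

lemma finite_difference_0 [simp]: "finite_difference 0 h g x = g x"
  by (simp add: finite_difference_def)

lemma finite_difference_Suc:
  fixes g :: "'a::real_vector \<Rightarrow> real"
  shows "finite_difference (Suc L) h g x = finite_difference L h g x - finite_difference L h g (x + h)"
  unfolding finite_difference_def real_scaleR_def
  using sum_binomial_Suc_shift[of L "\<lambda>l. g (x + real l *\<^sub>R h)"]
  by (simp add: algebra_simps)

text \<open>The class of polynomials in x \<bullet> e times the Gaussian is closed under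
  differentiation along e, and differences commute with that derivative. Hence each order of the
  difference can be traded for one derivative and one factor \<tau>. The polynomial is there only to
  keep the induction inside this class.\<close>

lemma nn_integral_gaussian_difference_le:
  fixes e :: "'a::euclidean_space"
  assumes e: "norm e = 1"
  shows "\<exists>C\<ge>0. \<forall>\<tau>\<ge>0. (\<integral>\<^sup>+x. ennreal \<bar>finite_difference L (\<tau> *\<^sub>R e) (\<lambda>x. poly P (x \<bullet> e) * exp (- (norm x)\<^sup>2 / 4)) x\<bar> \<partial>(lborel::'a measure))
            \<le> ennreal (C * \<tau> ^ L)"
proof (induction L arbitrary: P)
  case 0
  let ?g = "\<lambda>x::'a. \<bar>poly P (x \<bullet> e) * exp (- (norm x)\<^sup>2 / 4)\<bar>"
  have "integrable lborel ?g"
    by (intro integrable_abs integrable_gaussian_poly)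
  then have "(\<integral>\<^sup>+x. ennreal (?g x) \<partial>lborel) = ennreal (\<integral>x. ?g x \<partial>lborel)"
    by (intro nn_integral_eq_integral) auto
  then show ?case by (intro exI[of _ "\<integral>x. ?g x \<partial>lborel"]) auto
next
  case (Suc L)
  \<comment> \<open>The factor u / 2 comes from differentiating exp(-|x|^2 / 4) along the unit
    vector e.\<close>
  define Q where "Q = pderiv P - [:0, 1/2:] * P"
  define g where "g = (\<lambda>(P :: real poly) (x::'a). poly P (x \<bullet> e) * exp (- (norm x)\<^sup>2 / 4))"
  obtain C where C: "C \<ge> 0"
      "\<And>\<tau>. \<tau> \<ge> 0 \<Longrightarrow> (\<integral>\<^sup>+x. ennreal \<bar>finite_difference L (\<tau> *\<^sub>R e) (g Q) x\<bar> \<partial>(lborel::'a measure)) \<le> ennreal (C * \<tau> ^ L)"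
    using Suc.IH[of Q] unfolding g_def by blast
  have cont: "continuous_on UNIV (g R)" for R
    unfolding g_def by (intro continuous_intros) auto
  have der: "((\<lambda>v. g P (x + v *\<^sub>R e)) has_real_derivative g Q (x + v *\<^sub>R e)) (at v)" for x v
  proof -
    have ee: "e \<bullet> e = 1" using e by (simp add: norm_eq_1)
    have eq: "g P (x + v *\<^sub>R e) = poly P (x \<bullet> e + v) * exp (- (x \<bullet> x + 2 * v * (x \<bullet> e) + v\<^sup>2) / 4)" for v
      unfolding g_def power2_norm_eq_inner
      by (simp add: inner_add_left inner_add_right ee inner_commute power2_eq_square algebra_simps)
    have eq': "g Q (x + v *\<^sub>R e) = poly Q (x \<bullet> e + v) * exp (- (x \<bullet> x + 2 * v * (x \<bullet> e) + v\<^sup>2) / 4)"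
      unfolding g_def power2_norm_eq_inner
      by (simp add: inner_add_left inner_add_right ee inner_commute power2_eq_square algebra_simps)
    show ?thesis
      unfolding eq eq' unfolding Q_def
      by (auto intro!: derivative_eq_intros simp: field_simps power2_eq_square)
  qed
  have "(\<integral>\<^sup>+x. ennreal \<bar>finite_difference (Suc L) (\<tau> *\<^sub>R e) (g P) x\<bar> \<partial>(lborel::'a measure)) \<le> ennreal (C * \<tau> ^ Suc L)"
    if "\<tau> \<ge> 0" for \<tau>
  proof -
    let ?G = "\<lambda>R. finite_difference L (\<tau> *\<^sub>R e) (g R)"
    have contG: "continuous_on UNIV (?G R)" for R
      unfolding finite_difference_def
      by (intro continuous_intros continuous_on_compose2[OF cont]) auto
    have derG: "((\<lambda>v. ?G P (x + v *\<^sub>R e)) has_real_derivative ?G Q (x + v *\<^sub>R e)) (at v)" for x v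
    proof -
      have "((\<lambda>v. g P ((x + real l *\<^sub>R \<tau> *\<^sub>R e) + v *\<^sub>R e)) has_real_derivative g Q ((x + real l *\<^sub>R \<tau> *\<^sub>R e) + v *\<^sub>R e)) (at v)" for l
        by (rule der)
      then have "((\<lambda>v. g P (x + v *\<^sub>R e + real l *\<^sub>R \<tau> *\<^sub>R e)) has_real_derivative g Q (x + v *\<^sub>R e + real l *\<^sub>R \<tau> *\<^sub>R e)) (at v)" for l
        by (simp add: algebra_simps)
      then show ?thesis
        unfolding finite_difference_def real_scaleR_def
        by (intro DERIV_sum DERIV_cmult) auto
    qed
    have "(\<integral>\<^sup>+x. ennreal \<bar>finite_difference (Suc L) (\<tau> *\<^sub>R e) (g P) x\<bar> \<partial>(lborel::'a measure))
        = (\<integral>\<^sup>+x. ennreal \<bar>?G P (x + \<tau> *\<^sub>R e) - ?G P x\<bar> \<partial>(lborel::'a measure))"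
      by (simp add: finite_difference_Suc abs_minus_commute)
    also have "\<dots> \<le> ennreal \<tau> * (\<integral>\<^sup>+x. ennreal \<bar>?G Q x\<bar> \<partial>lborel)"
      by (intro nn_integral_difference_le derG contG that)
    also have "\<dots> \<le> ennreal \<tau> * ennreal (C * \<tau> ^ L)"
      by (intro mult_left_mono C(2) that) auto
    also have "\<dots> = ennreal (C * \<tau> ^ Suc L)"
      using that C(1) by (simp add: ennreal_mult[symmetric] mult_ac)
    finally show ?thesis .
  qed
  then show ?case using C(1) unfolding g_def by blast
qed

subsection \<open>The Bessel kernel\<close>

lemma nn_integral_lborel_scaleR:
  fixes f :: "'a::euclidean_space \<Rightarrow> ennreal"
  assumes [measurable]: "f \<in> borel_measurable borel" and c: "c > 0"
  shows "(\<integral>\<^sup>+x. f x \<partial>lborel) = ennreal (c ^ DIM('a)) * (\<integral>\<^sup>+x. f (c *\<^sub>R x) \<partial>lborel)"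
proof -
  have "(\<integral>\<^sup>+x. f x \<partial>lborel) = (\<integral>\<^sup>+x. f x \<partial>(density (distr lborel borel (\<lambda>x. 0 + c *\<^sub>R x)) (\<lambda>_. \<bar>c\<bar> ^ DIM('a))))"
    using lborel_affine[of c "0::'a"] c by simp
  also have "\<dots> = ennreal (c ^ DIM('a)) * (\<integral>\<^sup>+x. f (c *\<^sub>R x) \<partial>lborel)"
    using c by (simp add: nn_integral_density nn_integral_distr nn_integral_cmult ennreal_power)
  finally show ?thesis .
qed

text \<open>The substitution x = sqrt t * y turns the step h into h / sqrt t and produces the power
  of t as its Jacobian. If the step is long on this scale the triangle inequality is enough, with
  total coefficient 2 ^ L; if it is short, the smoothness of the Gaussian is used.\<close>

lemma nn_integral_gaussian_difference_min_le:
  fixes e :: "'a::euclidean_space"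
  assumes e: "norm e = 1"
  shows "\<exists>C\<ge>0. \<forall>h\<ge>0. \<forall>t>0. (\<integral>\<^sup>+x. ennreal \<bar>finite_difference L (h *\<^sub>R e) (\<lambda>x::'a. exp (- (norm x)\<^sup>2 / (4 * t))) x\<bar> \<partial>lborel)
            \<le> ennreal (C * t powr (real DIM('a) / 2) * min 1 ((h / sqrt t) ^ L))"
proof -
  let ?g = "\<lambda>x::'a. exp (- (norm x)\<^sup>2 / 4)"
  obtain C1 where C1: "C1 \<ge> 0"
     "\<And>\<tau>. \<tau> \<ge> 0 \<Longrightarrow> (\<integral>\<^sup>+x. ennreal \<bar>finite_difference L (\<tau> *\<^sub>R e) ?g x\<bar> \<partial>lborel) \<le> ennreal (C1 * \<tau> ^ L)"
    using nn_integral_gaussian_difference_le[OF e, of L "[:1:]"] by auto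
  define I where "I = (\<integral>x. ?g x \<partial>lborel)"
  have int: "integrable lborel ?g"
    using integrable_gaussian_poly[of "[:1:]" e] by simp
  have I: "(\<integral>\<^sup>+x. ennreal (?g x) \<partial>lborel) = ennreal I"
    unfolding I_def by (intro nn_integral_eq_integral int) auto
  have I0: "I \<ge> 0" unfolding I_def by (intro integral_nonneg_AE) auto
  have [measurable]: "?g \<in> borel_measurable borel"
    by (intro borel_measurable_continuous_onI continuous_intros) auto
  have bd0: "(\<integral>\<^sup>+x. ennreal \<bar>finite_difference L (\<tau> *\<^sub>R e) ?g x\<bar> \<partial>lborel) \<le> ennreal (2 ^ L * I)" for \<tau>
  proof -
    have "(\<integral>\<^sup>+x. ennreal \<bar>finite_difference L (\<tau> *\<^sub>R e) ?g x\<bar> \<partial>lborel)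
       \<le> (\<integral>\<^sup>+x. (\<Sum>l\<le>L. ennreal (real (L choose l)) * ennreal (?g (x + real l *\<^sub>R \<tau> *\<^sub>R e))) \<partial>lborel)"
    proof (intro nn_integral_mono)
      fix x
      have "\<bar>finite_difference L (\<tau> *\<^sub>R e) ?g x\<bar> \<le> (\<Sum>l\<le>L. \<bar>((-1)^l * real (L choose l)) *\<^sub>R ?g (x + real l *\<^sub>R \<tau> *\<^sub>R e)\<bar>)"
        unfolding finite_difference_def by (rule sum_abs)
      also have "\<dots> = (\<Sum>l\<le>L. real (L choose l) * ?g (x + real l *\<^sub>R \<tau> *\<^sub>R e))"
        by (simp add: abs_mult power_abs)
      finally show "ennreal \<bar>finite_difference L (\<tau> *\<^sub>R e) ?g x\<bar> \<le> (\<Sum>l\<le>L. ennreal (real (L choose l)) * ennreal (?g (x + real l *\<^sub>R \<tau> *\<^sub>R e)))"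
        by (simp add: ennreal_leI flip: ennreal_mult)
    qed
    also have "\<dots> = (\<Sum>l\<le>L. ennreal (real (L choose l)) * (\<integral>\<^sup>+x. ennreal (?g (x + real l *\<^sub>R \<tau> *\<^sub>R e)) \<partial>lborel))"
      by (subst nn_integral_sum) (auto simp: nn_integral_cmult)
    also have "\<dots> = (\<Sum>l\<le>L. ennreal (real (L choose l)) * ennreal I)"
      by (subst nn_integral_lborel_shift[of "\<lambda>x. ennreal (?g x)"]) (simp_all only: I, measurable)
    also have "\<dots> = ennreal ((\<Sum>l\<le>L. real (L choose l)) * I)"
      using I0 by (simp add: sum_distrib_right flip: ennreal_mult)
    also have "(\<Sum>l\<le>L. real (L choose l)) = 2 ^ L"
      using choose_row_sum[of L] by (metis of_nat_numeral of_nat_power of_nat_sum)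
    finally show ?thesis .
  qed
  define C where "C = max C1 (2 ^ L * I)"
  have "(\<integral>\<^sup>+x. ennreal \<bar>finite_difference L (h *\<^sub>R e) (\<lambda>x::'a. exp (- (norm x)\<^sup>2 / (4 * t))) x\<bar> \<partial>lborel)
            \<le> ennreal (C * t powr (real DIM('a) / 2) * min 1 ((h / sqrt t) ^ L))" if h: "h \<ge> 0" and t: "t > 0" for h t :: real
  proof -
    let ?G = "\<lambda>x::'a. exp (- (norm x)\<^sup>2 / (4 * t))"
    have [measurable]: "?G \<in> borel_measurable borel"
      using t by (intro borel_measurable_continuous_onI continuous_intros) auto
    have eq: "finite_difference L (h *\<^sub>R e) ?G (sqrt t *\<^sub>R x) = finite_difference L ((h / sqrt t) *\<^sub>R e) ?g x" for x
    proof -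
      have "?G (sqrt t *\<^sub>R x + real l *\<^sub>R h *\<^sub>R e) = ?g (x + real l *\<^sub>R (h / sqrt t) *\<^sub>R e)" for l
      proof -
        have "sqrt t *\<^sub>R x + real l *\<^sub>R h *\<^sub>R e = sqrt t *\<^sub>R (x + real l *\<^sub>R (h / sqrt t) *\<^sub>R e)"
          using t by (simp add: algebra_simps)
        then have "(norm (sqrt t *\<^sub>R x + real l *\<^sub>R h *\<^sub>R e))\<^sup>2 = t * (norm (x + real l *\<^sub>R (h / sqrt t) *\<^sub>R e))\<^sup>2"
          using t by (simp only: norm_scaleR power_mult_distrib) simp
        then show ?thesis using t by simp
      qed
      then show ?thesis unfolding finite_difference_def by (intro sum.cong refl arg_cong2[where f=scaleR])
    qed
    have "(\<integral>\<^sup>+x. ennreal \<bar>finite_difference L (h *\<^sub>R e) ?G x\<bar> \<partial>lborel)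
        = ennreal (sqrt t ^ DIM('a)) * (\<integral>\<^sup>+x. ennreal \<bar>finite_difference L (h *\<^sub>R e) ?G (sqrt t *\<^sub>R x)\<bar> \<partial>lborel)"
      using t by (intro nn_integral_lborel_scaleR) (auto simp: finite_difference_def)
    also have "\<dots> = ennreal (sqrt t ^ DIM('a)) * (\<integral>\<^sup>+x. ennreal \<bar>finite_difference L ((h / sqrt t) *\<^sub>R e) ?g x\<bar> \<partial>lborel)"
      by (simp only: eq)
    also have "\<dots> \<le> ennreal (sqrt t ^ DIM('a)) * min (ennreal (2 ^ L * I)) (ennreal (C1 * (h / sqrt t) ^ L))"
      using h t by (intro mult_left_mono min.boundedI bd0 C1(2)) auto
    also have "\<dots> = ennreal (sqrt t ^ DIM('a) * min (2 ^ L * I) (C1 * (h / sqrt t) ^ L))"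
    proof -
      have m: "min (ennreal a) (ennreal b) = ennreal (min a b)" if "a \<ge> 0" "b \<ge> 0" for a b
        using that by (auto simp: min_def ennreal_le_iff)
      show ?thesis
        using I0 C1(1) h t by (subst m) (simp_all only: ennreal_mult' zero_le_power real_sqrt_ge_zero less_imp_le mult_nonneg_nonneg, simp_all)
    qed
    also have "\<dots> \<le> ennreal (sqrt t ^ DIM('a) * (C * min 1 ((h / sqrt t) ^ L)))"
    proof (intro ennreal_leI mult_left_mono)
      have "2 ^ L * I \<le> C * 1" "C1 * (h / sqrt t) ^ L \<le> C * (h / sqrt t) ^ L"
        using h t by (auto simp: C_def intro!: mult_right_mono)
      then show "min (2 ^ L * I) (C1 * (h / sqrt t) ^ L) \<le> C * min 1 ((h / sqrt t) ^ L)"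
        by (auto simp: min_def)
    qed (use t in auto)
    also have "sqrt t ^ DIM('a) = t powr (real DIM('a) / 2)"
      using t by (simp add: powr_half_sqrt[symmetric] powr_powr flip: powr_realpow)
    finally show ?thesis by (simp add: mult_ac)
  qed
  moreover have "C \<ge> 0" using C1(1) by (simp add: C_def)
  ultimately show ?thesis by blast
qed

text \<open>The minimum changes sides at \<open>t = h\<^sup>2\<close>. Below it s > 0 gives
  integrability at 0, above it L > s gives integrability at infinity. Both pieces scale like h powr
  s, with constants 2 / s and 2 / (L - s).\<close>

lemma nn_integral_powr_min_le:
  fixes s h :: real
  assumes s: "s > 0" and L: "real L > s" and h: "h > 0"
  shows "(\<integral>\<^sup>+t. ennreal (indicator {0<..} t * (t powr (s/2 - 1) * min 1 ((h / sqrt t) ^ L))) \<partial>lborel)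
     \<le> ennreal ((2 / s + 2 / (real L - s)) * h powr s)"
proof -
  have 1: "(\<integral>\<^sup>+t. ennreal (indicator {0..h\<^sup>2} t * t powr (s/2 - 1)) \<partial>lborel) = ennreal (2 / s * h powr s)"
  proof -
    have "((\<lambda>t. t powr (s/2 - 1)) has_integral ((h\<^sup>2) powr (s/2 - 1 + 1) / (s/2 - 1 + 1))) {0..h\<^sup>2}"
      using s by (intro has_integral_powr_from_0) auto
    also have "(h\<^sup>2) powr (s/2 - 1 + 1) / (s/2 - 1 + 1) = 2 / s * h powr s"
    proof -
      have "(h\<^sup>2) powr (s/2) = h powr s"
        using h by (simp add: powr_powr flip: powr_numeral)
      then show ?thesis using s by simp
    qed
    finally show ?thesis by (intro nn_integral_has_integral_lebesgue) auto
  qed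
  have 2: "(\<integral>\<^sup>+t. ennreal (indicator {h\<^sup>2..} t * (h ^ L * t powr (s/2 - 1 - real L/2))) \<partial>lborel) = ennreal (2 / (real L - s) * h powr s)"
  proof -
    have "((\<lambda>t. h ^ L * t powr (s/2 - 1 - real L/2)) has_integral (h ^ L * (- ((h\<^sup>2) powr (s/2 - 1 - real L/2 + 1)) / (s/2 - 1 - real L/2 + 1)))) {h\<^sup>2..}"
      using s h L by (intro has_integral_mult_right has_integral_powr_to_inf) auto
    also have "h ^ L * (- ((h\<^sup>2) powr (s/2 - 1 - real L/2 + 1)) / (s/2 - 1 - real L/2 + 1)) = 2 / (real L - s) * h powr s"
    proof -
      have "(h\<^sup>2) powr ((s - real L)/2) = h powr (2 * ((s - real L)/2))"
        using h powr_powr[of h 2 "(s - real L)/2"] by simp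
      also have "2 * ((s - real L)/2) = s - real L" by simp
      finally have "(h\<^sup>2) powr ((s - real L)/2) = h powr (s - real L)" .
      moreover have "h ^ L * h powr (s - real L) = h powr s"
        using h by (simp flip: powr_realpow powr_add)
      moreover have "s/2 - 1 - real L/2 + 1 = (s - real L)/2" by (simp add: field_simps)
      moreover have "h ^ L * (- A / ((s - real L)/2)) = 2 / (real L - s) * (h ^ L * A)" for A
        using L by (simp add: field_simps)
      ultimately show ?thesis by (simp only:)
    qed
    finally show ?thesis using h by (intro nn_integral_has_integral_lebesgue) auto
  qed
  have "(\<integral>\<^sup>+t. ennreal (indicator {0<..} t * (t powr (s/2 - 1) * min 1 ((h / sqrt t) ^ L))) \<partial>lborel)
     \<le> (\<integral>\<^sup>+t. ennreal (indicator {0..h\<^sup>2} t * t powr (s/2 - 1)) + ennreal (indicator {h\<^sup>2..} t * (h ^ L * t powr (s/2 - 1 - real L/2))) \<partial>lborel)"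
  proof (intro nn_integral_mono)
    fix t :: real
    have "indicator {0<..} t * (t powr (s/2 - 1) * min 1 ((h / sqrt t) ^ L))
       \<le> indicator {0..h\<^sup>2} t * t powr (s/2 - 1) + indicator {h\<^sup>2..} t * (h ^ L * t powr (s/2 - 1 - real L/2))"
    proof (cases "t \<le> 0")
      case True then show ?thesis using h by (auto simp: indicator_def)
    next
      case False
      show ?thesis
      proof (cases "t \<le> h\<^sup>2")
        case True
        have "t powr (s/2 - 1) * min 1 ((h / sqrt t) ^ L) \<le> t powr (s/2 - 1) * 1"
          by (intro mult_left_mono) auto
        then show ?thesis using True False h by (auto simp: indicator_def intro: add_increasing2)
      next
        case F: False
        have "t powr (s/2 - 1) * min 1 ((h / sqrt t) ^ L) \<le> t powr (s/2 - 1) * ((h / sqrt t) ^ L)"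
          by (intro mult_left_mono) auto
        also have "\<dots> = h ^ L * (t powr (s/2 - 1) / sqrt t ^ L)" by (simp add: power_divide)
        also have "sqrt t ^ L = t powr (real L / 2)"
          using False by (simp add: powr_half_sqrt[symmetric] powr_powr flip: powr_realpow)
        also have "t powr (s/2 - 1) / t powr (real L / 2) = t powr (s/2 - 1 - real L/2)"
          using False by (simp add: powr_diff)
        finally show ?thesis using F False by (auto simp: indicator_def)
      qed
    qed
    then show "ennreal (indicator {0<..} t * (t powr (s/2 - 1) * min 1 ((h / sqrt t) ^ L)))
        \<le> ennreal (indicator {0..h\<^sup>2} t * t powr (s/2 - 1)) + ennreal (indicator {h\<^sup>2..} t * (h ^ L * t powr (s/2 - 1 - real L/2)))"
      using h by (subst ennreal_plus[symmetric]) (auto intro: ennreal_leI simp del: ennreal_plus)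
  qed
  also have "\<dots> = ennreal (2 / s * h powr s) + ennreal (2 / (real L - s) * h powr s)"
    by (subst nn_integral_add) (auto simp: 1 2)
  also have "\<dots> = ennreal ((2 / s + 2 / (real L - s)) * h powr s)"
    using s L by (simp add: ring_distribs flip: ennreal_plus)
  finally show ?thesis .
qed

context
  fixes s :: real
  assumes s: "s > 0"
begin

definition bessel_integrand :: "real \<Rightarrow> 'a::euclidean_space \<Rightarrow> real" where
  "bessel_integrand t x = indicator {0<..} t * (t powr (s / 2 - 1) * exp (- t) *
        ((4 * pi * t) powr (- real DIM('a) / 2) * exp (- (norm x)\<^sup>2 / (4 * t))))"

lemma bessel_kernel_eq: "bessel_kernel s x = (\<integral>t. bessel_integrand t x \<partial>lborel) / Gamma (s/2)"
  by (simp add: bessel_kernel_def set_lebesgue_integral_def bessel_integrand_def)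

lemma bessel_integrand_measurable [measurable]:
  "(\<lambda>(t, x::'a::euclidean_space). bessel_integrand t x) \<in> borel_measurable (borel \<Otimes>\<^sub>M borel)"
  unfolding bessel_integrand_def by measurable

lemma bessel_kernel_measurable [measurable]:
  "(bessel_kernel s :: 'a::euclidean_space \<Rightarrow> real) \<in> borel_measurable borel"
proof -
  have "(\<lambda>x::'a. \<integral>t. bessel_integrand t x \<partial>lborel) \<in> borel_measurable borel"
    by (intro lborel.borel_measurable_lebesgue_integral) measurable
  then show ?thesis unfolding bessel_kernel_eq[abs_def] by measurable
qed

text \<open>Integrating in x first reduces this to the Gaussian for fixed t, and the power of t from
  its Jacobian cancels against the normalization of the heat kernel. The factor
  \<open>exp (- t)\<close> is kept because the case L = 0, where the minimum gives no decay, is to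
  yield the integrability of the kernel.\<close>

lemma finite_difference_bessel_integrand_le:
  fixes e :: "'a::euclidean_space"
  assumes e: "norm e = 1"
  shows "\<exists>C\<ge>0. \<forall>h\<ge>0. (\<integral>\<^sup>+x. \<integral>\<^sup>+t. ennreal \<bar>finite_difference L (h *\<^sub>R e) (bessel_integrand t) x\<bar> \<partial>lborel \<partial>lborel)
     \<le> ennreal C * (\<integral>\<^sup>+t. ennreal (indicator {0<..} t * (t powr (s/2 - 1) * exp (-t) * min 1 ((h / sqrt t) ^ L))) \<partial>lborel)"
proof -
  let ?d = "real DIM('a)"
  obtain C where C: "C \<ge> 0" "\<And>h t. h \<ge> 0 \<Longrightarrow> t > 0 \<Longrightarrow>
     (\<integral>\<^sup>+x. ennreal \<bar>finite_difference L (h *\<^sub>R e) (\<lambda>x::'a. exp (- (norm x)\<^sup>2 / (4 * t))) x\<bar> \<partial>lborel)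
            \<le> ennreal (C * t powr (?d / 2) * min 1 ((h / sqrt t) ^ L))"
    using nn_integral_gaussian_difference_min_le[OF e, of L] by blast
  define C' where "C' = C * (4 * pi) powr (- ?d / 2)"
  have C': "C' \<ge> 0" using C(1) by (simp add: C'_def)
  have "(\<integral>\<^sup>+x. \<integral>\<^sup>+t. ennreal \<bar>finite_difference L (h *\<^sub>R e) (bessel_integrand t) x\<bar> \<partial>lborel \<partial>lborel)
     \<le> ennreal C' * (\<integral>\<^sup>+t. ennreal (indicator {0<..} t * (t powr (s/2 - 1) * exp (-t) * min 1 ((h / sqrt t) ^ L))) \<partial>lborel)"
    if h: "h \<ge> 0" for h
  proof -
    have "(\<integral>\<^sup>+x. \<integral>\<^sup>+t. ennreal \<bar>finite_difference L (h *\<^sub>R e) (bessel_integrand t) x\<bar> \<partial>lborel \<partial>lborel)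
       = (\<integral>\<^sup>+t. \<integral>\<^sup>+x. ennreal \<bar>finite_difference L (h *\<^sub>R e) (bessel_integrand t) x\<bar> \<partial>lborel \<partial>lborel)"
      unfolding finite_difference_def by (rule lborel_pair.Fubini') measurable
    also have "\<dots> \<le> (\<integral>\<^sup>+t. ennreal C' * ennreal (indicator {0<..} t * (t powr (s/2 - 1) * exp (-t) * min 1 ((h / sqrt t) ^ L))) \<partial>lborel)"
    proof (intro nn_integral_mono)
      fix t :: real
      show "(\<integral>\<^sup>+x. ennreal \<bar>finite_difference L (h *\<^sub>R e) (bessel_integrand t) x\<bar> \<partial>lborel)
        \<le> ennreal C' * ennreal (indicator {0<..} t * (t powr (s/2 - 1) * exp (-t) * min 1 ((h / sqrt t) ^ L)))"
      proof (cases "t > 0")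
        case False
        then show ?thesis by (simp add: bessel_integrand_def finite_difference_def)
      next
        case True
        define A where "A = t powr (s / 2 - 1) * exp (- t) * (4 * pi * t) powr (- ?d / 2)"
        have A: "A \<ge> 0" by (simp add: A_def)
        have "finite_difference L (h *\<^sub>R e) (bessel_integrand t) x
           = A * finite_difference L (h *\<^sub>R e) (\<lambda>x::'a. exp (- (norm x)\<^sup>2 / (4 * t))) x" for x
          using True by (simp add: finite_difference_def bessel_integrand_def A_def sum_distrib_left mult_ac)
        then have "(\<integral>\<^sup>+x. ennreal \<bar>finite_difference L (h *\<^sub>R e) (bessel_integrand t) x\<bar> \<partial>lborel)
          = ennreal A * (\<integral>\<^sup>+x. ennreal \<bar>finite_difference L (h *\<^sub>R e) (\<lambda>x::'a. exp (- (norm x)\<^sup>2 / (4 * t))) x\<bar> \<partial>lborel)"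
          using A by (simp add: abs_mult ennreal_mult finite_difference_def nn_integral_cmult)
        also have "\<dots> \<le> ennreal A * ennreal (C * t powr (?d / 2) * min 1 ((h / sqrt t) ^ L))"
          by (intro mult_left_mono C(2) h True) auto
        also have "\<dots> = ennreal (A * (C * t powr (?d / 2) * min 1 ((h / sqrt t) ^ L)))"
          using A C(1) h True by (simp add: ennreal_mult)
        also have "A * (C * t powr (?d / 2) * min 1 ((h / sqrt t) ^ L)) = C' * (t powr (s/2 - 1) * exp (-t) * min 1 ((h / sqrt t) ^ L))"
        proof -
          have "(4 * pi * t) powr (- ?d / 2) * t powr (?d / 2) = (4 * pi) powr (- ?d / 2)"
            using True by (simp add: powr_mult powr_minus)
          then show ?thesis by (simp add: A_def C'_def mult_ac)
        qed
        finally show ?thesis using True C' h by (simp add: ennreal_mult)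
      qed
    qed
    also have "\<dots> = ennreal C' * (\<integral>\<^sup>+t. ennreal (indicator {0<..} t * (t powr (s/2 - 1) * exp (-t) * min 1 ((h / sqrt t) ^ L))) \<partial>lborel)"
      by (intro nn_integral_cmult) measurable
    finally show ?thesis .
  qed
  then show ?thesis using C' by blast
qed

lemma nn_integral_bessel_integrand_finite:
  "(\<integral>\<^sup>+x. \<integral>\<^sup>+t. ennreal (bessel_integrand t (x::'a::euclidean_space)) \<partial>lborel \<partial>lborel) < \<infinity>"
proof -
  obtain e :: 'a where "e \<in> Basis" using nonempty_Basis by blast
  then have e: "norm e = 1" by simp
  \<comment> \<open>As \<open>(0 / sqrt t) ^ 0 = 1\<close>, the right-hand side for L = 0 and h = 0
    is a multiple of the Gamma integral.\<close>
  obtain C where C: "(\<integral>\<^sup>+x. \<integral>\<^sup>+t. ennreal \<bar>finite_difference 0 (0 *\<^sub>R e) (bessel_integrand t) x\<bar> \<partial>lborel \<partial>lborel)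
     \<le> ennreal C * (\<integral>\<^sup>+t. ennreal (indicator {0<..} t * (t powr (s/2 - 1) * exp (-t) * min 1 ((0 / sqrt t) ^ 0))) \<partial>lborel)"
    using finite_difference_bessel_integrand_le[OF e, of 0] by blast
  have "(\<integral>\<^sup>+x. \<integral>\<^sup>+t. ennreal (bessel_integrand t (x::'a)) \<partial>lborel \<partial>lborel)
      = (\<integral>\<^sup>+x. \<integral>\<^sup>+t. ennreal \<bar>finite_difference 0 (0 *\<^sub>R e) (bessel_integrand t) x\<bar> \<partial>lborel \<partial>lborel)"
    by (simp add: bessel_integrand_def)
  also have "\<dots> \<le> ennreal C * (\<integral>\<^sup>+t. ennreal (indicator {0..} t * t powr (s/2 - 1) / exp t) \<partial>lborel)"
    by (rule order_trans[OF C], intro mult_left_mono nn_integral_mono ennreal_leI)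
       (auto simp: indicator_def exp_minus field_simps)
  also have "\<dots> = ennreal C * ennreal (Gamma (s/2))"
    using Gamma_conv_nn_integral_real[of "s/2"] s by simp
  also have "\<dots> < \<infinity>" by (simp add: ennreal_mult_less_top)
  finally show ?thesis .
qed

text \<open>At x + a = 0 the integral over t diverges for small s, and \<open>bessel_kernel\<close>
  takes there the default value 0 of the Bochner integral. Linearity in the kernel is therefore only
  available almost everywhere.\<close>

lemma AE_integrable_bessel_integrand:
  "AE x in lborel. integrable lborel (\<lambda>t. bessel_integrand t (x + a :: 'a::euclidean_space))"
proof -
  have "(\<integral>\<^sup>+x. \<integral>\<^sup>+t. ennreal (bessel_integrand t (x + a)) \<partial>lborel \<partial>lborel)
      = (\<integral>\<^sup>+x. \<integral>\<^sup>+t. ennreal (bessel_integrand t (x::'a)) \<partial>lborel \<partial>lborel)"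
    by (rule nn_integral_lborel_shift[of "\<lambda>x. \<integral>\<^sup>+t. ennreal (bessel_integrand t x) \<partial>lborel"]) measurable
  then have "(\<integral>\<^sup>+x. \<integral>\<^sup>+t. ennreal (bessel_integrand t (x + a)) \<partial>lborel \<partial>lborel) \<noteq> \<infinity>"
    using nn_integral_bessel_integrand_finite by (metis infinity_ennreal_def less_irrefl)
  then have "AE x in lborel. (\<integral>\<^sup>+t. ennreal (bessel_integrand t (x + a)) \<partial>lborel) \<noteq> \<infinity>"
    by (intro nn_integral_PInf_AE) measurable
  then show ?thesis
  proof (eventually_elim)
    case (elim x)
    then show ?case
      by (intro integrableI_nonneg) (auto simp: bessel_integrand_def less_top)
  qed
qed

text \<open>Outside a null set all L + 1 translates are integrable in t, so that the difference may
  be taken under the integral.\<close>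

lemma AE_finite_difference_bessel_kernel_le:
  fixes h :: "'a::euclidean_space"
  shows "AE x in lborel. ennreal \<bar>finite_difference L h (bessel_kernel s) x\<bar>
      \<le> ennreal (1 / Gamma (s/2)) * (\<integral>\<^sup>+t. ennreal \<bar>finite_difference L h (bessel_integrand t) x\<bar> \<partial>lborel)"
proof -
  have "AE x in lborel. \<forall>l\<in>{..L}. integrable lborel (\<lambda>t. bessel_integrand t (x + real l *\<^sub>R h))"
    by (intro AE_finite_allI AE_integrable_bessel_integrand) auto
  then show ?thesis
  proof eventually_elim
    case (elim x)
    have G: "Gamma (s/2) > 0" using s by (simp add: Gamma_real_pos)
    have int: "integrable lborel (\<lambda>t. finite_difference L h (bessel_integrand t) x)"
      unfolding finite_difference_def real_scaleR_def using elim by (intro Bochner_Integration.integrable_sum integrable_mult_right) auto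
    have "finite_difference L h (bessel_kernel s) x = (\<integral>t. finite_difference L h (bessel_integrand t) x \<partial>lborel) / Gamma (s/2)"
    proof -
      have "(\<integral>t. finite_difference L h (bessel_integrand t) x \<partial>lborel)
         = (\<Sum>l\<le>L. (\<integral>t. ((-1)^l * real (L choose l)) *\<^sub>R bessel_integrand t (x + real l *\<^sub>R h) \<partial>lborel))"
        unfolding finite_difference_def real_scaleR_def using elim
        by (intro Bochner_Integration.integral_sum integrable_mult_right) auto
      also have "\<dots> = (\<Sum>l\<le>L. ((-1)^l * real (L choose l)) *\<^sub>R (\<integral>t. bessel_integrand t (x + real l *\<^sub>R h) \<partial>lborel))"
        by simp
      finally show ?thesis
        by (simp add: finite_difference_def bessel_kernel_eq sum_divide_distrib)
    qed
    then have "\<bar>finite_difference L h (bessel_kernel s) x\<bar> = 1 / Gamma (s/2) * \<bar>\<integral>t. finite_difference L h (bessel_integrand t) x \<partial>lborel\<bar>"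
      using G by (simp add: abs_mult)
    then have "ennreal \<bar>finite_difference L h (bessel_kernel s) x\<bar> = ennreal (1 / Gamma (s/2)) * ennreal \<bar>\<integral>t. finite_difference L h (bessel_integrand t) x \<partial>lborel\<bar>"
      using G by (simp only: ennreal_mult') (simp add: ennreal_mult'[symmetric])
    also have "\<dots> \<le> ennreal (1 / Gamma (s/2)) * (\<integral>\<^sup>+t. ennreal \<bar>finite_difference L h (bessel_integrand t) x\<bar> \<partial>lborel)"
      using integral_norm_bound_ennreal[OF int] by (intro mult_left_mono) auto
    finally show ?case .
  qed
qed

lemma integrable_bessel_kernel: "integrable lborel (bessel_kernel s :: 'a::euclidean_space \<Rightarrow> real)"
proof (subst integrable_iff_bounded, intro conjI)
  have "(\<integral>\<^sup>+x. ennreal (norm (bessel_kernel s (x::'a))) \<partial>lborel)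
     \<le> (\<integral>\<^sup>+x. ennreal (1 / Gamma (s/2)) * (\<integral>\<^sup>+t. ennreal \<bar>bessel_integrand t x\<bar> \<partial>lborel) \<partial>(lborel::'a measure))"
    using AE_finite_difference_bessel_kernel_le[of 0 "0::'a"]
    by (intro nn_integral_mono_AE) simp
  also have "\<dots> = ennreal (1 / Gamma (s/2)) * (\<integral>\<^sup>+x. \<integral>\<^sup>+t. ennreal (bessel_integrand t (x::'a)) \<partial>lborel \<partial>lborel)"
    by (subst nn_integral_cmult) (auto simp: bessel_integrand_def)
  also have "\<dots> < \<infinity>"
    using nn_integral_bessel_integrand_finite[where 'a='a] by (simp add: ennreal_mult_less_top)
  finally show "(\<integral>\<^sup>+x. ennreal (norm (bessel_kernel s (x::'a))) \<partial>lborel) < \<infinity>" .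
qed measurable

lemma nn_integral_bessel_kernel_difference_le:
  fixes e :: "'a::euclidean_space"
  assumes e: "norm e = 1" and L: "real L > s"
  shows "\<exists>C\<ge>0. \<forall>h>0. (\<integral>\<^sup>+x. ennreal \<bar>finite_difference L (h *\<^sub>R e) (bessel_kernel s) x\<bar> \<partial>lborel) \<le> ennreal (C * h powr s)"
proof -
  obtain C where C: "C \<ge> 0" "\<And>h. h \<ge> 0 \<Longrightarrow> (\<integral>\<^sup>+x. \<integral>\<^sup>+t. ennreal \<bar>finite_difference L (h *\<^sub>R e) (bessel_integrand t) x\<bar> \<partial>lborel \<partial>lborel)
     \<le> ennreal C * (\<integral>\<^sup>+t. ennreal (indicator {0<..} t * (t powr (s/2 - 1) * exp (-t) * min 1 ((h / sqrt t) ^ L))) \<partial>lborel)"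
    using finite_difference_bessel_integrand_le[OF e, of L] by blast
  define D where "D = 2 / s + 2 / (real L - s)"
  have D: "D \<ge> 0" using s L by (simp add: D_def)
  have G: "Gamma (s/2) > 0" using s by (simp add: Gamma_real_pos)
  have "(\<integral>\<^sup>+x. ennreal \<bar>finite_difference L (h *\<^sub>R e) (bessel_kernel s) x\<bar> \<partial>lborel) \<le> ennreal (1 / Gamma (s/2) * C * D * h powr s)"
    if h: "h > 0" for h
  proof -
    have "(\<integral>\<^sup>+x. ennreal \<bar>finite_difference L (h *\<^sub>R e) (bessel_kernel s) x\<bar> \<partial>lborel)
      \<le> (\<integral>\<^sup>+x. ennreal (1 / Gamma (s/2)) * (\<integral>\<^sup>+t. ennreal \<bar>finite_difference L (h *\<^sub>R e) (bessel_integrand t) x\<bar> \<partial>lborel) \<partial>lborel)"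
      by (intro nn_integral_mono_AE AE_finite_difference_bessel_kernel_le)
    also have "\<dots> = ennreal (1 / Gamma (s/2)) * (\<integral>\<^sup>+x. \<integral>\<^sup>+t. ennreal \<bar>finite_difference L (h *\<^sub>R e) (bessel_integrand t) x\<bar> \<partial>lborel \<partial>lborel)"
      unfolding finite_difference_def by (intro nn_integral_cmult) measurable
    also have "\<dots> \<le> ennreal (1 / Gamma (s/2)) * (ennreal C * (\<integral>\<^sup>+t. ennreal (indicator {0<..} t * (t powr (s/2 - 1) * exp (-t) * min 1 ((h / sqrt t) ^ L))) \<partial>lborel))"
      using h by (intro mult_left_mono C(2)) auto
    also have "\<dots> \<le> ennreal (1 / Gamma (s/2)) * (ennreal C * ennreal (D * h powr s))"
    proof (intro mult_left_mono)
      \<comment> \<open>For L > s the minimum alone makes the integral converge at infinity, so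
        \<open>exp (- t)\<close> can be bounded by 1.\<close>
      have "(\<integral>\<^sup>+t. ennreal (indicator {0<..} t * (t powr (s/2 - 1) * exp (-t) * min 1 ((h / sqrt t) ^ L))) \<partial>lborel)
         \<le> (\<integral>\<^sup>+t. ennreal (indicator {0<..} t * (t powr (s/2 - 1) * min 1 ((h / sqrt t) ^ L))) \<partial>lborel)"
      proof (intro nn_integral_mono ennreal_leI)
        fix t :: real
        show "indicator {0<..} t * (t powr (s/2 - 1) * exp (-t) * min 1 ((h / sqrt t) ^ L)) \<le> indicator {0<..} t * (t powr (s/2 - 1) * min 1 ((h / sqrt t) ^ L))"
        proof (cases "t > 0")
          case True
          then have "t powr (s/2 - 1) * exp (-t) * min 1 ((h / sqrt t) ^ L) \<le> t powr (s/2 - 1) * 1 * min 1 ((h / sqrt t) ^ L)"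
            using h by (intro mult_right_mono mult_left_mono) auto
          then show ?thesis using True by simp
        qed auto
      qed
      also have "\<dots> \<le> ennreal (D * h powr s)"
        unfolding D_def by (rule nn_integral_powr_min_le[OF s L h])
      finally show "(\<integral>\<^sup>+t. ennreal (indicator {0<..} t * (t powr (s/2 - 1) * exp (-t) * min 1 ((h / sqrt t) ^ L))) \<partial>lborel) \<le> ennreal (D * h powr s)" .
    qed auto
    also have "\<dots> = ennreal (1 / Gamma (s/2) * C * D * h powr s)"
      using G C(1) D by (simp add: ennreal_mult[symmetric] mult_ac)
    finally show ?thesis .
  qed
  moreover have "1 / Gamma (s/2) * C * D \<ge> 0" using G C(1) D by simp
  ultimately show ?thesis by blast
qed

end

subsection \<open>Pairing Sobolev functions with finite differences\<close>

lemma lborel_integral_shift: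
  fixes f :: "'a::euclidean_space \<Rightarrow> 'b::{banach, second_countable_topology}"
  assumes [measurable]: "f \<in> borel_measurable borel"
  shows "(\<integral>x. f (x + a) \<partial>lborel) = (\<integral>x. f x \<partial>lborel)"
proof -
  have "(\<integral>x. f x \<partial>lborel) = (\<integral>x. f x \<partial>(distr lborel borel ((+) a)))"
    by (simp add: lborel_distr_plus)
  also have "\<dots> = (\<integral>x. f (x + a) \<partial>lborel)"
    by (subst integral_distr) (auto simp: add.commute)
  finally show ?thesis by simp
qed

lemma lborel_integrable_shift:
  fixes f :: "'a::euclidean_space \<Rightarrow> 'b::{banach, second_countable_topology}"
  assumes f: "integrable lborel f"
  shows "integrable lborel (\<lambda>x. f (x + a))"
proof -
  have "integrable (distr lborel borel ((+) a)) f" using f by (simp add: lborel_distr_plus)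
  then have "integrable lborel (\<lambda>x. f (a + x))"
    using f by (subst (asm) integrable_distr_eq) auto
  then show ?thesis by (simp add: add.commute)
qed

lemma AE_lborel_shift:
  fixes a :: "'a::euclidean_space"
  assumes P: "AE x in lborel. P x"
  shows "AE x in lborel. P (x + a)"
proof -
  have "AE x in distr lborel borel ((+) a). P x" using P by (subst lborel_distr_plus)
  then have "AE x in lborel. P (a + x)" by (rule AE_distrD[rotated]) simp
  then show ?thesis by (simp add: add.commute)
qed

lemma lborel_integral_reflect_add:
  fixes f :: "'a::euclidean_space \<Rightarrow> 'b::{banach, second_countable_topology}"
  assumes [measurable]: "f \<in> borel_measurable borel"
  shows "(\<integral>y. f y \<partial>lborel) = (\<integral>z. f (x - z) \<partial>lborel)"
proof -
  have "(lborel :: 'a measure) = density (distr lborel borel ((-) x)) (\<lambda>_. 1)"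
    using lborel_affine[of "-1" x] by simp
  then have "(\<integral>y. f y \<partial>lborel) = (\<integral>y. f y \<partial>(density (distr lborel borel ((-) x)) (\<lambda>_. 1)))"
    by (rule arg_cong)
  also have "\<dots> = (\<integral>z. f (x - z) \<partial>lborel)"
    by (simp add: integral_distr density_1)
  finally show ?thesis .
qed

text \<open>Replaces Hoelder's inequality: the bound is not homogeneous in \<open>g\<close>, but has the right power of \<open>E\<close>.\<close>

lemma nn_integral_Lp_on_set_le:
  fixes g :: "'a::euclidean_space \<Rightarrow> complex"
  assumes g: "g \<in> Lp_space p" and p: "p > 1" and E: "E \<in> sets borel" "emeasure lborel E < \<infinity>" "measure lborel E > 0"
  shows "(\<integral>\<^sup>+x. ennreal (norm (g (x - z))) * indicator E x \<partial>lborel)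
     \<le> ennreal ((1 + (\<integral>x. norm (g x) powr p \<partial>lborel)) * measure lborel E powr (1 - 1/p))"
proof -
  have [measurable]: "g \<in> borel_measurable borel" "E \<in> sets borel"
    and int: "integrable lborel (\<lambda>x. norm (g x) powr p)"
    using g E by (auto simp: Lp_space_def)
  define V where "V = measure lborel E"
  \<comment> \<open>A threshold for |g|: below M the function is bounded by M on E, above M it is
    bounded by M powr (1 - p) times its p-th power. This value of M gives both contributions the
    same power 1 - 1/p of the volume.\<close>
  define M where "M = V powr (- 1 / p)"
  define I where "I = (\<integral>x. norm (g x) powr p \<partial>lborel)"
  have V: "V > 0" using E by (simp add: V_def)
  have M: "M > 0" using V by (simp add: M_def)
  have I0: "I \<ge> 0" unfolding I_def by (intro integral_nonneg_AE) auto
  have pw: "y \<le> M + M powr (1 - p) * y powr p" if "y \<ge> 0" for y :: real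
  proof (cases "y \<le> M")
    case True then show ?thesis by (simp add: add_increasing2)
  next
    case False
    then have "y = y powr (1 - p) * y powr p" using M by (simp flip: powr_add)
    also have "\<dots> \<le> M powr (1 - p) * y powr p"
      using False M p by (intro mult_right_mono powr_mono2') auto
    finally show ?thesis using M by simp
  qed
  have "(\<integral>\<^sup>+x. ennreal (norm (g (x - z))) * indicator E x \<partial>lborel)
    \<le> (\<integral>\<^sup>+x. ennreal M * indicator E x + ennreal (M powr (1 - p)) * ennreal (norm (g (x - z)) powr p) \<partial>lborel)"
  proof (intro nn_integral_mono)
    fix x
    have "ennreal (norm (g (x - z))) \<le> ennreal M + ennreal (M powr (1 - p)) * ennreal (norm (g (x - z)) powr p)"
      using pw[of "norm (g (x - z))"] M by (simp add: ennreal_leI flip: ennreal_plus ennreal_mult)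
    then show "ennreal (norm (g (x - z))) * indicator E x \<le> ennreal M * indicator E x + ennreal (M powr (1 - p)) * ennreal (norm (g (x - z)) powr p)"
      by (auto simp: indicator_def)
  qed
  also have "\<dots> = ennreal M * emeasure lborel E + ennreal (M powr (1 - p)) * (\<integral>\<^sup>+x. ennreal (norm (g (x - z)) powr p) \<partial>lborel)"
    by (subst nn_integral_add) (auto simp: nn_integral_cmult)
  also have "(\<integral>\<^sup>+x. ennreal (norm (g (x - z)) powr p) \<partial>lborel) = ennreal I"
  proof -
    have "(\<integral>\<^sup>+x. ennreal (norm (g (x + - z)) powr p) \<partial>lborel) = (\<integral>\<^sup>+x. ennreal (norm (g x) powr p) \<partial>lborel)"
      by (rule nn_integral_lborel_shift[of "\<lambda>x. ennreal (norm (g x) powr p)"]) measurable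
    also have "\<dots> = ennreal I" unfolding I_def by (intro nn_integral_eq_integral int) auto
    finally show ?thesis by simp
  qed
  also have "emeasure lborel E = ennreal V"
    unfolding V_def using E by (intro emeasure_eq_ennreal_measure) auto
  also have "ennreal M * ennreal V + ennreal (M powr (1 - p)) * ennreal I = ennreal (M * V + M powr (1 - p) * I)"
    using M V I0 by (simp flip: ennreal_plus ennreal_mult)
  also have "M * V = V powr (1 - 1/p)"
    using V by (simp add: M_def powr_diff powr_minus_divide)
  also have "M powr (1 - p) = V powr (1 - 1/p)"
  proof -
    have "(- 1 / p) * (1 - p) = 1 - 1/p" using p by (simp add: field_simps)
    then show ?thesis unfolding M_def powr_powr by simp
  qed
  finally show ?thesis by (simp add: V_def I_def algebra_simps)
qed

text \<open>Summation by parts: with u the convolution of the Bessel kernel and g, the difference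
  passes from k to the kernel, whose difference is small in L^1. The other factor is a correlation
  of g with k, bounded by the L^p information on g over a translate of E. The constant depends on u
  through g, but not on h, E or k.\<close>

lemma Sobolev_space_difference_pairing_le:
  fixes u :: "'a::euclidean_space \<Rightarrow> complex"
  assumes u: "u \<in> Sobolev_space s p" and s: "s > 0" and p: "p > 1" and e: "norm e = 1" and L: "real L > s"
  shows "\<exists>C\<ge>0. \<forall>h>0. \<forall>E k. E \<in> sets borel \<longrightarrow> emeasure lborel E < \<infinity> \<longrightarrow> measure lborel E > 0 \<longrightarrow>
      k \<in> borel_measurable borel \<longrightarrow> (\<forall>x. norm (k x) \<le> indicator E x) \<longrightarrow>
      norm (\<integral>x. u x * finite_difference L (- h *\<^sub>R e) k x \<partial>lborel) \<le> C * h powr s * measure lborel E powr (1 - 1/p)"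
proof -
  have um [measurable]: "u \<in> borel_measurable borel" using u by (simp add: Sobolev_space_def)
  obtain g where g: "g \<in> Lp_space p" and ug: "AE x in lborel. u x = bessel_potential s g x"
    using u by (auto simp: Sobolev_space_def)
  have gm [measurable]: "g \<in> borel_measurable borel" using g by (simp add: Lp_space_def)
  let ?G = "bessel_kernel s :: 'a \<Rightarrow> real"
  note [measurable] = bessel_kernel_measurable[OF s]
  have intG: "integrable lborel ?G" by (rule integrable_bessel_kernel[OF s])
  define I where "I = (\<integral>x. norm (g x) powr p \<partial>lborel)"
  have I0: "I \<ge> 0" unfolding I_def by (intro integral_nonneg_AE) auto
  obtain C where C: "C \<ge> 0" "\<And>h. h > 0 \<Longrightarrow> (\<integral>\<^sup>+x. ennreal \<bar>finite_difference L (h *\<^sub>R e) ?G x\<bar> \<partial>lborel) \<le> ennreal (C * h powr s)"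
    using nn_integral_bessel_kernel_difference_le[OF s e L] by blast
  have "norm (\<integral>x. u x * finite_difference L (- h *\<^sub>R e) k x \<partial>lborel) \<le> C * (1 + I) * h powr s * measure lborel E powr (1 - 1/p)"
    if h: "h > 0" and E: "E \<in> sets borel" "emeasure lborel E < \<infinity>" "measure lborel E > 0"
      and km [measurable]: "k \<in> borel_measurable borel" and k: "\<And>x. norm (k x) \<le> indicator E x" for h E and k :: "'a \<Rightarrow> complex"
  proof -
    define B where "B = (1 + I) * measure lborel E powr (1 - 1/p)"
    have B0: "B \<ge> 0" using I0 by (simp add: B_def)
    have B: "(\<integral>\<^sup>+x. ennreal (norm (g (x - z) * k x)) \<partial>lborel) \<le> ennreal B" for z
    proof -
      have "(\<integral>\<^sup>+x. ennreal (norm (g (x - z) * k x)) \<partial>lborel) \<le> (\<integral>\<^sup>+x. ennreal (norm (g (x - z))) * indicator E x \<partial>lborel)"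
      proof (intro nn_integral_mono)
        fix x
        show "ennreal (norm (g (x - z) * k x)) \<le> ennreal (norm (g (x - z))) * indicator E x"
          using mult_left_mono[OF k[of x], of "norm (g (x - z))"]
            k[of x]
          by (cases "x \<in> E") (auto simp: norm_mult ennreal_leI)
      qed
      also have "\<dots> \<le> ennreal B"
        unfolding B_def I_def by (rule nn_integral_Lp_on_set_le[OF g p E])
      finally show ?thesis .
    qed
    \<comment> \<open>The correlation that remains when the kernel is split off. It is bounded
      uniformly in z because the estimate for g on E is invariant under translation.\<close>
    define m where "m z = (\<integral>x. g (x - z) * k x \<partial>lborel)" for z
    have m_le: "norm (m z) \<le> B" for z
    proof -
      have "integrable lborel (\<lambda>x. g (x - z) * k x)"
        using B[of z] by (subst integrable_iff_bounded) (auto intro: le_less_trans)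
      then have "ennreal (norm (m z)) \<le> (\<integral>\<^sup>+x. ennreal (norm (g (x - z) * k x)) \<partial>lborel)"
        unfolding m_def by (rule integral_norm_bound_ennreal)
      also have "\<dots> \<le> ennreal B" by (rule B)
      finally show ?thesis using B0 by simp
    qed
    have mm [measurable]: "m \<in> borel_measurable borel"
      unfolding m_def by (intro lborel.borel_measurable_lebesgue_integral) measurable
    \<comment> \<open>One term of the difference, with a the accumulated shift. Absolute convergence
      of the double integral is proved first, since it also supplies the integrability of u against
      k.\<close>
    have pairing: "integrable lborel (\<lambda>x. u x * k (x - a)) \<and> integrable lborel (\<lambda>z. ?G (z + a) *\<^sub>R m z) \<and>
        (\<integral>x. u x * k (x - a) \<partial>lborel) = (\<integral>z. ?G (z + a) *\<^sub>R m z \<partial>lborel)" for a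
    proof -
      let ?\<phi> = "\<lambda>x z. ?G (z + a) *\<^sub>R (g (x - z) * k x)"
      have "(\<integral>\<^sup>+z. \<integral>\<^sup>+x. ennreal (norm (?\<phi> x z)) \<partial>lborel \<partial>lborel)
         = (\<integral>\<^sup>+z. ennreal (norm (?G (z + a))) * (\<integral>\<^sup>+x. ennreal (norm (g (x - z) * k x)) \<partial>lborel) \<partial>lborel)"
        by (simp add: ennreal_mult nn_integral_cmult)
      also have "\<dots> \<le> (\<integral>\<^sup>+z. ennreal (norm (?G (z + a))) * ennreal B \<partial>lborel)"
        by (intro nn_integral_mono mult_left_mono B) auto
      also have "\<dots> = (\<integral>\<^sup>+z. ennreal (norm (?G (z + a))) \<partial>lborel) * ennreal B"
        by (rule nn_integral_multc) measurable
      also have "\<dots> < \<infinity>"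
        using lborel_integrable_shift[OF intG, of a] by (simp add: integrable_iff_bounded ennreal_mult_less_top)
      finally have "(\<integral>\<^sup>+x. \<integral>\<^sup>+z. ennreal (norm (?\<phi> x z)) \<partial>lborel \<partial>lborel) < \<infinity>"
        by (subst lborel_pair.Fubini') measurable
      then have int: "integrable (lborel \<Otimes>\<^sub>M lborel) (\<lambda>(x, z). ?\<phi> x z)"
        by (subst integrable_iff_bounded, subst lborel.nn_integral_fst[symmetric]) (auto simp: case_prod_beta)
      have eq: "AE x in lborel. u (x + a) * k x = (\<integral>z. ?\<phi> x z \<partial>lborel)"
        using AE_lborel_shift[OF ug, of a]
      proof eventually_elim
        case (elim x)
        have "bessel_potential s g (x + a) = (\<integral>y. ?G (x + a - y) *\<^sub>R g y \<partial>lborel)"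
          using s by (simp add: bessel_potential_def)
        also have "\<dots> = (\<integral>z. ?G (x + a - (x - z)) *\<^sub>R g (x - z) \<partial>lborel)"
          by (rule lborel_integral_reflect_add) measurable
        also have "\<dots> = (\<integral>z. ?G (z + a) *\<^sub>R g (x - z) \<partial>lborel)"
          by (simp add: add.commute)
        finally show ?case using elim by (simp flip: integral_mult_left_zero)
      qed
      have i1: "integrable lborel (\<lambda>x. u (x + a) * k x)"
        using lborel_pair.integrable_fst[OF int] eq by (subst integrable_cong_AE) auto
      then have "integrable lborel (\<lambda>x. u (x + - a + a) * k (x + - a))"
        by (rule lborel_integrable_shift)
      moreover have "(\<integral>x. u (x + - a + a) * k (x + - a) \<partial>lborel) = (\<integral>x. u (x + a) * k x \<partial>lborel)"
        by (rule lborel_integral_shift[of "\<lambda>x. u (x + a) * k x"]) measurable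
      moreover have "(\<integral>x. u (x + a) * k x \<partial>lborel) = (\<integral>x. (\<integral>z. ?\<phi> x z \<partial>lborel) \<partial>lborel)"
        using eq by (intro integral_cong_AE) measurable
      moreover have "\<dots> = (\<integral>z. (\<integral>x. ?\<phi> x z \<partial>lborel) \<partial>lborel)"
        using lborel_pair.integral_fst[OF int] lborel_pair.integral_snd[OF int] by simp
      moreover have "(\<integral>x. ?\<phi> x z \<partial>lborel) = ?G (z + a) *\<^sub>R m z" for z
        by (simp add: m_def)
      ultimately show ?thesis
        using lborel_pair.integrable_snd[OF int] by (simp add: m_def)
    qed
    let ?c = "\<lambda>l. (-1)^l * real (L choose l)"
    have "(\<integral>x. u x * finite_difference L (- h *\<^sub>R e) k x \<partial>lborel)
        = (\<integral>x. (\<Sum>l\<le>L. ?c l *\<^sub>R (u x * k (x - real l *\<^sub>R h *\<^sub>R e))) \<partial>lborel)"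
      by (simp add: finite_difference_def sum_distrib_left)
    also have "\<dots> = (\<Sum>l\<le>L. (\<integral>x. ?c l *\<^sub>R (u x * k (x - real l *\<^sub>R h *\<^sub>R e)) \<partial>lborel))"
      using pairing by (intro Bochner_Integration.integral_sum integrable_scaleR_right) auto
    also have "\<dots> = (\<Sum>l\<le>L. (\<integral>z. ?c l *\<^sub>R (?G (z + real l *\<^sub>R h *\<^sub>R e) *\<^sub>R m z) \<partial>lborel))"
      using pairing by (intro sum.cong refl) (simp only: integral_scaleR_right)
    also have "\<dots> = (\<integral>z. (\<Sum>l\<le>L. ?c l *\<^sub>R (?G (z + real l *\<^sub>R h *\<^sub>R e) *\<^sub>R m z)) \<partial>lborel)"
      using pairing by (intro Bochner_Integration.integral_sum[symmetric] integrable_scaleR_right) auto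
    also have "\<dots> = (\<integral>z. finite_difference L (h *\<^sub>R e) ?G z *\<^sub>R m z \<partial>lborel)"
      by (simp add: finite_difference_def scaleR_sum_left)
    finally have *: "(\<integral>x. u x * finite_difference L (- h *\<^sub>R e) k x \<partial>lborel) = (\<integral>z. finite_difference L (h *\<^sub>R e) ?G z *\<^sub>R m z \<partial>lborel)" .
    have le: "(\<integral>\<^sup>+z. ennreal (norm (finite_difference L (h *\<^sub>R e) ?G z *\<^sub>R m z)) \<partial>lborel) \<le> ennreal (C * h powr s * B)"
    proof -
      have "(\<integral>\<^sup>+z. ennreal (norm (finite_difference L (h *\<^sub>R e) ?G z *\<^sub>R m z)) \<partial>lborel)
         \<le> (\<integral>\<^sup>+z. ennreal \<bar>finite_difference L (h *\<^sub>R e) ?G z\<bar> * ennreal B \<partial>lborel)"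
        using B0 m_le by (intro nn_integral_mono) (auto simp flip: ennreal_mult intro!: ennreal_leI mult_left_mono)
      also have "\<dots> = (\<integral>\<^sup>+z. ennreal \<bar>finite_difference L (h *\<^sub>R e) ?G z\<bar> \<partial>lborel) * ennreal B"
        unfolding finite_difference_def by (intro nn_integral_multc) measurable
      also have "\<dots> \<le> ennreal (C * h powr s) * ennreal B"
        by (intro mult_right_mono C(2) h) auto
      also have "\<dots> = ennreal (C * h powr s * B)"
        using C(1) B0 by (simp add: ennreal_mult)
      finally show ?thesis .
    qed
    then have "integrable lborel (\<lambda>z. finite_difference L (h *\<^sub>R e) ?G z *\<^sub>R m z)"
      by (subst integrable_iff_bounded) (auto simp: finite_difference_def intro: le_less_trans)
    then have "ennreal (norm (\<integral>z. finite_difference L (h *\<^sub>R e) ?G z *\<^sub>R m z \<partial>lborel)) \<le> ennreal (C * h powr s * B)"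
      using integral_norm_bound_ennreal le order_trans by blast
    then have "norm (\<integral>z. finite_difference L (h *\<^sub>R e) ?G z *\<^sub>R m z \<partial>lborel) \<le> C * h powr s * B"
      using C(1) B0 by (subst (asm) ennreal_le_iff) auto
    then show ?thesis unfolding * B_def by (simp add: mult_ac)
  qed
  moreover have "C * (1 + I) \<ge> 0" using C(1) I0 by simp
  ultimately show ?thesis by blast
qed

subsection \<open>Anisotropic dilations\<close>

context
  fixes T :: "'a::euclidean_space \<Rightarrow> 'a" and c :: "'a \<Rightarrow> real" and J :: real
  assumes T: "\<And>x b. b \<in> Basis \<Longrightarrow> T x \<bullet> b = c b * (x \<bullet> b)"
    and c: "\<And>b. b \<in> Basis \<Longrightarrow> c b > 0" and J: "(\<Prod>b\<in>Basis. c b) = J"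
begin

lemma lborel_diagonal: "lborel = density (distr lborel borel T) (\<lambda>_. ennreal J)"
proof -
  have "T = (\<lambda>x. 0 + (\<Sum>j\<in>Basis. (c j * (x \<bullet> j)) *\<^sub>R j))"
    by (rule ext, rule euclidean_eqI) (simp add: T)
  moreover have "(\<Prod>b\<in>Basis. \<bar>c b\<bar>) = J"
    unfolding J[symmetric] using c by (intro prod.cong refl) (simp add: less_imp_le)
  ultimately show ?thesis
    using lborel_affine_euclidean[of c 0] c by (metis less_irrefl)
qed

lemma diagonal_measurable: "T \<in> borel \<rightarrow>\<^sub>M borel"
proof -
  have "T = (\<lambda>x. (\<Sum>j\<in>Basis. (c j * (x \<bullet> j)) *\<^sub>R j))"
    by (rule ext, rule euclidean_eqI) (simp add: T)
  then show ?thesis by simp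
qed

lemma diagonal_pos: "J > 0"
  unfolding J[symmetric] using c by (intro prod_pos) auto

lemma lborel_integral_diagonal:
  fixes f :: "'a \<Rightarrow> complex"
  assumes [measurable]: "f \<in> borel_measurable borel"
  shows "(\<integral>x. f x \<partial>lborel) = J *\<^sub>R (\<integral>x. f (T x) \<partial>lborel)"
proof -
  note [measurable] = diagonal_measurable
  have "(\<integral>x. f x \<partial>lborel) = (\<integral>x. f x \<partial>(density (distr lborel borel T) (\<lambda>_. ennreal J)))"
    using lborel_diagonal by simp
  also have "\<dots> = J *\<^sub>R (\<integral>x. f (T x) \<partial>lborel)"
    using diagonal_pos by (subst integral_density) (auto simp: integral_distr less_imp_le)
  finally show ?thesis .
qed

lemma lborel_emeasure_diagonal:
  assumes [measurable]: "A \<in> sets borel"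
  shows "emeasure lborel A = ennreal J * emeasure lborel {x. T x \<in> A}"
proof -
  note [measurable] = diagonal_measurable
  have "emeasure lborel A = emeasure (density (distr lborel borel T) (\<lambda>_. ennreal J)) A"
    using lborel_diagonal by simp
  also have "\<dots> = ennreal J * emeasure lborel (T -` A)"
    by (subst emeasure_density) (simp_all add: nn_integral_cmult emeasure_distr)
  also have "T -` A = {x. T x \<in> A}" by auto
  finally show ?thesis .
qed

end

section \<open>Dilations by powers of two and their Jacobians\<close>

lemma dilate_component [simp]: "dilate j \<gamma> z $ i = 2 powi (j * \<gamma> $ i) * z $ i"
  by (simp add: dilate_def)

lemma dilate_dilate_uminus [simp]: "dilate j \<gamma> (dilate (- j) \<gamma> z) = z" "dilate (- j) \<gamma> (dilate j \<gamma> z) = z"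
  by (simp_all add: vec_eq_iff power_int_minus)

lemma continuous_on_dilate [continuous_intros]:
  "continuous_on A f \<Longrightarrow> continuous_on A (\<lambda>x. dilate j \<gamma> (f x))"
  unfolding dilate_def by (intro continuous_intros)

lemma dilate_add: "dilate j \<gamma> (x + y) = dilate j \<gamma> x + dilate j \<gamma> y"
  by (simp add: vec_eq_iff algebra_simps)

lemma dilate_measurable [measurable]: "dilate j \<gamma> \<in> borel \<rightarrow>\<^sub>M borel"
  by (intro borel_measurable_continuous_onI continuous_intros)

lemma prod_powi_eq: "(\<Prod>i\<in>A. (2::real) powi (f i)) = 2 powi (\<Sum>i\<in>A. f i)"
  by (induction A rule: infinite_finite_induct) (auto simp: power_int_add)

lemma dilate_inner_Basis:
  "b \<in> Basis \<Longrightarrow> dilate j \<gamma> z \<bullet> b = 2 powi (j * \<gamma> $ axis_index b) * (z \<bullet> b)"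
  by (auto simp: Basis_vec_def inner_axis axis_index_axis)

lemma prod_powi_Basis:
  fixes \<gamma> :: "int^'n"
  shows "(\<Prod>b\<in>(Basis::(real^'n) set). (2::real) powi (j * \<gamma> $ axis_index b)) = 2 powi (j * msize \<gamma>)"
proof -
  have B: "(Basis::(real^'n) set) = (\<lambda>i. axis i 1) ` UNIV" by (auto simp: Basis_vec_def)
  have "inj (\<lambda>i::'n. axis i (1::real))" by (auto simp: inj_on_def axis_eq_axis)
  then have "(\<Prod>b\<in>(Basis::(real^'n) set). (2::real) powi (j * \<gamma> $ axis_index b)) = (\<Prod>i\<in>UNIV. 2 powi (j * \<gamma> $ i))"
    unfolding B by (subst prod.reindex) (auto simp: axis_index_axis)
  then show ?thesis by (simp add: prod_powi_eq msize_def sum_distrib_left)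
qed

lemma lborel_integral_dilate:
  fixes f :: "real^'n \<Rightarrow> complex"
  assumes "f \<in> borel_measurable borel"
  shows "(\<integral>x. f x \<partial>lborel) = (2 powi (j * msize \<gamma>)) *\<^sub>R (\<integral>x. f (dilate j \<gamma> x) \<partial>lborel)"
  by (rule lborel_integral_diagonal[OF dilate_inner_Basis _ prod_powi_Basis assms]) auto

definition dilate_pair :: "int \<Rightarrow> int^'m \<Rightarrow> int^'k \<Rightarrow> (real^'m) \<times> (real^'k) \<Rightarrow> (real^'m) \<times> (real^'k)" where
  "dilate_pair j \<gamma> \<delta> x = (dilate j \<gamma> (fst x), dilate j \<delta> (snd x))"

lemma dilate_pair_dilate_pair_uminus [simp]:
  "dilate_pair j \<gamma> \<delta> (dilate_pair (- j) \<gamma> \<delta> z) = z" "dilate_pair (- j) \<gamma> \<delta> (dilate_pair j \<gamma> \<delta> z) = z"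
  by (simp_all add: dilate_pair_def)

lemma continuous_on_dilate_pair [continuous_intros]:
  "continuous_on A f \<Longrightarrow> continuous_on A (\<lambda>x. dilate_pair j \<gamma> \<delta> (f x))"
  unfolding dilate_pair_def by (intro continuous_intros)

lemma dilate_pair_measurable [measurable]: "dilate_pair j \<gamma> \<delta> \<in> borel \<rightarrow>\<^sub>M borel"
  by (intro borel_measurable_continuous_onI continuous_intros)

text \<open>Basis vectors of the product have the form (u, 0) or (0, v) with u, v basis vectors; the
  test \<open>snd b = 0\<close> tells the two kinds apart.\<close>

definition pair_scale :: "int \<Rightarrow> int^'m \<Rightarrow> int^'k \<Rightarrow> (real^'m) \<times> (real^'k) \<Rightarrow> real" where
  "pair_scale j \<gamma> \<delta> b = (if snd b = 0 then 2 powi (j * \<gamma> $ axis_index (fst b)) else 2 powi (j * \<delta> $ axis_index (snd b)))"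

lemma dilate_pair_inner_Basis:
  "b \<in> Basis \<Longrightarrow> dilate_pair j \<gamma> \<delta> z \<bullet> b = pair_scale j \<gamma> \<delta> b * (z \<bullet> b)"
  by (cases z) (auto simp: Basis_prod_def dilate_pair_def pair_scale_def dilate_inner_Basis)

lemma prod_pair_scale:
  fixes \<gamma> :: "int^'m" and \<delta> :: "int^'k"
  shows "(\<Prod>b\<in>Basis. pair_scale j \<gamma> \<delta> b) = 2 powi (j * (msize \<gamma> + msize \<delta>))"
proof -
  have "(\<Prod>b\<in>Basis. pair_scale j \<gamma> \<delta> b)
     = (\<Prod>b\<in>(\<lambda>u. (u, 0)) ` Basis. pair_scale j \<gamma> \<delta> b) * (\<Prod>b\<in>(\<lambda>v. (0, v)) ` Basis. pair_scale j \<gamma> \<delta> b)"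
    unfolding Basis_prod_def by (intro prod.union_disjoint) auto
  also have "(\<Prod>b\<in>(\<lambda>u. (u, 0)) ` Basis. pair_scale j \<gamma> \<delta> b) = (\<Prod>b\<in>(Basis::(real^'m) set). 2 powi (j * \<gamma> $ axis_index b))"
    by (subst prod.reindex) (auto simp: inj_on_def pair_scale_def)
  also have "(\<Prod>b\<in>(\<lambda>v. (0, v)) ` Basis. pair_scale j \<gamma> \<delta> b) = (\<Prod>b\<in>(Basis::(real^'k) set). 2 powi (j * \<delta> $ axis_index b))"
    by (subst prod.reindex) (auto simp: inj_on_def pair_scale_def intro!: prod.cong)
  finally show ?thesis by (simp add: prod_powi_Basis distrib_left power_int_add)
qed

lemma pair_scale_pos: "pair_scale j \<gamma> \<delta> b > 0"
  by (simp add: pair_scale_def)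

lemmas lborel_integral_dilate_pair = lborel_integral_diagonal[OF dilate_pair_inner_Basis pair_scale_pos prod_pair_scale]

lemma measure_dilate_pair:
  assumes A: "A \<in> sets borel" "emeasure lborel A < \<infinity>"
  shows "emeasure lborel {x. dilate_pair j \<gamma> \<delta> x \<in> A} < \<infinity>"
    and "measure lborel {x. dilate_pair j \<gamma> \<delta> x \<in> A} = 2 powi (- j * (msize \<gamma> + msize \<delta>)) * measure lborel A"
proof -
  have *: "emeasure lborel A = ennreal (2 powi (j * (msize \<gamma> + msize \<delta>))) * emeasure lborel {x. dilate_pair j \<gamma> \<delta> x \<in> A}"
    by (rule lborel_emeasure_diagonal[OF dilate_pair_inner_Basis pair_scale_pos prod_pair_scale A(1)])
  then show fin: "emeasure lborel {x. dilate_pair j \<gamma> \<delta> x \<in> A} < \<infinity>"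
    using A(2) by (auto simp: ennreal_mult_less_top)
  have "measure lborel A = 2 powi (j * (msize \<gamma> + msize \<delta>)) * measure lborel {x. dilate_pair j \<gamma> \<delta> x \<in> A}"
    unfolding measure_def * by (simp add: enn2real_mult)
  then show "measure lborel {x. dilate_pair j \<gamma> \<delta> x \<in> A} = 2 powi (- j * (msize \<gamma> + msize \<delta>)) * measure lborel A"
    by (simp add: power_int_minus)
qed

subsection \<open>Two selection principles\<close>

text \<open>The sets on which all terms from some index on are at most \<eta> are closed and cover
  the ball, so by Baire one of them has an interior point. Continuity is asked only from j0 on: in
  the application the dilated points lie in the domain of S only for large j.\<close>

lemma pointwise_null_sequence_uniform_on_ball:
  fixes \<phi> :: "nat \<Rightarrow> 'a::euclidean_space \<Rightarrow> real"
  assumes r: "r > 0" and cont: "\<And>j. j \<ge> j0 \<Longrightarrow> continuous_on (cball c r) (\<phi> j)"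
    and lim: "\<And>x. x \<in> cball c r \<Longrightarrow> (\<lambda>j. \<phi> j x) \<longlonglongrightarrow> 0" and \<eta>: "\<eta> > 0"
  shows "\<exists>d \<rho> n. \<rho> > 0 \<and> ball d \<rho> \<subseteq> cball c r \<and> (\<forall>j\<ge>n. \<forall>x\<in>ball d \<rho>. \<bar>\<phi> j x\<bar> \<le> \<eta>)"
proof -
  define A where "A n = {x \<in> cball c r. \<forall>j\<ge>max n j0. \<bar>\<phi> j x\<bar> \<le> \<eta>}" for n
  have closed: "closed (A n)" for n
  proof -
    have "A n = (\<Inter>j\<in>{max n j0..}. {x \<in> cball c r. \<bar>\<phi> j x\<bar> \<in> {..\<eta>}})"
      by (auto simp: A_def)
    moreover have "closed {x \<in> cball c r. \<bar>\<phi> j x\<bar> \<in> {..\<eta>}}" if "j \<ge> j0" for j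
      using continuous_closed_preimage[of "cball c r" "\<lambda>x. \<bar>\<phi> j x\<bar>" "{..\<eta>}"] cont[OF that]
      by (auto simp: vimage_def Int_def intro: continuous_intros)
    ultimately show ?thesis by (auto intro!: closed_INT)
  qed
  have cover: "x \<in> (\<Union>n. A n)" if x: "x \<in> cball c r" for x
  proof -
    have "\<forall>\<^sub>F j in sequentially. dist (\<phi> j x) 0 < \<eta>"
      using lim[OF x] \<eta> by (rule tendstoD)
    then obtain n where "\<And>j. j \<ge> n \<Longrightarrow> \<bar>\<phi> j x\<bar> < \<eta>"
      by (auto simp: eventually_sequentially)
    then have "x \<in> A n" using x by (auto simp: A_def less_imp_le)
    then show ?thesis by blast
  qed
  have "\<exists>n. interior (A n) \<noteq> {}"
  proof (rule ccontr)
    assume "\<not> (\<exists>n. interior (A n) \<noteq> {})"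
    then have int: "interior (A n) = {}" for n by blast
    have "cball c r \<subseteq> closure (\<Inter>(range (\<lambda>n. cball c r - A n)))"
    proof (rule Baire)
      fix T assume "T \<in> range (\<lambda>n. cball c r - A n)"
      then obtain n where T: "T = cball c r - A n" by blast
      have "cball c r \<subseteq> closure (cball c r - A n)"
      proof (rule ccontr)
        assume "\<not> cball c r \<subseteq> closure (cball c r - A n)"
        then obtain x where "x \<in> cball c r" "x \<notin> closure (cball c r - A n)"
          by blast
        then have x: "x \<in> closure (ball c r)" "x \<notin> closure (cball c r - A n)"
          using r by simp_all
        let ?O = "- closure (cball c r - A n)"
        have "open ?O" "x \<in> ?O" using x by auto
        then have "?O \<inter> ball c r \<noteq> {}" using x(1) closure_iff_nhds_not_empty by blast
        moreover have "?O \<inter> ball c r \<subseteq> A n"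
          using closure_subset[of "cball c r - A n"] ball_subset_cball[of c r] by blast
        moreover have "open (?O \<inter> ball c r)" by auto
        ultimately show False using int[of n] interior_maximal[of "?O \<inter> ball c r" "A n"] by auto
      qed
      then show "openin (top_of_set (cball c r)) T \<and> cball c r \<subseteq> closure T"
        unfolding T using closed[of n] openin_diff[OF openin_subtopology_self]
        by (auto intro!: openin_diff closed_subset simp: A_def)
    qed auto
    moreover have "(\<Inter>(range (\<lambda>n. cball c r - A n))) = {}" using cover by blast
    ultimately show False using r by (auto simp only: closure_empty) (meson centre_in_cball empty_iff less_imp_le subsetD)
  qed
  then obtain n d where "d \<in> interior (A n)" by blast
  then obtain \<rho> where \<rho>: "\<rho> > 0" "ball d \<rho> \<subseteq> A n"
    by (auto simp: mem_interior)
  then have "ball d \<rho> \<subseteq> cball c r" "\<forall>j\<ge>max n j0. \<forall>x\<in>ball d \<rho>. \<bar>\<phi> j x\<bar> \<le> \<eta>"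
    by (auto simp: A_def)
  then show ?thesis using \<rho>(1) by blast
qed

text \<open>The next index is taken beyond a bound after which every index is admissible, so R holds
  for all pairs and not just for consecutive ones. Growth is required against the sum of \<Theta>
  over all indices up to the current one, which is known before the selection; as \<Theta> is
  nonnegative, this dominates the sum over the selected indices.\<close>

lemma lacunary_subsequence:
  fixes A \<Theta> :: "nat \<Rightarrow> real" and R :: "nat \<Rightarrow> nat \<Rightarrow> bool"
  assumes R: "\<And>j. j \<ge> j0 \<Longrightarrow> \<forall>\<^sub>F i in sequentially. R j i" and A: "filterlim A at_top sequentially"
    and \<Theta>: "\<And>j. \<Theta> j \<ge> 0"
  shows "\<exists>\<sigma>. strict_mono \<sigma> \<and> (\<forall>m. \<sigma> m \<ge> j0) \<and> (\<forall>m n. m < n \<longrightarrow> R (\<sigma> m) (\<sigma> n)) \<and>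
           (\<forall>m. A (\<sigma> (Suc m)) \<ge> real m + (\<Sum>i\<le>m. \<Theta> (\<sigma> i)))"
proof -
  have "\<exists>g. g > j \<and> (\<forall>i\<ge>g. R j i \<and> A i \<ge> real j + (\<Sum>i\<le>j. \<Theta> i))" if "j \<ge> j0" for j
  proof -
    have "\<forall>\<^sub>F i in sequentially. A i \<ge> real j + (\<Sum>i\<le>j. \<Theta> i)"
      using A by (simp add: filterlim_at_top)
    then have "\<forall>\<^sub>F i in sequentially. i > j \<and> R j i \<and> A i \<ge> real j + (\<Sum>i\<le>j. \<Theta> i)"
      using R[OF that] eventually_gt_at_top[of j] by eventually_elim auto
    then show ?thesis unfolding eventually_sequentially by (metis order_refl)
  qed
  then obtain g where g: "\<And>j. j \<ge> j0 \<Longrightarrow> g j > j"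
    "\<And>j i. j \<ge> j0 \<Longrightarrow> i \<ge> g j \<Longrightarrow> R j i \<and> A i \<ge> real j + (\<Sum>i\<le>j. \<Theta> i)"
    by metis
  define \<sigma> where "\<sigma> = rec_nat j0 (\<lambda>_. g)"
  have \<sigma>: "\<sigma> 0 = j0" "\<sigma> (Suc m) = g (\<sigma> m)" for m by (simp_all add: \<sigma>_def)
  have ge: "\<sigma> m \<ge> j0" for m
    by (induction m) (use g(1) in \<open>auto simp: \<sigma> intro: less_imp_le order_trans\<close>)
  have mono: "strict_mono \<sigma>"
    by (intro strict_mono_Suc_iff[THEN iffD2]) (use g(1)[OF ge] in \<open>auto simp: \<sigma>\<close>)
  have "R (\<sigma> m) (\<sigma> n)" if "m < n" for m n
  proof -
    have "\<sigma> (Suc m) \<le> \<sigma> n" using that mono by (simp add: strict_mono_less_eq)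
    then show ?thesis using g(2)[OF ge[of m]] by (simp add: \<sigma>)
  qed
  moreover have "A (\<sigma> (Suc m)) \<ge> real m + (\<Sum>i\<le>m. \<Theta> (\<sigma> i))" for m
  proof -
    have "(\<Sum>i\<le>m. \<Theta> (\<sigma> i)) = (\<Sum>i\<in>\<sigma> ` {..m}. \<Theta> i)"
      using mono by (subst sum.reindex) (auto simp: strict_mono_imp_inj_on inj_on_subset)
    also have "\<dots> \<le> (\<Sum>i\<le>\<sigma> m. \<Theta> i)"
      using mono \<Theta> by (intro sum_mono2) (auto simp: strict_mono_less_eq)
    finally have "real m + (\<Sum>i\<le>m. \<Theta> (\<sigma> i)) \<le> real (\<sigma> m) + (\<Sum>i\<le>\<sigma> m. \<Theta> i)"
      using strict_mono_imp_increasing[OF mono, of m] by simp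
    also have "\<dots> \<le> A (\<sigma> (Suc m))"
      using g(2)[OF ge[of m], of "\<sigma> (Suc m)"] by (simp add: \<sigma>)
    finally show ?thesis .
  qed
  ultimately show ?thesis using mono ge by blast
qed

subsection \<open>Consequences of homogeneity\<close>

lemma smooth_on_imp_continuous_on: "smooth_on U f \<Longrightarrow> continuous_on U f"
  unfolding smooth_on_def by (metis higher_differentiable_on.simps(1))

lemma powi_uminus_le_power:
  assumes "c > 0"
  shows "(2::real) powi (- (int j * c)) \<le> (1/2) ^ j"
proof -
  have "int j * 1 \<le> int j * c" using assms by (intro mult_left_mono) auto
  then have "(2::real) powi (- (int j * c)) \<le> 2 powi (- int j)"
    by (intro power_int_increasing) auto
  then show ?thesis by (simp add: power_int_minus power_divide inverse_eq_divide)
qed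

lemma powi_uminus_tendsto_0:
  assumes "c > 0"
  shows "(\<lambda>j. (2::real) powi (- (int j * c))) \<longlonglongrightarrow> 0"
  using powi_uminus_le_power[OF assms]
  by (intro real_tendsto_sandwich[OF _ _ tendsto_const LIMSEQ_power_zero[of "1/2"]]) auto

lemma norm_dilate_le:
  assumes "\<And>i. \<gamma> $ i > 0"
  shows "norm (dilate (- int j) \<gamma> z) \<le> (1/2) ^ j * norm z"
proof -
  have "norm (dilate (- int j) \<gamma> z) \<le> norm ((1/2) ^ j *\<^sub>R z)"
    using mult_right_mono[OF powi_uminus_le_power[OF assms], of "\<bar>z $ i\<bar>" for i]
    by (intro norm_le_componentwise_cart) (simp add: abs_mult)
  then show ?thesis by simp
qed

lemma norm_axis: "norm (axis i c :: real^'n) = \<bar>c\<bar>"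
  by (simp add: norm_eq_sqrt_inner inner_axis_axis)

lemma dilate_zero [simp]: "dilate j \<gamma> 0 = 0"
  by (simp add: vec_eq_iff)

section \<open>Points in rescaled coordinates\<close>

definition triple :: "'a \<times> 'b \<Rightarrow> 'c \<Rightarrow> 'a \<times> 'b \<times> 'c" where
  "triple x y = (fst x, snd x, y)"

text \<open>Capital letters stand for rescaled variables throughout; the result is the corresponding
  small point at which S and \<psi> are evaluated.\<close>

definition dilate_triple :: "int^'m \<Rightarrow> int^'k \<Rightarrow> int^'m \<Rightarrow> nat \<Rightarrow> (real^'m) \<times> (real^'k) \<Rightarrow> real^'m
    \<Rightarrow> (real^'m) \<times> (real^'k) \<times> (real^'m)" where
  "dilate_triple \<alpha>' \<alpha>'' \<beta>' j X Y = triple (dilate_pair (- int j) \<alpha>' \<alpha>'' X) (dilate (- int j) \<beta>' Y)"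

lemma averaging_op_eq:
  "averaging_op S \<psi> f x = (\<integral>y. f (y, snd x + S (triple x y)) * \<psi> (triple x y) \<partial>lborel)"
  by (simp add: averaging_op_def case_prod_beta triple_def)

lemma continuous_on_triple [continuous_intros]:
  "continuous_on A f \<Longrightarrow> continuous_on A g \<Longrightarrow> continuous_on A (\<lambda>x. triple (f x) (g x))"
  unfolding triple_def by (intro continuous_intros)

lemma norm_triple_le: "norm (triple x y) \<le> 2 * norm x + norm y"
proof -
  have "norm (triple x y) \<le> norm (fst x) + norm (snd x, y)"
    unfolding triple_def by (rule norm_Pair_le)
  also have "\<dots> \<le> norm (fst x) + (norm (snd x) + norm y)"
    by (intro add_left_mono norm_Pair_le)
  finally show ?thesis using norm_fst_le[of "fst x" "snd x"] norm_snd_le[of "snd x" "fst x"] by simp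
qed

lemma norm_dilate_triple_le:
  assumes "\<And>i. \<alpha>' $ i > 0" "\<And>i. \<alpha>'' $ i > 0" "\<And>i. \<beta>' $ i > 0"
  shows "norm (dilate_triple \<alpha>' \<alpha>'' \<beta>' j X Y) \<le> (1/2) ^ j * (2 * norm X + norm Y)"
proof -
  have "norm (dilate_triple \<alpha>' \<alpha>'' \<beta>' j X Y)
      \<le> norm (dilate (- int j) \<alpha>' (fst X)) + (norm (dilate (- int j) \<alpha>'' (snd X)) + norm (dilate (- int j) \<beta>' Y))"
    unfolding dilate_triple_def triple_def dilate_pair_def fst_conv snd_conv
    by (rule order_trans[OF norm_Pair_le add_left_mono[OF norm_Pair_le]])
  also have "\<dots> \<le> (1/2)^j * norm (fst X) + ((1/2)^j * norm (snd X) + (1/2)^j * norm Y)"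
    using assms by (intro add_mono norm_dilate_le) auto
  also have "\<dots> \<le> (1/2)^j * norm X + ((1/2)^j * norm X + (1/2)^j * norm Y)"
    using norm_fst_le[of "fst X" "snd X"] norm_snd_le[of "snd X" "fst X"]
    by (intro add_mono mult_left_mono) auto
  finally show ?thesis by (simp add: algebra_simps)
qed

lemma dilate_triple_tendsto_0:
  assumes "\<And>i. \<alpha>' $ i > 0" "\<And>i. \<alpha>'' $ i > 0" "\<And>i. \<beta>' $ i > 0"
  shows "(\<lambda>j. dilate_triple \<alpha>' \<alpha>'' \<beta>' j X Y) \<longlonglongrightarrow> 0"
proof (rule Lim_null_comparison)
  show "\<forall>\<^sub>F j in sequentially. norm (dilate_triple \<alpha>' \<alpha>'' \<beta>' j X Y) \<le> (1/2) ^ j * (2 * norm X + norm Y)"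
    using norm_dilate_triple_le[OF assms] by (intro always_eventually allI)
  show "(\<lambda>j. (1/2::real) ^ j * (2 * norm X + norm Y)) \<longlonglongrightarrow> 0"
    by (intro tendsto_mult_left_zero LIMSEQ_power_zero) auto
qed

context
  fixes S SP :: "(real^'m) \<times> (real^'k) \<times> (real^'m) \<Rightarrow> (real^'k)"
    and \<alpha>' \<beta>' :: "int^'m" and \<alpha>'' \<beta>'' :: "int^'k"
  assumes hom: "homogeneity_conditions S \<alpha>' \<alpha>'' \<beta>' \<beta>'' SP"
begin

lemma homogeneity_tendsto_component:
  "(\<lambda>j. 2 powi (int j * \<beta>'' $ i) * S (dilate_triple \<alpha>' \<alpha>'' \<beta>' j X Y) $ i) \<longlonglongrightarrow> SP (triple X Y) $ i"
proof -
  have "(\<lambda>j. dilate (int j) \<beta>'' (S (dilate_triple \<alpha>' \<alpha>'' \<beta>' j X Y))) \<longlonglongrightarrow> SP (triple X Y)"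
    using hom unfolding homogeneity_conditions_def dilate_triple_def triple_def dilate_pair_def by simp
  from tendsto_vec_nth[OF this, of i] show ?thesis by simp
qed

text \<open>Here the strict inequality \<beta>'' > \<alpha>'' enters. At the scale \<alpha>'' of the
  boxes the translation by S disappears in the limit, while at the finer scale \<beta>'' of the
  oscillation it leaves the phase given by SP.\<close>

lemma homogeneity_dilate_tendsto_0:
  "(\<lambda>j. dilate (int j) \<alpha>'' (S (dilate_triple \<alpha>' \<alpha>'' \<beta>' j X Y))) \<longlonglongrightarrow> 0"
proof (rule vec_tendstoI)
  fix i
  have "(\<lambda>j. 2 powi (- (int j * (\<beta>'' $ i - \<alpha>'' $ i))) * (2 powi (int j * \<beta>'' $ i) * S (dilate_triple \<alpha>' \<alpha>'' \<beta>' j X Y) $ i))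
     \<longlonglongrightarrow> 0 * SP (triple X Y) $ i"
    using hom by (intro tendsto_mult homogeneity_tendsto_component powi_uminus_tendsto_0)
      (simp add: homogeneity_conditions_def)
  moreover have "2 powi (- (int j * (\<beta>'' $ i - \<alpha>'' $ i))) * (2 powi (int j * \<beta>'' $ i) * s) = 2 powi (int j * \<alpha>'' $ i) * s"
    for j and s :: real
  proof -
    have "2 powi (- (int j * (\<beta>'' $ i - \<alpha>'' $ i))) * 2 powi (int j * \<beta>'' $ i) = (2::real) powi (int j * \<alpha>'' $ i)"
      by (subst power_int_add[symmetric]) (auto simp: algebra_simps)
    then show ?thesis by (simp add: mult.assoc[symmetric])
  qed
  ultimately show "(\<lambda>j. dilate (int j) \<alpha>'' (S (dilate_triple \<alpha>' \<alpha>'' \<beta>' j X Y)) $ i) \<longlonglongrightarrow> 0 $ i"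
    by simp
qed

text \<open>The limit defining \<open>SP\<close> is only pointwise; by Baire's theorem it is uniform on some small ball, which can be
  chosen away from \<open>X''\<^sub>k = 0\<close>.\<close>

lemma homogeneity_test_region:
  fixes k :: 'k
  assumes U: "open U" "0 \<in> U" "continuous_on U S"
  shows "\<exists>\<rho>\<^sub>0 a d \<rho> n. \<rho>\<^sub>0 > 0 \<and> a > 0 \<and> \<rho> > 0 \<and>
     (\<forall>X Y. norm X < \<rho>\<^sub>0 \<longrightarrow> norm Y < \<rho>\<^sub>0 \<longrightarrow> \<bar>SP (triple X Y) $ k - SP 0 $ k\<bar> \<le> 1) \<and>
     (\<forall>X\<in>ball d \<rho>. norm X < \<rho>\<^sub>0 \<and> 2 * a \<le> snd X $ k) \<and>
     (\<forall>j\<ge>n. \<forall>X\<in>ball d \<rho>. \<bar>2 powi (int j * \<alpha>'' $ k) * S (dilate_triple \<alpha>' \<alpha>'' \<beta>' j X 0) $ k\<bar> \<le> a)"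
proof -
  have pos: "\<And>i. \<alpha>' $ i > 0" "\<And>i. \<alpha>'' $ i > 0" "\<And>i. \<beta>' $ i > 0"
    using hom by (auto simp: homogeneity_conditions_def)
  have "continuous_on UNIV SP"
    using hom by (intro smooth_on_imp_continuous_on) (simp add: homogeneity_conditions_def)
  then have "isCont (\<lambda>z. SP z $ k) 0"
    using continuous_on_eq_continuous_at[OF open_UNIV] by (intro continuous_intros) blast
  then obtain \<epsilon> where \<epsilon>: "\<epsilon> > 0" "\<And>z. dist z 0 < \<epsilon> \<Longrightarrow> dist (SP z $ k) (SP 0 $ k) < 1"
    unfolding continuous_at_eps_delta by (metis zero_less_one)
  \<comment> \<open>A third of \<epsilon>, because \<open>norm (triple X Y)\<close> is bounded by 2
    |X| + |Y|.\<close>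
  define \<rho>\<^sub>0 where "\<rho>\<^sub>0 = \<epsilon> / 3"
  have 1: "\<bar>SP (triple X Y) $ k - SP 0 $ k\<bar> \<le> 1" if "norm X < \<rho>\<^sub>0" "norm Y < \<rho>\<^sub>0" for X Y
    using \<epsilon>(2)[of "triple X Y"] norm_triple_le[of X Y] that by (auto simp: dist_norm \<rho>\<^sub>0_def)
  \<comment> \<open>The ball of radius \<rho>0 / 8 about height \<rho>0 / 2 lies inside the ball of
    radius \<rho>0, and on it the k-th component is at least 3 \<rho>0 / 8, hence at least 2
    a.\<close>
  define a where "a = \<rho>\<^sub>0 / 8"
  define c :: "(real^'m) \<times> (real^'k)" where "c = (0, axis k (\<rho>\<^sub>0 / 2))"
  have r0: "\<rho>\<^sub>0 > 0" "a > 0" using \<epsilon> by (auto simp: \<rho>\<^sub>0_def a_def)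
  have 2: "norm X < \<rho>\<^sub>0 \<and> 2 * a \<le> snd X $ k" if "X \<in> cball c a" for X
  proof
    have d: "norm (X - c) \<le> a" using that by (simp add: dist_norm norm_minus_commute)
    have "norm X \<le> norm (X - c) + norm c" using norm_triangle_ineq[of "X - c" c] by simp
    also have "norm c = \<rho>\<^sub>0 / 2" using r0 by (simp add: c_def norm_Pair norm_axis)
    finally show "norm X < \<rho>\<^sub>0" using d r0 by (simp add: a_def)
    have "\<bar>(snd X - axis k (\<rho>\<^sub>0 / 2)) $ k\<bar> \<le> norm (snd X - axis k (\<rho>\<^sub>0 / 2))"
      by (rule component_le_norm_cart)
    also have "\<dots> \<le> norm (X - c)"
      using norm_snd_le[of "snd (X - c)" "fst (X - c)"] unfolding prod.collapse by (simp add: c_def)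
    also have "\<dots> \<le> a" by (rule d)
    finally have "\<bar>snd X $ k - \<rho>\<^sub>0 / 2\<bar> \<le> \<rho>\<^sub>0 / 8" by (simp add: a_def axis_def)
    then show "2 * a \<le> snd X $ k" using r0 unfolding a_def by linarith
  qed
  obtain \<epsilon>' where \<epsilon>': "\<epsilon>' > 0" "ball 0 \<epsilon>' \<subseteq> U" using U by (auto simp: open_contains_ball)
  have "(\<lambda>j. (1/2::real) ^ j * (2 * \<rho>\<^sub>0)) \<longlonglongrightarrow> 0"
    by (intro tendsto_mult_left_zero LIMSEQ_power_zero) auto
  then have "\<forall>\<^sub>F j in sequentially. (1/2::real) ^ j * (2 * \<rho>\<^sub>0) < \<epsilon>'"
    using \<epsilon>'(1) by (rule order_tendstoD)
  then obtain j0 where j0: "\<And>j. j \<ge> j0 \<Longrightarrow> (1/2::real) ^ j * (2 * \<rho>\<^sub>0) < \<epsilon>'"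
    by (auto simp: eventually_sequentially)
  have inU: "dilate_triple \<alpha>' \<alpha>'' \<beta>' j X 0 \<in> U" if "j \<ge> j0" "X \<in> cball c a" for j X
  proof -
    have "norm (dilate_triple \<alpha>' \<alpha>'' \<beta>' j X 0) \<le> (1/2) ^ j * (2 * norm X + norm (0::real^'m))"
      by (rule norm_dilate_triple_le[OF pos])
    also have "\<dots> \<le> (1/2) ^ j * (2 * \<rho>\<^sub>0)"
      using 2[OF that(2)] by (intro mult_left_mono) auto
    also have "\<dots> < \<epsilon>'" by (rule j0[OF that(1)])
    finally show ?thesis using \<epsilon>'(2) by auto
  qed
  obtain d \<rho> n where "\<rho> > 0" "ball d \<rho> \<subseteq> cball c a"
     "\<forall>j\<ge>n. \<forall>X\<in>ball d \<rho>. \<bar>2 powi (int j * \<alpha>'' $ k) * S (dilate_triple \<alpha>' \<alpha>'' \<beta>' j X 0) $ k\<bar> \<le> a"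
  proof (rule exE[OF pointwise_null_sequence_uniform_on_ball[of a j0 c "\<lambda>j X. 2 powi (int j * \<alpha>'' $ k) * S (dilate_triple \<alpha>' \<alpha>'' \<beta>' j X 0) $ k" a]])
    show "continuous_on (cball c a) (\<lambda>X. 2 powi (int j * \<alpha>'' $ k) * S (dilate_triple \<alpha>' \<alpha>'' \<beta>' j X 0) $ k)" if "j \<ge> j0" for j
    proof (intro continuous_intros continuous_on_compose2[OF U(3)])
      show "continuous_on (cball c a) (\<lambda>X. dilate_triple \<alpha>' \<alpha>'' \<beta>' j X 0)"
        unfolding dilate_triple_def by (intro continuous_intros)
    qed (use inU[OF that] in auto)
    show "(\<lambda>j. 2 powi (int j * \<alpha>'' $ k) * S (dilate_triple \<alpha>' \<alpha>'' \<beta>' j x 0) $ k) \<longlonglongrightarrow> 0" for x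
    proof -
      have "(\<lambda>j. dilate (int j) \<alpha>'' (S (dilate_triple \<alpha>' \<alpha>'' \<beta>' j x 0)) $ k) \<longlonglongrightarrow> 0 $ k"
        by (rule tendsto_vec_nth[OF homogeneity_dilate_tendsto_0])
      then show ?thesis by simp
    qed
  qed (use r0 in blast)+
  then show ?thesis using r0 1 2 by blast
qed

end

subsection \<open>The test functions\<close>

text \<open>The assumption \<open>phase\<close> keeps the limiting phase within 1 of a constant, so
  that the amplitudes cannot cancel. The assumptions \<open>region\<close> and
  \<open>region_S\<close> keep x''_k + S_k at least a in rescaled units on the testing region. The
  latter concerns Y = 0 only: the pieces to be excluded there are those of much finer scale, for
  which y' is negligible.\<close>

locale averaging_test =
  fixes S SP :: "(real^'m) \<times> (real^'k) \<times> (real^'m) \<Rightarrow> (real^'k)"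
    and U :: "((real^'m) \<times> (real^'k) \<times> (real^'m)) set"
    and \<alpha>' \<beta>' :: "int^'m" and \<alpha>'' \<beta>'' :: "int^'k"
    and \<psi> :: "(real^'m) \<times> (real^'k) \<times> (real^'m) \<Rightarrow> complex"
    and k :: 'k and \<rho>\<^sub>0 a \<rho> :: real and d :: "(real^'m) \<times> (real^'k)" and n L :: nat
  assumes openU: "open U" and zeroU: "0 \<in> U" and contS: "continuous_on U S"
    and hom: "homogeneity_conditions S \<alpha>' \<alpha>'' \<beta>' \<beta>'' SP"
    and cutoff: "cutoff U \<psi>" and psi0: "\<psi> 0 \<noteq> 0"
    and region_pos: "\<rho>\<^sub>0 > 0" "a > 0" "\<rho> > 0"
    and phase: "\<And>X Y. norm X < \<rho>\<^sub>0 \<Longrightarrow> norm Y < \<rho>\<^sub>0 \<Longrightarrow> \<bar>SP (triple X Y) $ k - SP 0 $ k\<bar> \<le> 1"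
    and region: "\<And>X. X \<in> ball d \<rho> \<Longrightarrow> norm X < \<rho>\<^sub>0 \<and> 2 * a \<le> snd X $ k"
    and region_S: "\<And>j X. j \<ge> n \<Longrightarrow> X \<in> ball d \<rho> \<Longrightarrow>
           \<bar>2 powi (int j * \<alpha>'' $ k) * S (dilate_triple \<alpha>' \<alpha>'' \<beta>' j X 0) $ k\<bar> \<le> a"
begin

abbreviation dX where "dX j \<equiv> dilate_pair (int j) \<alpha>' \<alpha>''"
abbreviation dX' where "dX' j \<equiv> dilate_pair (- int j) \<alpha>' \<alpha>''"
abbreviation dZ where "dZ \<equiv> dilate_triple \<alpha>' \<alpha>'' \<beta>'"

definition freq :: "nat \<Rightarrow> real" where "freq j = 2 powi (int j * \<beta>'' $ k)"
definition shift :: "nat \<Rightarrow> real" where "shift j = pi / freq j"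
definition direction :: "(real^'m) \<times> (real^'k)" where "direction = (0, axis k 1)"

text \<open>The condition on the k-th component keeps the box off the hyperplane towards which the
  test functions of finer scales shrink. Both the disjointness of their supports and the exact
  vanishing of the tails rest on it.\<close>

definition test_box :: "((real^'m) \<times> (real^'k)) set" where
  "test_box = {y. norm (fst y) < \<rho>\<^sub>0 \<and> norm (snd y) < \<rho>\<^sub>0 \<and> a < snd y $ k}"

definition test_fun :: "nat \<Rightarrow> (real^'m) \<times> (real^'k) \<Rightarrow> complex" where
  "test_fun j y = indicator test_box (dilate_pair (int j) \<beta>' \<alpha>'' y) * cis (freq j * snd y $ k)"

text \<open>The phase is opposite to that of \<open>test_fun\<close>. Half the radius is used so
  that the translates occurring in an L-fold difference still fit into the ball of radius
  \<rho>.\<close>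

definition test_dual :: "nat \<Rightarrow> (real^'m) \<times> (real^'k) \<Rightarrow> complex" where
  "test_dual j x = indicator (ball d (\<rho>/2)) (dX j x) * cis (- (freq j * snd x $ k))"

text \<open>The modulus of the L-fold difference of \<open>test_dual\<close> in rescaled
  coordinates, where the step becomes 2^(j \<alpha>''_k) times \<open>shift j\<close>. The
  alternating signs are absent because the phase compensates them.\<close>

definition weight :: "nat \<Rightarrow> (real^'m) \<times> (real^'k) \<Rightarrow> real" where
  "weight j X = (\<Sum>l\<le>L. real (L choose l) * indicator (ball d (\<rho>/2)) (X - (real l * (2 powi (int j * \<alpha>'' $ k) * shift j)) *\<^sub>R direction))"

definition pairing :: "nat \<Rightarrow> ((real^'m) \<times> (real^'k) \<Rightarrow> complex) \<Rightarrow> complex" where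
  "pairing j u = (\<integral>x. u x * finite_difference L (- shift j *\<^sub>R direction) (test_dual j) x \<partial>lborel)"

lemma exponents_pos: "\<And>i. \<alpha>' $ i > 0" "\<And>i. \<alpha>'' $ i > 0" "\<And>i. \<beta>' $ i > 0" "\<And>i. \<beta>'' $ i > \<alpha>'' $ i"
  using hom by (auto simp: homogeneity_conditions_def)

lemma freq_pos: "freq j > 0" and shift_pos: "shift j > 0"
  by (simp_all add: freq_def shift_def)

lemma contSP: "continuous_on UNIV SP"
  using hom by (intro smooth_on_imp_continuous_on) (simp add: homogeneity_conditions_def)

section \<open>The cutoff and measurability\<close>

lemma cont_psi: "continuous_on UNIV \<psi>"
  using cutoff unfolding cutoff_def by (intro smooth_on_imp_continuous_on) simp

lemma psi_supp: "\<psi> z \<noteq> 0 \<Longrightarrow> z \<in> U"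
  using cutoff closure_subset[of "{z. \<psi> z \<noteq> 0}"] unfolding cutoff_def by blast

lemma psi_bounded: "\<exists>M>0. \<forall>z. norm (\<psi> z) \<le> M"
proof -
  let ?K = "closure {z. \<psi> z \<noteq> 0}"
  have "compact (\<psi> ` ?K)"
    using cutoff by (intro compact_continuous_image continuous_on_subset[OF cont_psi]) (auto simp: cutoff_def)
  then obtain M where M: "M > 0" "\<And>z. z \<in> ?K \<Longrightarrow> norm (\<psi> z) \<le> M"
    using compact_imp_bounded[of "\<psi> ` ?K"] by (auto simp: bounded_pos)
  have "norm (\<psi> z) \<le> M" for z
  proof (cases "\<psi> z = 0")
    case False
    then have "z \<in> ?K" using closure_subset[of "{z. \<psi> z \<noteq> 0}"] by blast
    then show ?thesis by (rule M(2))
  qed (use M(1) in auto)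
  then show ?thesis using M(1) by blast
qed

text \<open>S is arbitrary outside U and need not be measurable there. Since \<psi> vanishes outside
  U, replacing S by 0 does not change the averages.\<close>

definition St where "St z = (if z \<in> U then S z else 0)"

lemma St_measurable [measurable]: "St \<in> borel \<rightarrow>\<^sub>M borel"
  unfolding St_def[abs_def] using openU contS
  by (intro borel_measurable_continuous_on_if) auto

lemma psi_measurable [measurable]: "\<psi> \<in> borel \<rightarrow>\<^sub>M borel"
  by (rule borel_measurable_continuous_onI[OF cont_psi])

lemma psi_mult_St: "F (S z) * \<psi> z = F (St z) * \<psi> z"
  using psi_supp[of z] by (auto simp: St_def)

lemma averaging_op_St: "averaging_op S \<psi> f x = (\<integral>y. f (y, snd x + St (triple x y)) * \<psi> (triple x y) \<partial>lborel)"
  unfolding averaging_op_eq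
  by (intro Bochner_Integration.integral_cong refl) (rule psi_mult_St)

lemma borel_measurable_lborel_integral:
  fixes G :: "'x::euclidean_space \<times> 'y::euclidean_space \<Rightarrow> complex"
  assumes "G \<in> borel \<rightarrow>\<^sub>M borel"
  shows "(\<lambda>x. \<integral>y. G (x, y) \<partial>lborel) \<in> borel \<rightarrow>\<^sub>M borel"
proof -
  have "G \<in> borel \<Otimes>\<^sub>M lborel \<rightarrow>\<^sub>M borel"
    using assms by (subst measurable_cong_sets[OF _ refl]) (auto simp: borel_prod[symmetric] cong: sets_pair_measure_cong)
  then show ?thesis by (intro lborel.borel_measurable_lebesgue_integral) simp
qed

lemma averaging_integrand_measurable:
  assumes f: "f \<in> borel \<rightarrow>\<^sub>M borel"
  shows "(\<lambda>p. f (snd p, snd (fst p) + St (triple (fst p) (snd p))) * \<psi> (triple (fst p) (snd p))) \<in> borel \<rightarrow>\<^sub>M borel"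
proof -
  have t [measurable]: "(\<lambda>p. triple (fst p) (snd p)) \<in> borel \<rightarrow>\<^sub>M (borel :: ((real^'m) \<times> (real^'k) \<times> (real^'m)) measure)"
    by (intro borel_measurable_continuous_onI continuous_intros)
  have "(\<lambda>p. (snd p, snd (fst p) + St (triple (fst p) (snd p)))) \<in> (borel :: (((real^'m) \<times> (real^'k)) \<times> (real^'m)) measure) \<rightarrow>\<^sub>M borel"
    by (intro borel_measurable_Pair borel_measurable_add measurable_compose[OF t St_measurable] borel_measurable_continuous_onI continuous_intros)
  from measurable_compose[OF this f] show ?thesis
    by (intro borel_measurable_times measurable_compose[OF t psi_measurable])
qed

lemma averaging_op_measurable:
  assumes "f \<in> borel \<rightarrow>\<^sub>M borel"
  shows "averaging_op S \<psi> f \<in> borel \<rightarrow>\<^sub>M borel"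
  using borel_measurable_lborel_integral[OF averaging_integrand_measurable[OF assms]]
  by (simp add: averaging_op_St[abs_def])

lemma averaging_slice_measurable:
  assumes "f \<in> borel \<rightarrow>\<^sub>M borel"
  shows "(\<lambda>y. f (y, snd x + S (triple x y)) * \<psi> (triple x y)) \<in> borel \<rightarrow>\<^sub>M borel"
proof -
  have "(\<lambda>y. (x, y)) \<in> borel \<rightarrow>\<^sub>M borel"
    by (intro borel_measurable_continuous_onI continuous_intros)
  from measurable_compose[OF this averaging_integrand_measurable[OF assms]]
  show ?thesis by (simp add: psi_mult_St[of "\<lambda>s. f (y, snd x + s)" for y])
qed

lemma open_test_box: "open test_box"
  unfolding test_box_def by (intro open_Collect_conj open_Collect_less continuous_intros)

lemma cis_snd_measurable [measurable]: "(\<lambda>x::(real^'m) \<times> (real^'k). cis (c * snd x $ k)) \<in> borel \<rightarrow>\<^sub>M borel"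
  by (intro borel_measurable_continuous_onI continuous_intros)

lemma test_fun_measurable [measurable]: "test_fun j \<in> borel \<rightarrow>\<^sub>M borel"
  unfolding test_fun_def
  by (intro borel_measurable_times cis_snd_measurable measurable_compose[OF dilate_pair_measurable] borel_measurable_indicator)
     (simp add: open_test_box)

lemma test_dual_measurable [measurable]: "test_dual j \<in> borel \<rightarrow>\<^sub>M borel"
  unfolding test_dual_def minus_mult_left
  by (intro borel_measurable_times cis_snd_measurable measurable_compose[OF dilate_pair_measurable] borel_measurable_indicator)
     simp

lemma norm_direction: "norm direction = 1"
  by (simp add: direction_def norm_Pair norm_axis)

text \<open>The shift is half a period of the oscillation, so that the terms of the difference add up instead of cancelling.\<close>

lemma finite_difference_test_dual:
  "finite_difference L (- shift j *\<^sub>R direction) (test_dual j) x = of_real (weight j (dX j x)) * cis (- (freq j * snd x $ k))"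
proof -
  have "((-1)^l * real (L choose l)) *\<^sub>R test_dual j (x + real l *\<^sub>R - shift j *\<^sub>R direction)
     = of_real (real (L choose l) * indicator (ball d (\<rho>/2)) (dX j x - (real l * (2 powi (int j * \<alpha>'' $ k) * shift j)) *\<^sub>R direction)) * cis (- (freq j * snd x $ k))" for l
  proof -
    have 1: "dX j (x + real l *\<^sub>R - shift j *\<^sub>R direction) = dX j x - (real l * (2 powi (int j * \<alpha>'' $ k) * shift j)) *\<^sub>R direction"
      by (auto simp: dilate_pair_def direction_def prod_eq_iff vec_eq_iff axis_def algebra_simps)
    have "- (freq j * snd (x + real l *\<^sub>R - shift j *\<^sub>R direction) $ k) = - (freq j * snd x $ k) + real l * pi"
      using freq_pos[of j] by (simp add: direction_def shift_def axis_def field_simps)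
    then have 2: "cis (- (freq j * snd (x + real l *\<^sub>R - shift j *\<^sub>R direction) $ k)) = cis (- (freq j * snd x $ k)) * (-1)^l"
      by (simp only: cis_mult[symmetric] Complex.DeMoivre[symmetric] cis_pi)
    have 3: "((-1)^l * (-1)^l :: complex) = 1" by (simp flip: power_mult_distrib)
    show ?thesis unfolding test_dual_def 1 2
      by (simp add: scaleR_conv_of_real indicator_def 3 mult_ac)
  qed
  then show ?thesis unfolding finite_difference_def weight_def of_real_sum sum_distrib_right by (intro sum.cong refl)
qed

lemma weight_measurable [measurable]: "weight j \<in> borel \<rightarrow>\<^sub>M borel"
proof -
  have "(\<lambda>X. indicator (ball d (\<rho>/2)) (X - v)) \<in> borel \<rightarrow>\<^sub>M (borel :: real measure)" for v
    by (rule measurable_compose[OF _ borel_measurable_indicator]) (auto intro!: borel_measurable_continuous_onI continuous_intros)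
  then show ?thesis unfolding weight_def[abs_def] by (intro borel_measurable_sum borel_measurable_times) auto
qed

lemma weight_nonneg: "weight j X \<ge> 0"
  unfolding weight_def by (intro sum_nonneg mult_nonneg_nonneg) auto

lemma weight_le: "weight j X \<le> 2 ^ L"
proof -
  have "weight j X \<le> (\<Sum>l\<le>L. real (L choose l) * 1)"
    unfolding weight_def by (intro sum_mono mult_left_mono) (auto simp: indicator_def)
  also have "\<dots> = 2 ^ L"
    using choose_row_sum[of L] by (simp flip: of_nat_sum)
  finally show ?thesis .
qed

lemma indicator_le_weight: "indicator (ball d (\<rho>/2)) X \<le> weight j X"
proof -
  have "(\<Sum>l\<in>{0}. real (L choose l) * indicator (ball d (\<rho>/2)) (X - (real l * (2 powi (int j * \<alpha>'' $ k) * shift j)) *\<^sub>R direction)) \<le> weight j X"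
    unfolding weight_def by (intro sum_mono2 mult_nonneg_nonneg) auto
  then show ?thesis by simp
qed

text \<open>The rescaled step is \<pi> 2^(-j(\<beta>''_k - \<alpha>''_k)) and tends to 0, so
  eventually L steps move the smaller ball by less than \<rho> / 2.\<close>

lemma eventually_weight_support: "\<forall>\<^sub>F j in sequentially. \<forall>X. weight j X \<noteq> 0 \<longrightarrow> X \<in> ball d \<rho>"
proof -
  define \<tau> where "\<tau> j = 2 powi (int j * \<alpha>'' $ k) * shift j" for j
  have \<tau>: "\<tau> j = pi * 2 powi (- (int j * (\<beta>'' $ k - \<alpha>'' $ k)))" for j
    by (simp add: \<tau>_def shift_def freq_def power_int_diff right_diff_distrib)
  have "(\<lambda>j. real L * \<tau> j) \<longlonglongrightarrow> real L * (pi * 0)"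
    unfolding \<tau> using exponents_pos by (intro tendsto_intros powi_uminus_tendsto_0) simp
  then have "\<forall>\<^sub>F j in sequentially. real L * \<tau> j < \<rho>/2"
    using region_pos by (intro order_tendstoD) auto
  then show ?thesis
  proof (eventually_elim, intro allI impI)
    case (elim j)
    fix X assume "weight j X \<noteq> 0"
    then obtain l where l: "l \<le> L" "indicator (ball d (\<rho>/2)) (X - (real l * \<tau> j) *\<^sub>R direction) \<noteq> (0::real)"
      unfolding weight_def \<tau>_def by (metis (no_types, lifting) atMost_iff mult_zero_right sum.neutral)
    have \<tau>0: "\<tau> j \<ge> 0" using shift_pos[of j] by (simp add: \<tau>_def)
    have "norm (d - (X - (real l * \<tau> j) *\<^sub>R direction)) < \<rho>/2"
      using l(2) by (auto simp: indicator_def dist_norm split: if_splits)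
    moreover have "norm ((real l * \<tau> j) *\<^sub>R direction) \<le> real L * \<tau> j"
      using l(1) \<tau>0 by (simp add: norm_direction mult_right_mono)
    moreover have "norm (d - X) \<le> norm (d - (X - (real l * \<tau> j) *\<^sub>R direction)) + norm ((real l * \<tau> j) *\<^sub>R direction)"
      using norm_triangle_ineq4[of "d - (X - (real l * \<tau> j) *\<^sub>R direction)" "(real l * \<tau> j) *\<^sub>R direction"] by (simp add: algebra_simps)
    ultimately show "X \<in> ball d \<rho>" using elim by (simp add: dist_norm)
  qed
qed

section \<open>Amplitude of the averaged test functions\<close>

text \<open>The integrand of T f_j in rescaled coordinates without the factor exp(i N x''_k). That
  factor does not depend on the variable of integration, and what is left converges pointwise under
  a fixed integrable bound.\<close>

definition theta :: "nat \<Rightarrow> (real^'m) \<times> (real^'k) \<Rightarrow> real^'m \<Rightarrow> complex" where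
  "theta j X Y = indicator test_box (Y, snd X + dilate (int j) \<alpha>'' (S (dZ j X Y))) *
     cis (freq j * S (dZ j X Y) $ k) * \<psi> (dZ j X Y)"

definition amplitude :: "nat \<Rightarrow> (real^'m) \<times> (real^'k) \<Rightarrow> complex" where
  "amplitude j X = (\<integral>Y. theta j X Y \<partial>lborel)"

lemma test_fun_rescaled:
  "test_fun j (dilate (- int j) \<beta>' Y, snd (dX' j X) + S (dZ j X Y)) * \<psi> (dZ j X Y)
     = cis (freq j * snd (dX' j X) $ k) * theta j X Y"
proof -
  have "cis (freq j * (snd (dX' j X) + S (dZ j X Y)) $ k) = cis (freq j * snd (dX' j X) $ k) * cis (freq j * S (dZ j X Y) $ k)"
    by (simp add: cis_mult algebra_simps)
  moreover have "dilate_pair (int j) \<beta>' \<alpha>'' (dilate (- int j) \<beta>' Y, snd (dX' j X) + S (dZ j X Y)) = (Y, snd X + dilate (int j) \<alpha>'' (S (dZ j X Y)))"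
    by (simp add: dilate_pair_def dilate_add)
  ultimately show ?thesis by (simp add: test_fun_def theta_def mult_ac)
qed

lemma averaging_op_test_fun_rescaled:
  "averaging_op S \<psi> (test_fun j) (dX' j X) = (2 powi (- int j * msize \<beta>')) *\<^sub>R (cis (freq j * snd (dX' j X) $ k) * amplitude j X)"
proof -
  have "averaging_op S \<psi> (test_fun j) (dX' j X)
     = (2 powi (- int j * msize \<beta>')) *\<^sub>R (\<integral>Y. test_fun j (dilate (- int j) \<beta>' Y, snd (dX' j X) + S (dZ j X Y)) * \<psi> (dZ j X Y) \<partial>lborel)"
    unfolding averaging_op_eq dilate_triple_def
    by (rule lborel_integral_dilate[OF averaging_slice_measurable[OF test_fun_measurable]])
  then show ?thesis by (simp add: test_fun_rescaled amplitude_def)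
qed

text \<open>\<open>theta\<close> contains S itself, which may fail to be measurable. The measurable
  integrand of the average equals \<open>theta\<close> times a phase constant in Y, and
  multiplication by the inverse phase recovers it.\<close>

lemma theta_measurable: "theta j X \<in> borel \<rightarrow>\<^sub>M borel"
proof -
  have "(\<lambda>Y. test_fun j (dilate (- int j) \<beta>' Y, snd (dX' j X) + S (dZ j X Y)) * \<psi> (dZ j X Y)) \<in> borel \<rightarrow>\<^sub>M borel"
    unfolding dilate_triple_def
    by (rule measurable_compose[OF dilate_measurable averaging_slice_measurable[OF test_fun_measurable]])
  then have "(\<lambda>Y. cis (- (freq j * snd (dX' j X) $ k)) * (cis (freq j * snd (dX' j X) $ k) * theta j X Y)) \<in> borel \<rightarrow>\<^sub>M borel"
    unfolding test_fun_rescaled by (rule borel_measurable_times[OF borel_measurable_const])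
  moreover have "(\<lambda>Y. cis (- (freq j * snd (dX' j X) $ k)) * (cis (freq j * snd (dX' j X) $ k) * theta j X Y)) = theta j X"
    by (simp add: mult.assoc[symmetric] cis_mult)
  ultimately show ?thesis by (simp only:)
qed

lemma amplitude_measurable [measurable]: "amplitude j \<in> borel \<rightarrow>\<^sub>M borel"
proof -
  have "(\<lambda>X. averaging_op S \<psi> (test_fun j) (dX' j X)) \<in> borel \<rightarrow>\<^sub>M borel"
    by (rule measurable_compose[OF dilate_pair_measurable averaging_op_measurable[OF test_fun_measurable]])
  moreover have "(\<lambda>X. cis (- freq j * snd (dX' j X) $ k)) \<in> borel \<rightarrow>\<^sub>M borel"
    by (rule measurable_compose[OF dilate_pair_measurable cis_snd_measurable])
  ultimately have "(\<lambda>X. inverse (2 powi (- int j * msize \<beta>')) *\<^sub>R (cis (- freq j * snd (dX' j X) $ k) * averaging_op S \<psi> (test_fun j) (dX' j X))) \<in> borel \<rightarrow>\<^sub>M borel"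
    by (intro borel_measurable_scaleR borel_measurable_times) auto
  moreover have "inverse (2 powi (- int j * msize \<beta>')) *\<^sub>R (cis (- freq j * snd (dX' j X) $ k) * averaging_op S \<psi> (test_fun j) (dX' j X)) = amplitude j X" for X
    unfolding averaging_op_test_fun_rescaled by (simp add: mult.assoc[symmetric] cis_mult)
  ultimately show ?thesis by simp
qed

text \<open>The phases of T f_j and of the differenced dual function are inverse to each other, so
  no oscillation is left; the power of 2 collects the Jacobians of the changes of variable in x and
  y'.\<close>

lemma pairing_test_fun:
  "pairing j (averaging_op S \<psi> (test_fun j)) =
    (2 powi (- int j * (msize \<alpha>' + msize \<alpha>'' + msize \<beta>'))) *\<^sub>R (\<integral>X. of_real (weight j X) * amplitude j X \<partial>lborel)"
proof -
  have 1: "pairing j (averaging_op S \<psi> (test_fun j)) = (2 powi (- int j * (msize \<alpha>' + msize \<alpha>''))) *\<^sub>R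
      (\<integral>X. averaging_op S \<psi> (test_fun j) (dX' j X) * finite_difference L (- shift j *\<^sub>R direction) (test_dual j) (dX' j X) \<partial>lborel)"
    unfolding pairing_def
  proof (rule lborel_integral_dilate_pair)
    have "(\<lambda>x. weight j (dX j x)) \<in> borel \<rightarrow>\<^sub>M borel"
      by (rule measurable_compose[OF dilate_pair_measurable weight_measurable])
    then have "(\<lambda>x. of_real (weight j (dX j x)) * cis (- freq j * snd x $ k)) \<in> borel \<rightarrow>\<^sub>M (borel :: complex measure)"
      by (intro borel_measurable_times cis_snd_measurable) measurable
    then show "(\<lambda>x. averaging_op S \<psi> (test_fun j) x * finite_difference L (- shift j *\<^sub>R direction) (test_dual j) x) \<in> borel \<rightarrow>\<^sub>M borel"
      unfolding finite_difference_test_dual minus_mult_left by (rule borel_measurable_times[OF averaging_op_measurable[OF test_fun_measurable]])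
  qed
  have 2: "averaging_op S \<psi> (test_fun j) (dX' j X) * finite_difference L (- shift j *\<^sub>R direction) (test_dual j) (dX' j X)
      = (2 powi (- int j * msize \<beta>')) *\<^sub>R (of_real (weight j X) * amplitude j X)" for X
  proof -
    have "cis t * cis (- t) = 1" for t
      by (simp add: cis_mult)
    then have "cis t * A * (W * cis (- t)) = W * A" for t A W
      by (metis (no_types, lifting) mult.assoc mult.commute mult.right_neutral)
    then show ?thesis unfolding averaging_op_test_fun_rescaled finite_difference_test_dual
      by (simp only: mult_scaleR_left dilate_pair_dilate_pair_uminus)
  qed
  have "(2::real) powi (- int j * (msize \<alpha>' + msize \<alpha>'' + msize \<beta>'))
      = 2 powi (- int j * (msize \<alpha>' + msize \<alpha>'')) * 2 powi (- int j * msize \<beta>')"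
    by (subst power_int_add[symmetric]) (auto simp: algebra_simps)
  then show ?thesis
    unfolding 1 2 by simp
qed

text \<open>Dominated convergence in Y gives a limit amplitude whose values, after one common
  rotation, have real part bounded below. A second dominated convergence, in X, transfers this to
  the integral. About the weights only the bounds by the two indicators are used, not a
  limit.\<close>

lemma eventually_amplitude_lower_bound:
  "\<exists>c>0. \<forall>\<^sub>F j in sequentially. c \<le> norm (\<integral>X. of_real (weight j X) * amplitude j X \<partial>lborel)"
proof -
  obtain M where M: "M > 0" "\<And>z. norm (\<psi> z) \<le> M" using psi_bounded by blast
  define Q where "Q = ball (0::real^'m) \<rho>\<^sub>0"
  define v where "v = measure lborel Q"
  have Qfin: "emeasure lborel Q < \<infinity>" unfolding Q_def by (intro emeasure_bounded_finite) auto
  have v: "v > 0" unfolding v_def Q_def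
    using content_ball_pos[OF region_pos(1), of "0::real^'m"] by simp
  have [measurable]: "Q \<in> sets borel" by (simp add: Q_def)
  \<comment> \<open>In the limit \<psi> is frozen at the origin, the phase becomes that of SP, and
    the box only restricts Y to Q.\<close>
  define limit_amplitude where "limit_amplitude X = (\<integral>Y. indicator Q Y * cis (SP (triple X Y) $ k) * \<psi> 0 \<partial>lborel)" for X
  have intQ: "integrable lborel (\<lambda>Y. M * indicator Q Y)"
    using Qfin by (intro integrable_mult_right integrable_real_indicator) auto
  have cSP: "continuous_on UNIV (\<lambda>p. cis (SP (triple (fst p) (snd p)) $ k))"
    by (intro continuous_intros continuous_on_compose2[OF contSP]) auto
  have mSP: "(\<lambda>p. indicator Q (snd p) * cis (SP (triple (fst p) (snd p)) $ k) * \<psi> 0) \<in> borel \<rightarrow>\<^sub>M borel"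
  proof (intro borel_measurable_times borel_measurable_continuous_onI[OF cSP])
    show "(\<lambda>p::((real^'m) \<times> (real^'k)) \<times> (real^'m). indicator Q (snd p)) \<in> borel \<rightarrow>\<^sub>M (borel :: complex measure)"
      by (rule measurable_compose[OF _ borel_measurable_indicator]) (auto intro!: borel_measurable_continuous_onI continuous_intros)
  qed auto
  have mL: "(\<lambda>Y. indicator Q Y * cis (SP (triple X Y) $ k) * \<psi> 0) \<in> borel \<rightarrow>\<^sub>M borel" for X
    using measurable_compose[OF _ mSP, of "\<lambda>Y. (X, Y)"] by (auto intro!: borel_measurable_continuous_onI continuous_intros)
  have [measurable]: "limit_amplitude \<in> borel \<rightarrow>\<^sub>M borel"
    unfolding limit_amplitude_def using borel_measurable_lborel_integral[OF mSP] by simp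
  have thetaQ: "norm (theta j X Y) \<le> M * indicator Q Y" for j X Y
    using M by (auto simp: theta_def norm_mult indicator_def test_box_def Q_def)
  have amplitude_le: "norm (amplitude j X) \<le> M * v" for j X
  proof -
    have "norm (amplitude j X) \<le> (\<integral>Y. M * indicator Q Y \<partial>lborel)"
      unfolding amplitude_def by (intro Bochner_Integration.integral_norm_bound_integral Bochner_Integration.integrable_bound[OF intQ])
        (use theta_measurable thetaQ in \<open>auto simp: intro!: AE_I2 order_trans[OF thetaQ]\<close>)
    then show ?thesis by (simp add: v_def)
  qed
  have intL: "integrable lborel (\<lambda>Y. indicator Q Y * cis (SP (triple X Y) $ k) * \<psi> 0)" for X
    by (rule Bochner_Integration.integrable_bound[OF intQ]) (use mL M in \<open>auto simp: norm_mult indicator_def\<close>)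
  have limit_amplitude_le: "norm (limit_amplitude X) \<le> M * v" for X
  proof -
    have "norm (limit_amplitude X) \<le> (\<integral>Y. M * indicator Q Y \<partial>lborel)"
      unfolding limit_amplitude_def using intL intQ M
      by (intro Bochner_Integration.integral_norm_bound_integral) (auto simp: norm_mult indicator_def)
    then show ?thesis by (simp add: v_def)
  qed
  have lim: "(\<lambda>j. amplitude j X) \<longlonglongrightarrow> limit_amplitude X" if X: "X \<in> ball d \<rho>" for X
    unfolding amplitude_def limit_amplitude_def
  proof (rule integral_dominated_convergence[where w="\<lambda>Y. M * indicator Q Y"])
    show "AE Y in lborel. (\<lambda>j. theta j X Y) \<longlonglongrightarrow> indicator Q Y * cis (SP (triple X Y) $ k) * \<psi> 0"
    proof (intro AE_I2)
      fix Y
      show "(\<lambda>j. theta j X Y) \<longlonglongrightarrow> indicator Q Y * cis (SP (triple X Y) $ k) * \<psi> 0"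
      proof (cases "Y \<in> Q")
        case False
        then show ?thesis by (simp add: theta_def test_box_def Q_def indicator_def)
      next
        case True
        have "(\<lambda>j. (Y, snd X + dilate (int j) \<alpha>'' (S (dZ j X Y)))) \<longlonglongrightarrow> (Y, snd X + 0)"
          by (intro tendsto_intros homogeneity_dilate_tendsto_0[OF hom])
        \<comment> \<open>The limit point lies in the open box because 2 a exceeds a; hence the
          indicator is eventually constant, although it is discontinuous.\<close>
        moreover have "(Y, snd X + 0) \<in> test_box"
          using True region[OF X] region_pos norm_snd_le[of "snd X" "fst X"] by (simp add: test_box_def Q_def)
        ultimately have "\<forall>\<^sub>F j in sequentially. (Y, snd X + dilate (int j) \<alpha>'' (S (dZ j X Y))) \<in> test_box"
          by (rule topological_tendstoD[OF _ open_test_box])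
        then have "\<forall>\<^sub>F j in sequentially. (indicator test_box (Y, snd X + dilate (int j) \<alpha>'' (S (dZ j X Y))) :: complex) = 1"
          by eventually_elim simp
        then have 1: "(\<lambda>j. indicator test_box (Y, snd X + dilate (int j) \<alpha>'' (S (dZ j X Y))) :: complex) \<longlonglongrightarrow> 1"
          by (rule tendsto_eventually)
        have 2: "(\<lambda>j. cis (freq j * S (dZ j X Y) $ k)) \<longlonglongrightarrow> cis (SP (triple X Y) $ k)"
          unfolding freq_def by (intro tendsto_intros homogeneity_tendsto_component[OF hom])
        have "(\<lambda>j. \<psi> (dZ j X Y)) \<longlonglongrightarrow> \<psi> 0"
          using cont_psi by (intro isCont_tendsto_compose[of _ \<psi>] dilate_triple_tendsto_0 exponents_pos)
            (metis UNIV_I continuous_on_eq_continuous_at open_UNIV)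
        from tendsto_mult[OF tendsto_mult[OF 1 2] this]
        show ?thesis unfolding theta_def using True by simp
      qed
    qed
    show "AE Y in lborel. norm (theta j X Y) \<le> M * indicator Q Y" for j
      using thetaQ by auto
  qed (use mL theta_measurable intQ in auto)
  define c1 where "c1 = norm (\<psi> 0) * cos 1 * v"
  have cos1: "cos (1::real) > 0" using cos_gt_zero_pi[of 1] pi_gt3 by simp
  have c1: "c1 > 0" using psi0 cos1 v by (simp add: c1_def)
  \<comment> \<open>This rotation removes the argument of \<psi> 0 and the constant phase of SP at
    0. The phase that remains is at most 1 in modulus, which is where cos 1 in \<open>c1\<close>
    comes from.\<close>
  define \<omega> where "\<omega> = cis (- SP 0 $ k) * (cnj (\<psi> 0) / norm (\<psi> 0))"
  have \<omega>: "norm \<omega> = 1" using psi0 by (simp add: \<omega>_def norm_mult norm_divide)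
  have Re_limit_amplitude: "Re (\<omega> * limit_amplitude X) \<ge> c1" if X: "X \<in> ball d \<rho>" for X
  proof -
    have eq: "\<omega> * (indicator Q Y * cis (SP (triple X Y) $ k) * \<psi> 0) = of_real (indicator Q Y * norm (\<psi> 0)) * cis (SP (triple X Y) $ k - SP 0 $ k)" for Y
    proof -
      have "cnj (\<psi> 0) / norm (\<psi> 0) * \<psi> 0 = norm (\<psi> 0)"
        using psi0 by (simp add: complex_norm_square[symmetric] mult.commute power2_eq_square)
      moreover have "cis (- SP 0 $ k) * cis (SP (triple X Y) $ k) = cis (SP (triple X Y) $ k - SP 0 $ k)"
        by (simp add: cis_mult)
      moreover have "\<omega> * (indicator Q Y * cis (SP (triple X Y) $ k) * \<psi> 0)
         = indicator Q Y * (cnj (\<psi> 0) / norm (\<psi> 0) * \<psi> 0) * (cis (- SP 0 $ k) * cis (SP (triple X Y) $ k))"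
        by (simp add: \<omega>_def mult_ac)
      ultimately show ?thesis by (simp add: indicator_def)
    qed
    have "\<omega> * limit_amplitude X = (\<integral>Y. \<omega> * (indicator Q Y * cis (SP (triple X Y) $ k) * \<psi> 0) \<partial>lborel)"
      by (simp add: limit_amplitude_def)
    then have "Re (\<omega> * limit_amplitude X) = (\<integral>Y. Re (\<omega> * (indicator Q Y * cis (SP (triple X Y) $ k) * \<psi> 0)) \<partial>lborel)"
      using intL[of X] by (simp only:) (subst integral_Re, auto)
    also have "\<dots> = (\<integral>Y. indicator Q Y * norm (\<psi> 0) * cos (SP (triple X Y) $ k - SP 0 $ k) \<partial>lborel)"
      unfolding eq by simp
    also have "\<dots> \<ge> (\<integral>Y. (norm (\<psi> 0) * cos 1) * indicator Q Y \<partial>lborel)"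
    proof (rule integral_mono)
      show "integrable lborel (\<lambda>Y. (norm (\<psi> 0) * cos 1) * indicator Q Y)"
        using Qfin by (intro integrable_mult_right integrable_real_indicator) auto
      have "integrable lborel (\<lambda>Y. Re (\<omega> * (indicator Q Y * cis (SP (triple X Y) $ k) * \<psi> 0)))"
        using intL by (intro integrable_Re integrable_mult_right) auto
      then show "integrable lborel (\<lambda>Y. indicator Q Y * norm (\<psi> 0) * cos (SP (triple X Y) $ k - SP 0 $ k))"
        unfolding eq by simp
      fix Y
      show "(norm (\<psi> 0) * cos 1) * indicator Q Y \<le> indicator Q Y * norm (\<psi> 0) * cos (SP (triple X Y) $ k - SP 0 $ k)"
      proof (cases "Y \<in> Q")
        case True
        have "\<bar>SP (triple X Y) $ k - SP 0 $ k\<bar> \<le> 1"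
          using True region[OF X] by (intro phase) (auto simp: Q_def)
        then have "cos 1 \<le> cos \<bar>SP (triple X Y) $ k - SP 0 $ k\<bar>"
          using pi_gt3 by (intro cos_monotone_0_pi_le) auto
        then show ?thesis using True by (simp add: mult_left_mono)
      qed simp
    qed
    also have "(\<integral>Y. (norm (\<psi> 0) * cos 1) * indicator Q Y \<partial>lborel) = c1"
      by (simp add: c1_def v_def)
    finally show ?thesis .
  qed
  define D where "D = ball d \<rho>"
  define b where "b = measure lborel (ball d (\<rho>/2))"
  have b: "b > 0" unfolding b_def using content_ball_pos[of "\<rho>/2" d] region_pos by simp
  have Dm [measurable]: "D \<in> sets borel" by (simp add: D_def)
  have Dfin: "emeasure lborel D < \<infinity>" unfolding D_def by (intro emeasure_bounded_finite) auto
  have intD: "integrable lborel (\<lambda>X. C * indicator D X)" for C :: real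
    using Dfin by (intro integrable_mult_right integrable_real_indicator) auto
  \<comment> \<open>The amplitudes converge in L^1 over D. Together with the uniform bound 2 ^ L on
    the weights this allows the limit amplitude to be inserted although the weights vary with
    j.\<close>
  have err: "(\<lambda>j. \<integral>X. indicator D X * norm (amplitude j X - limit_amplitude X) \<partial>lborel) \<longlonglongrightarrow> (\<integral>X. 0 \<partial>(lborel :: ((real^'m) \<times> (real^'k)) measure))"
  proof (rule integral_dominated_convergence[where w="\<lambda>X. (2 * (M * v)) * indicator D X"])
    show "AE X in lborel. (\<lambda>j. indicator D X * norm (amplitude j X - limit_amplitude X)) \<longlonglongrightarrow> 0"
    proof (intro AE_I2)
      fix X
      show "(\<lambda>j. indicator D X * norm (amplitude j X - limit_amplitude X)) \<longlonglongrightarrow> 0"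
      proof (cases "X \<in> D")
        case True
        then have "(\<lambda>j. norm (amplitude j X - limit_amplitude X)) \<longlonglongrightarrow> norm (limit_amplitude X - limit_amplitude X)"
          by (intro tendsto_intros lim) (simp add: D_def)
        then show ?thesis using True by simp
      qed simp
    qed
    show "AE X in lborel. norm (indicator D X * norm (amplitude j X - limit_amplitude X)) \<le> (2 * (M * v)) * indicator D X" for j
    proof (intro AE_I2)
      fix X
      have "norm (amplitude j X - limit_amplitude X) \<le> 2 * (M * v)"
        using norm_triangle_ineq4[of "amplitude j X" "limit_amplitude X"] amplitude_le[of j X] limit_amplitude_le[of X] by simp
      then show "norm (indicator D X * norm (amplitude j X - limit_amplitude X)) \<le> (2 * (M * v)) * indicator D X"
        by (simp add: indicator_def)
    qed
  qed (use intD in auto)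
  then have "(\<lambda>j. 2 ^ L * (\<integral>X. indicator D X * norm (amplitude j X - limit_amplitude X) \<partial>lborel)) \<longlonglongrightarrow> 2 ^ L * 0"
    by (intro tendsto_mult tendsto_const) simp
  then have "\<forall>\<^sub>F j in sequentially. 2 ^ L * (\<integral>X. indicator D X * norm (amplitude j X - limit_amplitude X) \<partial>lborel) < c1 * b / 2"
    using c1 b by (intro order_tendstoD(2)) (assumption, simp)
  with eventually_weight_support have "\<forall>\<^sub>F j in sequentially. c1 * b / 2 \<le> norm (\<integral>X. of_real (weight j X) * amplitude j X \<partial>lborel)"
  proof eventually_elim
    case (elim j)
    have w0: "weight j X = 0" if "X \<notin> D" for X using elim(1) that unfolding D_def by blast
    have wD: "weight j X \<le> 2 ^ L * indicator D X" for X
      using weight_le[of j X] w0[of X] by (cases "X \<in> D") auto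
    have i1: "integrable lborel (\<lambda>X. of_real (weight j X) * amplitude j X)"
    proof (rule Bochner_Integration.integrable_bound[OF intD[of "2 ^ L * (M * v)"]])
      show "AE X in lborel. norm (of_real (weight j X) * amplitude j X) \<le> norm (2 ^ L * (M * v) * indicator D X)"
        using mult_mono[OF wD amplitude_le] weight_nonneg M v by (auto simp: norm_mult mult_ac)
    qed auto
    have i2: "integrable lborel (\<lambda>X. of_real (weight j X) * limit_amplitude X)"
    proof (rule Bochner_Integration.integrable_bound[OF intD[of "2 ^ L * (M * v)"]])
      show "AE X in lborel. norm (of_real (weight j X) * limit_amplitude X) \<le> norm (2 ^ L * (M * v) * indicator D X)"
        using mult_mono[OF wD limit_amplitude_le] weight_nonneg M v by (auto simp: norm_mult mult_ac)
    qed auto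
    have "norm ((\<integral>X. of_real (weight j X) * amplitude j X \<partial>lborel) - (\<integral>X. of_real (weight j X) * limit_amplitude X \<partial>lborel))
        = norm (\<integral>X. of_real (weight j X) * (amplitude j X - limit_amplitude X) \<partial>lborel)"
      using i1 i2 by (simp add: right_diff_distrib)
    also have "\<dots> \<le> (\<integral>X. 2 ^ L * (indicator D X * norm (amplitude j X - limit_amplitude X)) \<partial>lborel)"
    proof (rule Bochner_Integration.integral_norm_bound_integral)
      show "integrable lborel (\<lambda>X. of_real (weight j X) * (amplitude j X - limit_amplitude X))"
        using i1 i2 by (simp add: right_diff_distrib)
      show "integrable lborel (\<lambda>X. 2 ^ L * (indicator D X * norm (amplitude j X - limit_amplitude X)))"
      proof (rule Bochner_Integration.integrable_bound[OF intD[of "2 ^ L * (2 * (M * v))"]])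
        show "AE X in lborel. norm (2 ^ L * (indicator D X * norm (amplitude j X - limit_amplitude X))) \<le> norm (2 ^ L * (2 * (M * v)) * indicator D X)"
        proof (intro AE_I2)
          fix X
          have "norm (amplitude j X - limit_amplitude X) \<le> 2 * (M * v)"
            using norm_triangle_ineq4[of "amplitude j X" "limit_amplitude X"] amplitude_le[of j X] limit_amplitude_le[of X] by simp
          then show "norm (2 ^ L * (indicator D X * norm (amplitude j X - limit_amplitude X))) \<le> norm (2 ^ L * (2 * (M * v)) * indicator D X)"
            using M v by (simp add: indicator_def abs_mult)
        qed
      qed auto
      show "norm (of_real (weight j X) * (amplitude j X - limit_amplitude X)) \<le> 2 ^ L * (indicator D X * norm (amplitude j X - limit_amplitude X))" for X
        using mult_right_mono[OF wD, of "norm (amplitude j X - limit_amplitude X)" X] weight_nonneg[of j X] by (simp add: norm_mult)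
    qed
    also have "\<dots> < c1 * b / 2" using elim(2) by simp
    finally have 1: "norm ((\<integral>X. of_real (weight j X) * amplitude j X \<partial>lborel) - (\<integral>X. of_real (weight j X) * limit_amplitude X \<partial>lborel)) < c1 * b / 2" .
    \<comment> \<open>The term l = 0 alone bounds the weight below by 1 on the smaller ball. The
      error above costs at most half of the resulting bound.\<close>
    have "c1 * b = (\<integral>X. c1 * indicator (ball d (\<rho>/2)) X \<partial>lborel)" by (simp add: b_def)
    also have "\<dots> \<le> (\<integral>X. Re (\<omega> * (of_real (weight j X) * limit_amplitude X)) \<partial>lborel)"
    proof (rule integral_mono)
      show "integrable lborel (\<lambda>X. c1 * indicator (ball d (\<rho>/2)) X)"
        by (intro integrable_mult_right integrable_real_indicator) (use emeasure_bounded_finite[OF bounded_ball, of d "\<rho>/2"] in auto)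
      show "integrable lborel (\<lambda>X. Re (\<omega> * (of_real (weight j X) * limit_amplitude X)))"
        using i2 by (intro integrable_Re integrable_mult_right) auto
      fix X
      have e: "Re (\<omega> * (of_real (weight j X) * limit_amplitude X)) = weight j X * Re (\<omega> * limit_amplitude X)"
        by (simp add: algebra_simps)
      show "c1 * indicator (ball d (\<rho>/2)) X \<le> Re (\<omega> * (of_real (weight j X) * limit_amplitude X))"
      proof (cases "X \<in> D")
        case True
        have "c1 * indicator (ball d (\<rho>/2)) X \<le> c1 * weight j X"
          using c1 indicator_le_weight by (intro mult_left_mono) auto
        also have "\<dots> \<le> Re (\<omega> * limit_amplitude X) * weight j X"
          using Re_limit_amplitude True weight_nonneg by (intro mult_right_mono) (auto simp: D_def)
        finally show ?thesis unfolding e by (simp add: mult.commute)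
      next
        case False
        then have "X \<notin> ball d (\<rho>/2)" "weight j X = 0" using w0 region_pos by (auto simp: D_def)
        then show ?thesis unfolding e by simp
      qed
    qed
    also have "\<dots> = Re (\<omega> * (\<integral>X. of_real (weight j X) * limit_amplitude X \<partial>lborel))"
      using i2 by (subst integral_Re) auto
    also have "\<dots> \<le> norm (\<integral>X. of_real (weight j X) * limit_amplitude X \<partial>lborel)"
      using complex_Re_le_cmod[of "\<omega> * (\<integral>X. of_real (weight j X) * limit_amplitude X \<partial>lborel)"] \<omega> by (simp add: norm_mult)
    finally show ?case
      using 1 norm_triangle_ineq2[of "\<integral>X. of_real (weight j X) * limit_amplitude X \<partial>lborel" "\<integral>X. of_real (weight j X) * amplitude j X \<partial>lborel"]
      by (simp add: norm_minus_commute)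
  qed
  then show ?thesis using c1 b by (intro exI[of _ "c1 * b / 2"]) auto
qed

subsection \<open>The gliding hump\<close>

text \<open>The second form has the minus sign outside the scalar multiplication, as simp leaves
  it.\<close>

lemmas finite_difference_test_dual' = finite_difference_test_dual finite_difference_test_dual[unfolded scaleR_minus_left]

lemma test_fun_nonzeroD:
  assumes "test_fun j y \<noteq> 0"
  shows "norm (fst y) \<le> (1/2) ^ j * \<rho>\<^sub>0" "\<bar>snd y $ k\<bar> \<le> (1/2) ^ j * \<rho>\<^sub>0" "2 powi (- int j * \<alpha>'' $ k) * a < snd y $ k"
proof -
  have y: "dilate_pair (int j) \<beta>' \<alpha>'' y \<in> test_box"
    using assms by (auto simp: test_fun_def indicator_def split: if_splits)
  have "norm (dilate (- int j) \<beta>' (dilate (int j) \<beta>' (fst y))) \<le> (1/2) ^ j * norm (dilate (int j) \<beta>' (fst y))"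
    by (rule norm_dilate_le[OF exponents_pos(3)])
  also have "\<dots> \<le> (1/2) ^ j * \<rho>\<^sub>0" using y by (intro mult_left_mono) (auto simp: test_box_def dilate_pair_def)
  finally show "norm (fst y) \<le> (1/2) ^ j * \<rho>\<^sub>0" by simp
  have "\<bar>snd y $ k\<bar> \<le> norm (snd y)" by (rule component_le_norm_cart)
  also have "norm (snd y) = norm (dilate (- int j) \<alpha>'' (dilate (int j) \<alpha>'' (snd y)))" by simp
  also have "\<dots> \<le> (1/2) ^ j * norm (dilate (int j) \<alpha>'' (snd y))"
    by (rule norm_dilate_le[OF exponents_pos(2)])
  also have "\<dots> \<le> (1/2) ^ j * \<rho>\<^sub>0" using y by (intro mult_left_mono) (auto simp: test_box_def dilate_pair_def)
  finally show "\<bar>snd y $ k\<bar> \<le> (1/2) ^ j * \<rho>\<^sub>0" .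
  have "a < 2 powi (int j * \<alpha>'' $ k) * snd y $ k" using y by (simp add: test_box_def dilate_pair_def)
  then have "2 powi (- (int j * \<alpha>'' $ k)) * a < 2 powi (- (int j * \<alpha>'' $ k)) * (2 powi (int j * \<alpha>'' $ k) * snd y $ k)"
    by (intro mult_strict_left_mono) auto
  then show "2 powi (- int j * \<alpha>'' $ k) * a < snd y $ k"
    by (simp add: power_int_minus field_simps)
qed

lemma half_power_rho_tendsto_0: "(\<lambda>i. (1/2::real) ^ i * c) \<longlonglongrightarrow> 0"
  by (intro tendsto_mult_left_zero LIMSEQ_power_zero) auto

text \<open>On the support of f_j the component y''_k exceeds a fixed positive number, while the
  support of f_i shrinks to the origin as i grows.\<close>

lemma eventually_test_fun_disjoint: "\<forall>\<^sub>F i in sequentially. \<forall>y. test_fun j y = 0 \<or> test_fun i y = 0"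
proof -
  have "\<forall>\<^sub>F i in sequentially. (1/2::real) ^ i * \<rho>\<^sub>0 < 2 powi (- int j * \<alpha>'' $ k) * a"
    using region_pos by (intro order_tendstoD(2)[OF half_power_rho_tendsto_0]) simp
  then show ?thesis
  proof eventually_elim
    case (elim i)
    show ?case
    proof (rule allI, rule ccontr)
      fix y assume "\<not> (test_fun j y = 0 \<or> test_fun i y = 0)"
      then show False using elim test_fun_nonzeroD(3)[of j y] test_fun_nonzeroD(2)[of i y] by auto
    qed
  qed
qed

text \<open>Replaces the continuity of the operator on \<open>L\<^sup>p\<close>, which is not among the hypotheses.\<close>

lemma eventually_tail_vanishes:
  "\<forall>\<^sub>F j in sequentially. \<forall>\<^sub>F i in sequentially. \<forall>x y. weight j (dX j x) \<noteq> 0 \<longrightarrow>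
      test_fun i (y, snd x + S (triple x y)) * \<psi> (triple x y) = 0"
proof -
  obtain \<epsilon> where \<epsilon>: "\<epsilon> > 0" "cball 0 \<epsilon> \<subseteq> U" using openU zeroU by (auto simp: open_contains_cball)
  \<comment> \<open>Uniform continuity gives a \<delta> that serves all x of the testing region at
    once; no derivative bound on S is involved.\<close>
  have uc: "uniformly_continuous_on (cball 0 \<epsilon>) (\<lambda>z. S z $ k)"
    by (intro compact_uniformly_continuous continuous_intros continuous_on_subset[OF contS] \<epsilon>) auto
  have "\<forall>\<^sub>F j in sequentially. (1/2::real) ^ j * (2 * \<rho>\<^sub>0) < \<epsilon> / 2"
    using \<epsilon> by (intro order_tendstoD(2)[OF half_power_rho_tendsto_0]) simp
  with eventually_weight_support eventually_ge_at_top[of n] show ?thesis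
  proof eventually_elim
    case (elim j)
    \<comment> \<open>In this unit x''_k is at least 4 b and S_k at (x, 0) at least -2 b. Passing
      from (x, 0) to (x, y) loses less than b, so x''_k + S_k exceeds b, while f_i is supported
      where this component is smaller than b in modulus.\<close>
    define b where "b = 2 powi (- int j * \<alpha>'' $ k) * a / 2"
    have b: "b > 0" using region_pos by (simp add: b_def)
    obtain \<delta> where \<delta>: "\<delta> > 0" "\<And>z z'. z \<in> cball 0 \<epsilon> \<Longrightarrow> z' \<in> cball 0 \<epsilon> \<Longrightarrow> dist z' z < \<delta> \<Longrightarrow> dist (S z' $ k) (S z $ k) < b"
      using uc b unfolding uniformly_continuous_on_def by metis
    have "\<forall>\<^sub>F i in sequentially. (1/2::real) ^ i * \<rho>\<^sub>0 < min b (min \<delta> (\<epsilon> / 2))"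
      using \<epsilon> \<delta> b by (intro order_tendstoD(2)[OF half_power_rho_tendsto_0]) simp
    then show ?case
    proof eventually_elim
      case (elim i)
      show ?case
      proof (intro allI impI, rule ccontr)
      fix x y assume x: "weight j (dX j x) \<noteq> 0" and nz: "test_fun i (y, snd x + S (triple x y)) * \<psi> (triple x y) \<noteq> 0"
      define X where "X = dX j x"
      have X: "X \<in> ball d \<rho>" using x \<open>\<forall>X. weight j X \<noteq> 0 \<longrightarrow> X \<in> ball d \<rho>\<close> by (auto simp only: X_def)
      have xX: "x = dX' j X" by (simp add: X_def)
      have t0: "triple x (0::real^'m) = dZ j X 0" by (simp add: dilate_triple_def xX)
      have "norm (triple x (0::real^'m)) \<le> (1/2) ^ j * (2 * norm X + norm (0::real^'m))"
        unfolding t0 by (rule norm_dilate_triple_le[OF exponents_pos(1-3)])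
      also have "\<dots> \<le> (1/2) ^ j * (2 * \<rho>\<^sub>0)" using region[OF X] by (intro mult_left_mono) auto
      finally have n0: "norm (triple x (0::real^'m)) < \<epsilon> / 2" using \<open>(1/2::real) ^ j * (2 * \<rho>\<^sub>0) < \<epsilon> / 2\<close> by simp
      have ny: "norm y < min b (min \<delta> (\<epsilon> / 2))" and v: "\<bar>(snd x + S (triple x y)) $ k\<bar> < b"
        using test_fun_nonzeroD(1,2)[of i "(y, snd x + S (triple x y))"] nz elim by auto
      \<comment> \<open>A nonzero value of f_i forces y to be small, so S at (x, y) can be compared
        with S at (x, 0), the point that \<open>region_S\<close> controls.\<close>
      have dty: "dist (triple x y) (triple x (0::real^'m)) = norm y"
        by (simp add: dist_norm triple_def norm_Pair)
      then have "norm (triple x y) \<le> norm (triple x (0::real^'m)) + norm y"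
        using norm_triangle_ineq2[of "triple x y" "triple x (0::real^'m)"] by (simp add: dist_norm)
      then have "dist (S (triple x y) $ k) (S (triple x (0::real^'m)) $ k) < b"
        using n0 ny \<epsilon>(1) dty by (intro \<delta>(2)) auto
      then have S1: "S (triple x y) $ k > S (triple x (0::real^'m)) $ k - b" by (simp add: dist_norm abs_less_iff)
      have S0: "S (triple x (0::real^'m)) $ k \<ge> - 2 * b"
      proof -
        have "2 powi (int j * \<alpha>'' $ k) * S (triple x (0::real^'m)) $ k \<ge> - a"
          using region_S[OF \<open>j \<ge> n\<close> X] unfolding t0 by linarith
        then have "2 powi (- (int j * \<alpha>'' $ k)) * (2 powi (int j * \<alpha>'' $ k) * S (triple x (0::real^'m)) $ k) \<ge> 2 powi (- (int j * \<alpha>'' $ k)) * - a"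
          by (intro mult_left_mono) auto
        then show ?thesis by (simp add: b_def power_int_minus field_simps)
      qed
      have "2 * a \<le> 2 powi (int j * \<alpha>'' $ k) * snd x $ k"
        using region[OF X] by (simp add: X_def dilate_pair_def)
      then have "2 powi (- (int j * \<alpha>'' $ k)) * (2 * a) \<le> 2 powi (- (int j * \<alpha>'' $ k)) * (2 powi (int j * \<alpha>'' $ k) * snd x $ k)"
        by (intro mult_left_mono) auto
      then have "4 * b \<le> snd x $ k" by (simp add: b_def power_int_minus field_simps)
      then show False using S0 S1 v by simp
      qed
    qed
  qed
qed

section \<open>Lebesgue norms and pairings of lacunary sums\<close>

lemma test_box_finite: "emeasure lborel test_box < \<infinity>"
proof -
  have "test_box \<subseteq> ball 0 \<rho>\<^sub>0 \<times> ball 0 \<rho>\<^sub>0" by (auto simp: test_box_def)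
  then have "bounded test_box" by (rule bounded_subset[rotated]) (intro bounded_Times bounded_ball)
  then show ?thesis by (rule emeasure_bounded_finite)
qed

lemma nn_integral_test_fun_powr:
  assumes "p > 0" "c \<ge> 0"
  shows "(\<integral>\<^sup>+y. ennreal (norm (of_real c * test_fun j y) powr p) \<partial>lborel)
     = ennreal (c powr p * (2 powi (- int j * (msize \<beta>' + msize \<alpha>'')) * measure lborel test_box))"
proof -
  let ?E = "{y. dilate_pair (int j) \<beta>' \<alpha>'' y \<in> test_box}"
  have fb: "test_box \<in> sets borel" using open_test_box by simp
  have [measurable]: "?E \<in> sets borel"
    using measurable_sets[OF dilate_pair_measurable fb, of "int j" \<beta>' \<alpha>''] by (simp add: vimage_def)
  have "norm (of_real c * test_fun j y) powr p = c powr p * indicator ?E y" for y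
    using assms by (auto simp: test_fun_def norm_mult indicator_def)
  then have "(\<integral>\<^sup>+y. ennreal (norm (of_real c * test_fun j y) powr p) \<partial>lborel) = (\<integral>\<^sup>+y. ennreal (c powr p) * indicator ?E y \<partial>lborel)"
    by (intro nn_integral_cong) (auto simp: indicator_def)
  also have "\<dots> = ennreal (c powr p) * emeasure lborel ?E" by (simp add: nn_integral_cmult)
  also have "emeasure lborel ?E = ennreal (measure lborel ?E)"
    using measure_dilate_pair(1)[OF fb test_box_finite, of "int j" \<beta>' \<alpha>''] by (intro emeasure_eq_ennreal_measure) auto
  also have "measure lborel ?E = 2 powi (- int j * (msize \<beta>' + msize \<alpha>'')) * measure lborel test_box"
    by (rule measure_dilate_pair(2)[OF fb test_box_finite])
  finally show ?thesis by (simp add: ennreal_mult')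
qed

lemma test_fun_Lp: assumes "p > 0" shows "test_fun j \<in> Lp_space p"
proof -
  have "integrable lborel (\<lambda>y. norm (test_fun j y) powr p)"
    using nn_integral_test_fun_powr[OF assms, of 1 j] by (intro integrableI_nonneg) auto
  then show ?thesis by (simp add: Lp_space_def)
qed

lemma averaging_test_fun_integrable:
  "integrable lborel (\<lambda>y. test_fun j (y, snd x + S (triple x y)) * \<psi> (triple x y))"
  and averaging_test_fun_bounded: "\<exists>B. \<forall>j x. norm (averaging_op S \<psi> (test_fun j) x) \<le> B"
proof -
  obtain M where M: "M > 0" "\<And>z. norm (\<psi> z) \<le> M" using psi_bounded by blast
  have i: "integrable lborel (\<lambda>y. M * indicator (cball (0::real^'m) \<rho>\<^sub>0) y)"
    by (intro integrable_mult_right integrable_real_indicator) (use emeasure_bounded_finite[OF bounded_cball] in auto)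
  have le: "norm (test_fun j (y, snd x + S (triple x y)) * \<psi> (triple x y)) \<le> M * indicator (cball 0 \<rho>\<^sub>0) y" for j x y
  proof (cases "test_fun j (y, snd x + S (triple x y)) = 0")
    case True then show ?thesis using M by simp
  next
    case False
    have "norm y \<le> (1/2) ^ j * \<rho>\<^sub>0" using test_fun_nonzeroD(1)[OF False] by simp
    also have "\<dots> \<le> 1 * \<rho>\<^sub>0" using region_pos by (intro mult_right_mono power_le_one) auto
    finally have "y \<in> cball 0 \<rho>\<^sub>0" by simp
    moreover have "norm (test_fun j (y, snd x + S (triple x y)) * \<psi> (triple x y)) \<le> 1 * M"
      unfolding norm_mult by (intro mult_mono M) (auto simp: test_fun_def norm_mult indicator_def)
    ultimately show ?thesis by simp
  qed
  have int: "integrable lborel (\<lambda>y. test_fun j (y, snd x + S (triple x y)) * \<psi> (triple x y))" for j x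
    by (rule Bochner_Integration.integrable_bound[OF i])
      (use averaging_slice_measurable[OF test_fun_measurable] M in \<open>auto intro!: order_trans[OF le]\<close>)
  then show "integrable lborel (\<lambda>y. test_fun j (y, snd x + S (triple x y)) * \<psi> (triple x y))" .
  have "norm (averaging_op S \<psi> (test_fun j) x) \<le> (\<integral>y. M * indicator (cball (0::real^'m) \<rho>\<^sub>0) y \<partial>lborel)" for j x
    unfolding averaging_op_eq by (rule Bochner_Integration.integral_norm_bound_integral[OF int i le])
  then show "\<exists>B. \<forall>j x. norm (averaging_op S \<psi> (test_fun j) x) \<le> B" by blast
qed

lemma pairing_integrable:
  assumes supp: "\<forall>X. weight j X \<noteq> 0 \<longrightarrow> X \<in> ball d \<rho>"
  shows "integrable lborel (\<lambda>x. averaging_op S \<psi> (test_fun i) x * finite_difference L (- shift j *\<^sub>R direction) (test_dual j) x)"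
proof -
  obtain B where B: "\<And>j x. norm (averaging_op S \<psi> (test_fun j) x) \<le> B" using averaging_test_fun_bounded by blast
  let ?E = "{x. dX j x \<in> ball d \<rho>}"
  have bm: "ball d \<rho> \<in> sets borel" "emeasure lborel (ball d \<rho>) < \<infinity>" using emeasure_bounded_finite[OF bounded_ball] by auto
  have E: "?E \<in> sets borel"
    using measurable_sets[OF dilate_pair_measurable bm(1), of "int j" \<alpha>' \<alpha>''] by (simp add: vimage_def)
  have i: "integrable lborel (\<lambda>x. (B * 2 ^ L) * indicator ?E x)"
    using E measure_dilate_pair(1)[OF bm, of "int j" \<alpha>' \<alpha>''] by (intro integrable_mult_right integrable_real_indicator) auto
  show ?thesis
  proof (rule Bochner_Integration.integrable_bound[OF i])
    have "(\<lambda>x. weight j (dX j x)) \<in> borel \<rightarrow>\<^sub>M borel"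
      by (rule measurable_compose[OF dilate_pair_measurable weight_measurable])
    then have "(\<lambda>x. of_real (weight j (dX j x)) * cis (- freq j * snd x $ k)) \<in> borel \<rightarrow>\<^sub>M (borel :: complex measure)"
      by (intro borel_measurable_times cis_snd_measurable) measurable
    from borel_measurable_times[OF averaging_op_measurable[OF test_fun_measurable] this]
    show "(\<lambda>x. averaging_op S \<psi> (test_fun i) x * finite_difference L (- shift j *\<^sub>R direction) (test_dual j) x) \<in> borel_measurable lborel"
      unfolding finite_difference_test_dual minus_mult_left by simp
    show "AE x in lborel. norm (averaging_op S \<psi> (test_fun i) x * finite_difference L (- shift j *\<^sub>R direction) (test_dual j) x)
        \<le> norm ((B * 2 ^ L) * indicator ?E x)"
    proof (intro AE_I2)
      fix x
      have B0: "B \<ge> 0" using order_trans[OF norm_ge_zero B] .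
      show "norm (averaging_op S \<psi> (test_fun i) x * finite_difference L (- shift j *\<^sub>R direction) (test_dual j) x) \<le> norm ((B * 2 ^ L) * indicator ?E x)"
      proof (cases "weight j (dX j x) = 0")
        case True then show ?thesis by (simp add: finite_difference_test_dual')
      next
        case False
        then have "x \<in> ?E" using supp by blast
        moreover have "norm (averaging_op S \<psi> (test_fun i) x) * \<bar>weight j (dX j x)\<bar> \<le> B * 2 ^ L"
          using weight_le weight_nonneg B B0 by (intro mult_mono) auto
        ultimately show ?thesis using B0 by (simp add: finite_difference_test_dual' norm_mult)
      qed
    qed
  qed
qed

text \<open>Where the weight of scale \<sigma> m is nonzero, the integrand of the average contains
  only the terms up to m. The series is thus cut to a finite sum before T is applied, and no limit
  has to be exchanged with T.\<close>

lemma pairing_lacunary_sum: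
  fixes c :: "nat \<Rightarrow> complex" and \<sigma> :: "nat \<Rightarrow> nat"
  assumes supp: "\<forall>X. weight (\<sigma> m) X \<noteq> 0 \<longrightarrow> X \<in> ball d \<rho>"
    and tail: "\<And>i x y. i > m \<Longrightarrow> weight (\<sigma> m) (dX (\<sigma> m) x) \<noteq> 0 \<Longrightarrow> test_fun (\<sigma> i) (y, snd x + S (triple x y)) * \<psi> (triple x y) = 0"
  shows "pairing (\<sigma> m) (averaging_op S \<psi> (\<lambda>y. \<Sum>i. c i * test_fun (\<sigma> i) y)) = (\<Sum>i\<le>m. c i * pairing (\<sigma> m) (averaging_op S \<psi> (test_fun (\<sigma> i))))"
proof -
  let ?F = "\<lambda>y. \<Sum>i. c i * test_fun (\<sigma> i) y"
  have "averaging_op S \<psi> ?F x = (\<Sum>i\<le>m. c i * averaging_op S \<psi> (test_fun (\<sigma> i)) x)" if x: "weight (\<sigma> m) (dX (\<sigma> m) x) \<noteq> 0" for x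
  proof -
    have "?F (y, snd x + S (triple x y)) * \<psi> (triple x y)
        = (\<Sum>i\<le>m. c i * (test_fun (\<sigma> i) (y, snd x + S (triple x y)) * \<psi> (triple x y)))" for y
    proof (cases "\<psi> (triple x y) = 0")
      case False
      have "test_fun (\<sigma> i) (y, snd x + S (triple x y)) = 0" if "i \<notin> {..m}" for i
        using tail[OF _ x, of i y] that False by auto
      then have "?F (y, snd x + S (triple x y)) = (\<Sum>i\<le>m. c i * test_fun (\<sigma> i) (y, snd x + S (triple x y)))"
        by (intro suminf_finite) auto
      then show ?thesis by (simp add: sum_distrib_right mult.assoc)
    qed simp
    then have "averaging_op S \<psi> ?F x = (\<integral>y. (\<Sum>i\<le>m. c i * (test_fun (\<sigma> i) (y, snd x + S (triple x y)) * \<psi> (triple x y))) \<partial>lborel)"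
      unfolding averaging_op_eq by (intro Bochner_Integration.integral_cong refl)
    also have "\<dots> = (\<Sum>i\<le>m. c i * averaging_op S \<psi> (test_fun (\<sigma> i)) x)"
      unfolding averaging_op_eq using averaging_test_fun_integrable
      by (subst Bochner_Integration.integral_sum) (auto intro!: integrable_mult_right sum.cong)
    finally show ?thesis .
  qed
  then have "averaging_op S \<psi> ?F x * finite_difference L (- shift (\<sigma> m) *\<^sub>R direction) (test_dual (\<sigma> m)) x
     = (\<Sum>i\<le>m. c i * (averaging_op S \<psi> (test_fun (\<sigma> i)) x * finite_difference L (- shift (\<sigma> m) *\<^sub>R direction) (test_dual (\<sigma> m)) x))" for x
    by (cases "weight (\<sigma> m) (dX (\<sigma> m) x) = 0") (auto simp: finite_difference_test_dual' sum_distrib_right mult.assoc)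
  then have "pairing (\<sigma> m) (averaging_op S \<psi> ?F)
      = (\<integral>x. (\<Sum>i\<le>m. c i * (averaging_op S \<psi> (test_fun (\<sigma> i)) x * finite_difference L (- shift (\<sigma> m) *\<^sub>R direction) (test_dual (\<sigma> m)) x)) \<partial>lborel)"
    unfolding pairing_def by (intro Bochner_Integration.integral_cong refl)
  also have "\<dots> = (\<Sum>i\<le>m. c i * pairing (\<sigma> m) (averaging_op S \<psi> (test_fun (\<sigma> i))))"
    unfolding pairing_def using pairing_integrable[OF supp]
    by (subst Bochner_Integration.integral_sum) (auto intro!: integrable_mult_right sum.cong)
  finally show ?thesis .
qed

text \<open>With disjoint supports at most one term is nonzero at each point, so the p-th powers of
  the moduli add up and only their integrals have to be summable.\<close>

lemma lacunary_sum_Lp: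
  fixes c :: "nat \<Rightarrow> real" and \<sigma> :: "nat \<Rightarrow> nat"
  assumes p: "p > 0" and c: "\<And>i. c i \<ge> 0" and disj: "\<And>i i' y. i < i' \<Longrightarrow> test_fun (\<sigma> i) y = 0 \<or> test_fun (\<sigma> i') y = 0"
    and summ: "summable (\<lambda>i. c i powr p * 2 powi (- int (\<sigma> i) * (msize \<beta>' + msize \<alpha>'')))"
  shows "(\<lambda>y. \<Sum>i. of_real (c i) * test_fun (\<sigma> i) y) \<in> Lp_space p"
proof -
  let ?t = "\<lambda>i y. of_real (c i) * test_fun (\<sigma> i) y"
  have unique: "\<exists>m. \<forall>i. i \<noteq> m \<longrightarrow> test_fun (\<sigma> i) y = 0" for y
    using disj[of _ _ y] by (metis nat_neq_iff)
  have sums: "(\<lambda>i. ?t i y) sums (\<Sum>i. ?t i y)" for y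
  proof -
    obtain m where "\<forall>i. i \<noteq> m \<longrightarrow> test_fun (\<sigma> i) y = 0" using unique by blast
    then show ?thesis by (intro summable_sums summable_finite[of "{m}"]) auto
  qed
  have meas [measurable]: "(\<lambda>y. \<Sum>i. ?t i y) \<in> borel \<rightarrow>\<^sub>M borel"
  proof (rule borel_measurable_LIMSEQ_metric)
    show "(\<lambda>y. \<Sum>i<N. ?t i y) \<in> borel \<rightarrow>\<^sub>M borel" for N by measurable
    show "(\<lambda>N. \<Sum>i<N. ?t i y) \<longlonglongrightarrow> (\<Sum>i. ?t i y)" for y using sums[of y] by (simp add: sums_def)
  qed
  have "(\<integral>\<^sup>+y. ennreal (norm (\<Sum>i. ?t i y) powr p) \<partial>lborel) \<le> (\<integral>\<^sup>+y. (\<Sum>i. ennreal (norm (?t i y) powr p)) \<partial>lborel)"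
  proof (rule nn_integral_mono)
    fix y
    obtain m where m: "\<forall>i. i \<noteq> m \<longrightarrow> test_fun (\<sigma> i) y = 0" using unique by blast
    have "(\<Sum>i. ?t i y) = (\<Sum>i\<in>{m}. ?t i y)" using m by (intro suminf_finite) auto
    then have "ennreal (norm (\<Sum>i. ?t i y) powr p) = (\<Sum>i\<in>{m}. ennreal (norm (?t i y) powr p))" by simp
    also have "\<dots> \<le> (\<Sum>i. ennreal (norm (?t i y) powr p))" by (intro sum_le_suminf) auto
    finally show "ennreal (norm (\<Sum>i. ?t i y) powr p) \<le> (\<Sum>i. ennreal (norm (?t i y) powr p))" .
  qed
  also have "\<dots> = (\<Sum>i. \<integral>\<^sup>+y. ennreal (norm (?t i y) powr p) \<partial>lborel)"
    by (rule nn_integral_suminf) measurable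
  also have "\<dots> = (\<Sum>i. ennreal (c i powr p * (2 powi (- int (\<sigma> i) * (msize \<beta>' + msize \<alpha>'')) * measure lborel test_box)))"
    using nn_integral_test_fun_powr[OF p c] by simp
  also have "\<dots> < \<infinity>"
    using summable_mult2[OF summ, of "measure lborel test_box"]
    by (subst suminf_ennreal2) (auto simp: mult.assoc)
  finally have "integrable lborel (\<lambda>y. norm (\<Sum>i. ?t i y) powr p)"
    by (intro integrableI_nonneg) auto
  then show ?thesis using meas by (simp add: Lp_space_def)
qed

section \<open>Decay of the pairings and the contradiction\<close>

text \<open>The difference estimate with step \<open>shift j\<close> and the dilated ball as the set
  E. The constant is uniform in j for fixed u; between different u nothing is claimed.\<close>

lemma pairing_Sobolev_le:
  assumes u: "u \<in> Sobolev_space s p" and s: "0 < s" "s < real L" and p: "p > 1"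
  shows "\<exists>C\<ge>0. \<forall>j. norm (pairing j u) \<le> C * (2 powi (- int j * \<beta>'' $ k)) powr s
      * (2 powi (- int j * (msize \<alpha>' + msize \<alpha>''))) powr (1 - 1/p)"
proof -
  let ?W = "ball d (\<rho>/2)"
  obtain C where C: "C \<ge> 0" "\<And>h E g. h > 0 \<Longrightarrow> E \<in> sets borel \<Longrightarrow> emeasure lborel E < \<infinity> \<Longrightarrow> measure lborel E > 0 \<Longrightarrow>
      g \<in> borel_measurable borel \<Longrightarrow> (\<forall>x. norm (g x) \<le> indicator E x) \<Longrightarrow>
      norm (\<integral>x. u x * finite_difference L (- h *\<^sub>R direction) g x \<partial>lborel) \<le> C * h powr s * measure lborel E powr (1 - 1/p)"
    using Sobolev_space_difference_pairing_le[OF u s(1) p norm_direction s(2)] by blast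
  have W: "?W \<in> sets borel" "emeasure lborel ?W < \<infinity>" using emeasure_bounded_finite[OF bounded_ball] by auto
  have Wpos: "measure lborel ?W > 0" using content_ball_pos[of "\<rho>/2" d] region_pos by simp
  have "norm (pairing j u) \<le> (C * pi powr s * measure lborel ?W powr (1 - 1/p)) * (2 powi (- int j * \<beta>'' $ k)) powr s
      * (2 powi (- int j * (msize \<alpha>' + msize \<alpha>''))) powr (1 - 1/p)" for j
  proof -
    let ?E = "{x. dX j x \<in> ?W}"
    have E: "?E \<in> sets borel"
      using measurable_sets[OF dilate_pair_measurable W(1), of "int j" \<alpha>' \<alpha>''] by (simp add: vimage_def)
    have mE: "measure lborel ?E = 2 powi (- int j * (msize \<alpha>' + msize \<alpha>'')) * measure lborel ?W"
      by (rule measure_dilate_pair(2)[OF W])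
    have "norm (pairing j u) \<le> C * shift j powr s * measure lborel ?E powr (1 - 1/p)"
      unfolding pairing_def
    proof (rule C(2)[OF shift_pos E measure_dilate_pair(1)[OF W] _ test_dual_measurable])
      show "measure lborel ?E > 0" unfolding mE using Wpos by simp
      show "\<forall>x. norm (test_dual j x) \<le> indicator ?E x" by (auto simp: test_dual_def norm_mult indicator_def)
    qed
    also have "shift j = pi * 2 powi (- int j * \<beta>'' $ k)"
      by (simp add: shift_def freq_def power_int_minus divide_inverse)
    finally show ?thesis unfolding mE using Wpos by (simp add: powr_mult mult_ac)
  qed
  moreover have "C * pi powr s * measure lborel ?W powr (1 - 1/p) \<ge> 0" using C(1) by simp
  ultimately show ?thesis by blast
qed

lemma regularity_bound:
  assumes s: "0 < s" "s < real L" and p: "1 < p"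
    and bdd: "\<And>f. f \<in> Lp_space p \<Longrightarrow> averaging_op S \<psi> f \<in> Sobolev_space s p"
  shows "s * real_of_int (\<beta>'' $ k) \<le> real_of_int (msize \<alpha>') / p + real_of_int (msize \<beta>') * (1 - 1 / p)"
proof (rule ccontr)
  assume neg: "\<not> ?thesis"
  define A1 A2 B1 b where "A1 = real_of_int (msize \<alpha>')" and "A2 = real_of_int (msize \<alpha>'')"
    and "B1 = real_of_int (msize \<beta>')" and "b = real_of_int (\<beta>'' $ k)"
  \<comment> \<open>The amount by which the asserted inequality is supposed to fail.\<close>
  define \<delta> where "\<delta> = s * b - A1 / p - B1 * (1 - 1 / p)"
  have \<delta>: "\<delta> > 0" using neg by (simp add: \<delta>_def A1_def B1_def b_def)
  have powi: "(2::real) powi m = 2 powr (real_of_int m)" for m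
    by (simp add: powr_real_of_int')
  \<comment> \<open>Up to constants this is h^s |E|^(1 - 1/p) at scale j, the decay that every
    pairing with a function of the Sobolev space must show.\<close>
  define \<kappa> where "\<kappa> j = 2 powr (- real j * (b * s + (A1 + A2) * (1 - 1/p)))" for j :: nat
  have \<kappa>pos: "\<kappa> j > 0" for j by (simp add: \<kappa>_def)
  have upper: "\<exists>C\<ge>0. \<forall>j. norm (pairing j (averaging_op S \<psi> f)) \<le> C * \<kappa> j" if f: "f \<in> Lp_space p" for f
  proof -
    have "(2 powi (- int j * \<beta>'' $ k)) powr s * (2 powi (- int j * (msize \<alpha>' + msize \<alpha>''))) powr (1 - 1/p) = \<kappa> j" for j
      unfolding powi \<kappa>_def powr_powr A1_def A2_def b_def
      by (subst powr_add[symmetric]) (simp add: algebra_simps)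
    then show ?thesis
      using pairing_Sobolev_le[OF bdd[OF f] s p] by (simp add: mult.assoc)
  qed
  have fL: "test_fun i \<in> Lp_space p" for i using p by (intro test_fun_Lp) simp
  have "\<forall>i. \<exists>C\<ge>0. \<forall>j. norm (pairing j (averaging_op S \<psi> (test_fun i))) \<le> C * \<kappa> j" using upper[OF fL] by blast
  then obtain K where K: "\<And>i. K i \<ge> 0" "\<And>i j. norm (pairing j (averaging_op S \<psi> (test_fun i))) \<le> K i * \<kappa> j"
    by metis
  \<comment> \<open>The exponent (B1 + A2) / p normalizes f_j in L^p. Half of the gap \<delta> is
    given away to make the sum converge in L^p; the other half remains as growth 2^(j \<delta> / 2)
    of the pairing relative to \<kappa>.\<close>
  define c where "c j = 2 powr (real j * ((B1 + A2) / p - \<delta> / 2))" for j :: nat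
  have cpos: "c j > 0" for j by (simp add: c_def)
  obtain c0 where c0: "c0 > 0" "\<forall>\<^sub>F j in sequentially. c0 \<le> norm (\<integral>X. of_real (weight j X) * amplitude j X \<partial>lborel)"
    using eventually_amplitude_lower_bound by blast
  have lower: "c j * norm (pairing j (averaging_op S \<psi> (test_fun j))) \<ge> c0 * 2 powr (real j * (\<delta> / 2)) * \<kappa> j"
    if "c0 \<le> norm (\<integral>X. of_real (weight j X) * amplitude j X \<partial>lborel)" for j
  proof -
    have "c j * 2 powi (- int j * (msize \<alpha>' + msize \<alpha>'' + msize \<beta>')) = 2 powr (real j * (\<delta> / 2)) * \<kappa> j"
      unfolding c_def powi \<kappa>_def powr_add[symmetric] using p
      by (simp add: \<delta>_def A1_def A2_def B1_def b_def field_simps)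
    then have "c0 * 2 powr (real j * (\<delta> / 2)) * \<kappa> j = c j * 2 powi (- int j * (msize \<alpha>' + msize \<alpha>'' + msize \<beta>')) * c0"
      by (simp add: mult_ac)
    also have "\<dots> \<le> c j * 2 powi (- int j * (msize \<alpha>' + msize \<alpha>'' + msize \<beta>')) * norm (\<integral>X. of_real (weight j X) * amplitude j X \<partial>lborel)"
      using that cpos[of j] by (intro mult_left_mono) auto
    also have "\<dots> = c j * norm (pairing j (averaging_op S \<psi> (test_fun j)))"
      unfolding pairing_test_fun by simp
    finally show ?thesis .
  qed
  define R where "R j i \<longleftrightarrow> (\<forall>y. test_fun j y = 0 \<or> test_fun i y = 0) \<and>
      (\<forall>x y. weight j (dX j x) \<noteq> 0 \<longrightarrow> test_fun i (y, snd x + S (triple x y)) * \<psi> (triple x y) = 0)" for j i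
  have "\<forall>\<^sub>F j in sequentially. (\<forall>\<^sub>F i in sequentially. R j i) \<and> (\<forall>X. weight j X \<noteq> 0 \<longrightarrow> X \<in> ball d \<rho>)
      \<and> c0 \<le> norm (\<integral>X. of_real (weight j X) * amplitude j X \<partial>lborel)"
    using eventually_tail_vanishes eventually_weight_support c0(2)
  proof eventually_elim
    case (elim j)
    have "\<forall>\<^sub>F i in sequentially. R j i"
      using eventually_test_fun_disjoint[of j] elim(1) unfolding R_def by (rule eventually_conj)
    then show ?case using elim by blast
  qed
  then obtain j0 where j0: "\<And>j. j \<ge> j0 \<Longrightarrow> \<forall>\<^sub>F i in sequentially. R j i"
      "\<And>j. j \<ge> j0 \<Longrightarrow> \<forall>X. weight j X \<noteq> 0 \<longrightarrow> X \<in> ball d \<rho>"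
      "\<And>j. j \<ge> j0 \<Longrightarrow> c0 \<le> norm (\<integral>X. of_real (weight j X) * amplitude j X \<partial>lborel)"
    unfolding eventually_sequentially[of "\<lambda>j. _ j \<and> _ j"] by blast
  have growth: "filterlim (\<lambda>j. c0 * 2 powr (real j * (\<delta> / 2))) at_top sequentially"
  proof -
    have "filterlim (\<lambda>j. (\<delta> / 2 * ln 2) * real j) at_top sequentially"
      using \<delta> by (intro filterlim_tendsto_pos_mult_at_top[OF tendsto_const _ filterlim_real_sequentially]) auto
    then have "filterlim (\<lambda>j. c0 * exp ((\<delta> / 2 * ln 2) * real j)) at_top sequentially"
      by (rule filterlim_tendsto_pos_mult_at_top[OF tendsto_const c0(1) filterlim_compose[OF exp_at_top]])
    then show ?thesis by (simp add: powr_def mult_ac)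
  qed
  \<comment> \<open>The growth at the new scale is to beat the total contribution of the earlier
    pieces, each measured with its own constant K, by at least m.\<close>
  obtain \<sigma> where \<sigma>: "strict_mono \<sigma>" "\<And>m. \<sigma> m \<ge> j0" "\<And>m n. m < n \<Longrightarrow> R (\<sigma> m) (\<sigma> n)"
     "\<And>m. c0 * 2 powr (real (\<sigma> (Suc m)) * (\<delta> / 2)) \<ge> real m + (\<Sum>i\<le>m. c (\<sigma> i) * K (\<sigma> i))"
  proof -
    have "c i * K i \<ge> 0" for i using cpos[of i] K(1)[of i] by simp
    then have "\<exists>\<sigma>. strict_mono \<sigma> \<and> (\<forall>m. \<sigma> m \<ge> j0) \<and> (\<forall>m n. m < n \<longrightarrow> R (\<sigma> m) (\<sigma> n)) \<and>
        (\<forall>m. c0 * 2 powr (real (\<sigma> (Suc m)) * (\<delta> / 2)) \<ge> real m + (\<Sum>i\<le>m. c (\<sigma> i) * K (\<sigma> i)))"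
      by (intro lacunary_subsequence j0(1) growth)
    then show ?thesis using that by blast
  qed
  define F where "F = (\<lambda>y. \<Sum>i. of_real (c (\<sigma> i)) * test_fun (\<sigma> i) y)"
  have "F \<in> Lp_space p"
    unfolding F_def
  proof (rule lacunary_sum_Lp)
    show "test_fun (\<sigma> i) y = 0 \<or> test_fun (\<sigma> i') y = 0" if "i < i'" for i i' y using \<sigma>(3)[OF that] unfolding R_def by blast
    \<comment> \<open>The p-th power of the norm of \<open>c j\<close> times f_j is a constant times
      q ^ j; the ratio is below 1 thanks to the half of \<delta> given away in c.\<close>
    define q where "q = 2 powr (- \<delta> * p / 2)"
    have "- \<delta> * p / 2 < 0" using \<delta> p by simp
    then have q: "0 < q" "q < 1" unfolding q_def by (auto simp: powr_less_one)
    have eq: "c j powr p * 2 powi (- int j * (msize \<beta>' + msize \<alpha>'')) = q ^ j" for j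
    proof -
      have "c j powr p * 2 powi (- int j * (msize \<beta>' + msize \<alpha>'')) = 2 powr (- \<delta> * p / 2 * real j)"
        unfolding c_def powi powr_powr powr_add[symmetric] using p
        by (simp add: A2_def B1_def field_simps)
      also have "\<dots> = q ^ j" using q(1) by (simp add: q_def powr_powr flip: powr_realpow)
      finally show ?thesis .
    qed
    show "summable (\<lambda>i. c (\<sigma> i) powr p * 2 powi (- int (\<sigma> i) * (msize \<beta>' + msize \<alpha>'')))"
      unfolding eq
    proof (rule summable_comparison_test'[OF summable_geometric[of q]])
      show "norm (q ^ \<sigma> i) \<le> q ^ i" for i
        using q strict_mono_imp_increasing[OF \<sigma>(1), of i] by (simp add: power_decreasing)
    qed (use q in auto)
  qed (use p cpos less_imp_le in auto)
  then obtain CF where CF: "\<And>j. norm (pairing j (averaging_op S \<psi> F)) \<le> CF * \<kappa> j" using upper by blast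
  \<comment> \<open>The sum is tested at scale \<sigma> (Suc m): later pieces vanish there, the
    earlier ones are those with index up to m, and CF \<kappa> bounds the whole. After division by
    \<kappa> the surplus m is left, and CF does not depend on m.\<close>
  have "real m \<le> CF" for m
  proof -
    let ?j = "\<sigma> (Suc m)"
    have "pairing ?j (averaging_op S \<psi> F) = (\<Sum>i\<le>Suc m. of_real (c (\<sigma> i)) * pairing ?j (averaging_op S \<psi> (test_fun (\<sigma> i))))"
      unfolding F_def
    proof (rule pairing_lacunary_sum)
      show "\<forall>X. weight ?j X \<noteq> 0 \<longrightarrow> X \<in> ball d \<rho>" by (rule j0(2)[OF \<sigma>(2)])
      fix i x y assume "Suc m < i" "weight ?j (dX ?j x) \<noteq> 0"
      then show "test_fun (\<sigma> i) (y, snd x + S (triple x y)) * \<psi> (triple x y) = 0"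
        using \<sigma>(3)[of "Suc m" i] unfolding R_def by blast
    qed
    then have "of_real (c ?j) * pairing ?j (averaging_op S \<psi> (test_fun ?j)) = pairing ?j (averaging_op S \<psi> F)
        - (\<Sum>i\<le>m. of_real (c (\<sigma> i)) * pairing ?j (averaging_op S \<psi> (test_fun (\<sigma> i))))" by simp
    then have "norm (of_real (c ?j) * pairing ?j (averaging_op S \<psi> (test_fun ?j))) = norm (pairing ?j (averaging_op S \<psi> F)
        - (\<Sum>i\<le>m. of_real (c (\<sigma> i)) * pairing ?j (averaging_op S \<psi> (test_fun (\<sigma> i)))))"
      by (rule arg_cong)
    then have "c ?j * norm (pairing ?j (averaging_op S \<psi> (test_fun ?j))) = norm (pairing ?j (averaging_op S \<psi> F)
        - (\<Sum>i\<le>m. of_real (c (\<sigma> i)) * pairing ?j (averaging_op S \<psi> (test_fun (\<sigma> i)))))"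
      by (simp only: norm_mult norm_of_real abs_of_pos[OF cpos])
    also have "\<dots> \<le> norm (pairing ?j (averaging_op S \<psi> F))
        + norm (\<Sum>i\<le>m. of_real (c (\<sigma> i)) * pairing ?j (averaging_op S \<psi> (test_fun (\<sigma> i))))"
      by (rule norm_triangle_ineq4)
    also have "\<dots> \<le> CF * \<kappa> ?j + (\<Sum>i\<le>m. c (\<sigma> i) * (K (\<sigma> i) * \<kappa> ?j))"
      using cpos by (intro add_mono CF sum_norm_le) (simp add: norm_mult less_imp_le mult_left_mono K(2))
    also have "\<dots> = (CF + (\<Sum>i\<le>m. c (\<sigma> i) * K (\<sigma> i))) * \<kappa> ?j"
      by (simp add: distrib_right sum_distrib_right mult.assoc)
    finally have "c ?j * norm (pairing ?j (averaging_op S \<psi> (test_fun ?j))) \<le> (CF + (\<Sum>i\<le>m. c (\<sigma> i) * K (\<sigma> i))) * \<kappa> ?j" .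
    with lower[OF j0(3)[OF \<sigma>(2)], of "Suc m"]
    have "c0 * 2 powr (real ?j * (\<delta> / 2)) * \<kappa> ?j \<le> (CF + (\<Sum>i\<le>m. c (\<sigma> i) * K (\<sigma> i))) * \<kappa> ?j" by linarith
    then have "c0 * 2 powr (real ?j * (\<delta> / 2)) \<le> CF + (\<Sum>i\<le>m. c (\<sigma> i) * K (\<sigma> i))"
      using \<kappa>pos[of ?j] by simp
    then show ?thesis using \<sigma>(4)[of m] by linarith
  qed
  then show False using reals_Archimedean2[of CF] by (meson not_less)
qed

end

lemma homogeneous_averaging_regularity_bound:
  fixes S SP :: "(real^'m) \<times> (real^'k) \<times> (real^'m) \<Rightarrow> (real^'k)"
  assumes U: "open U" "0 \<in> U" "smooth_on U S"
    and hom: "homogeneity_conditions S \<alpha>' \<alpha>'' \<beta>' \<beta>'' SP"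
    and \<psi>: "cutoff U \<psi>" "\<psi> 0 \<noteq> 0" and s: "0 \<le> s" and p: "1 < p"
    and bdd: "\<And>f. f \<in> Lp_space p \<Longrightarrow> averaging_op S \<psi> f \<in> Sobolev_space s p"
  shows "s * real_of_int (\<beta>'' $ k) \<le> real_of_int (msize \<alpha>') / p + real_of_int (msize \<beta>') * (1 - 1 / p)"
proof (cases "s = 0")
  case True
  \<comment> \<open>The kernel estimates require s > 0. For s = 0 the left-hand side is 0 and the
    right-hand side is nonnegative.\<close>
  have "msize \<alpha>' \<ge> 0" "msize \<beta>' \<ge> 0"
    using hom unfolding homogeneity_conditions_def msize_def by (auto intro!: sum_nonneg simp: less_imp_le)
  then show ?thesis using True p by simp
next
  case False
  have cont: "continuous_on U S"
    using U(3) by (rule smooth_on_imp_continuous_on)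
  obtain \<rho>\<^sub>0 a d \<rho> n where reg: "\<rho>\<^sub>0 > 0" "a > 0" "\<rho> > 0"
     "\<forall>X Y. norm X < \<rho>\<^sub>0 \<longrightarrow> norm Y < \<rho>\<^sub>0 \<longrightarrow> \<bar>SP (triple X Y) $ k - SP 0 $ k\<bar> \<le> 1"
     "\<forall>X\<in>ball d \<rho>. norm X < \<rho>\<^sub>0 \<and> 2 * a \<le> snd X $ k"
     "\<forall>j\<ge>n. \<forall>X\<in>ball d \<rho>. \<bar>2 powi (int j * \<alpha>'' $ k) * S (dilate_triple \<alpha>' \<alpha>'' \<beta>' j X 0) $ k\<bar> \<le> a"
    using homogeneity_test_region[OF hom U(1,2) cont, of k] by blast
  obtain L :: nat where L: "s < real L" using reals_Archimedean2 by blast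
  interpret averaging_test S SP U \<alpha>' \<beta>' \<alpha>'' \<beta>'' \<psi> k \<rho>\<^sub>0 a \<rho> d n L
    by unfold_locales (use U(1,2) cont hom \<psi> reg in blast)+
  show ?thesis using regularity_bound[OF _ L p bdd] False s by simp
qed

theorem mainTheorem5:
  fixes S SP :: "(real^'m) \<times> (real^'k) \<times> (real^'m) \<Rightarrow> (real^'k)"
    and U :: "((real^'m) \<times> (real^'k) \<times> (real^'m)) set"
    and \<alpha>' \<beta>' :: "(int^'m)"
    and \<alpha>'' \<beta>'' :: "(int^'k)"
    and r :: nat
  assumes "open U" and "0 \<in> U" and "smooth_on U S"
    and "homogeneity_conditions S \<alpha>' \<alpha>'' \<beta>' \<beta>'' SP"
    and "0 < r" and "rank_condition SP r"
    and "real r / real CARD('k) >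
           real_of_int (msize \<alpha>' + msize \<beta>') / real_of_int (msize \<beta>'')"
  shows "\<exists>\<epsilon>>0. \<forall>(\<psi> :: (real^'m) \<times> (real^'k) \<times> (real^'m) \<Rightarrow> complex) (s::real) (p::real).
           cutoff U \<psi> \<longrightarrow> \<psi> 0 \<noteq> 0 \<longrightarrow> closure {z. \<psi> z \<noteq> 0} \<subseteq> ball 0 \<epsilon> \<longrightarrow>
           0 \<le> s \<longrightarrow> 1 < p \<longrightarrow>
           (\<forall>f \<in> Lp_space p. averaging_op S \<psi> f \<in> Sobolev_space s p) \<longrightarrow>
           s * real_of_int (Max (range (\<lambda>k. \<beta>'' $ k)))
             \<le> real_of_int (msize \<alpha>') / p + real_of_int (msize \<beta>') * (1 - 1 / p)"
\<comment> \<open>The lower bound sees \<psi> through its limit \<psi> 0 along the contracting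
  dilations, so the radius can be fixed in advance.\<close>
proof (intro exI[of _ 1] conjI allI impI)
  fix \<psi> :: "(real^'m) \<times> (real^'k) \<times> (real^'m) \<Rightarrow> complex" and s p :: real
  assume \<psi>: "cutoff U \<psi>" "\<psi> 0 \<noteq> 0" and sp: "0 \<le> s" "1 < p"
    and bdd: "\<forall>f \<in> Lp_space p. averaging_op S \<psi> f \<in> Sobolev_space s p"
  have "Max (range (\<lambda>k. \<beta>'' $ k)) \<in> range (\<lambda>k. \<beta>'' $ k)" by (rule Max_in) auto
  then obtain k where k: "Max (range (\<lambda>k. \<beta>'' $ k)) = \<beta>'' $ k" by blast
  show "s * real_of_int (Max (range (\<lambda>k. \<beta>'' $ k)))
             \<le> real_of_int (msize \<alpha>') / p + real_of_int (msize \<beta>') * (1 - 1 / p)"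
    unfolding k using bdd
    by (intro homogeneous_averaging_regularity_bound[OF assms(1-4) \<psi> sp]) blast
qed simp

end
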